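(* Let $\mathcal O$ be an operad in $\mathcal V$, let $A$ be an $\mathcal O$-algebra in $\mathcal C$, let $f\colon Y\to Z$ be a map in $\mathcal C$, let $g\colon \mathcal F_{\mathcal O}(Y)\to A$ be an $\mathcal O$-algebra map, and let $\bar g\colon Y\to A$ be the map in $\mathcal C$ adjoint to $g$. Then there is a sequence in $\mathcal C$ $$A=B_0\xrightarrow{\varphi_1}B_1\to\cdots\to B_{t-1}\xrightarrow{\varphi_t}B_t\to\cdots$$ such that, for each $t\ge 1$, the morphism $\varphi_t$ is given by a push-out square $$\begin{array}{ccc}\bullet&\xrightarrow{\ \mathcal O_A(t)(f,\dots,f)\ }&\bullet\\ {\scriptstyle\psi_t}\downarrow&&\downarrow{\scriptstyle\bar\psi_t}\\ B_{t-1}&\xrightarrow{\ \varphi_t\ }&B_t\end{array}$$ whose top arrow is the latching map of $\mathcal O_A(t)(f,\dots,f)\colon\mathbf 2^t\to\mathcal C$ at $(1,\dots,1)$, and where the attaching map $\psi_t$ is (well) defined by the following maps, $1\le i\le t$: $$\mathcal O_A(t)(\underbrace{Z,\dots,Z}_{i-1},Y,\underbrace{Z,\dots,Z}_{t-i})\longrightarrow \mathcal O_A(t)(\underbrace{Z,\dots,Z}_{i-1},A,\underbrace{Z,\dots,Z}_{t-i})\xrightarrow{\ \circ_i\ }\mathcal O_A(t-1)(\underbrace{Z,\dots,Z}_{t-1})\longrightarrow B_{t-1}.$$ Here the first map is induced by $\bar g\colon Y\to A=\mathcal O_A(0)$, the second one is the functor-operad composition, and the third one is $\bar\psi_{t-1}$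 if $t>1$ and the identity of $A$ if $t=1$.
   Context: Setting. $\mathcal V$ is a bicomplete closed symmetric monoidal category and $\mathcal C$ is a bicomplete biclosed monoidal category, possibly nonsymmetric; $\otimes$ and $\mathbb I$ denote tensor product and unit in either. $z\colon\mathcal V\to\mathcal C$ is a strong monoidal functor with a right adjoint, equipped with natural isomorphisms $z(V)\otimes X\cong X\otimes z(V)$ making it a strong braided monoidal functor from $\mathcal V$ to the (Drinfeld) center of $\mathcal C$. Operads are nonsymmetric: an operad $\mathcal O$ in $\mathcal V$ is a sequence $\{\mathcal O(n)\}_{n\ge0}$ of objects of $\mathcal V$ with a unit $\mathbb I\to\mathcal O(1)$ and compositions $\circ_i\colon\mathcal O(p)\otimes\mathcal O(q)\to\mathcal O(p+q-1)$, $1\le i\le p$, $q\ge0$, satisfying the usual associativity and unit laws. An $\mathcal O$-algebra in $\mathcal C$ is an object $A$ with structure maps $z(\mathcal O(n))\otimes A^{\otimes n}\to A$, $n\ge0$, compatible with compositions and unit. $\mathcal F_{\mathcal O}$ is the free $\mathcal O$-algebra functor, left adjoint to the forgetful functor from $\mathcal O$-algebras in $\mathcal C$ to $\mathcal C$. Functor-operads. A (nonsymmetric) functor-operad $F=\{F(n)\}_{n\ge0}$ in $\mathcal C$ is a sequence of functors $F(n)\colon\mathcal C^n\to\mathcal C$ with natural transformations $\circ_i\colon F(p)(\dots,F(q),\dots)\to F(p+q-1)$ ($F(q)$ in the $i$-th slot, $1\le i\le p$, $q\ge0$) and $u\colon\mathrm{id}_{\mathcal C}\to F(1)$ satisfying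 the same relations as operads. A functor $\mathcal C^0\to\mathcal C$ is an object of $\mathcal C$. Enveloping functor-operad $\mathcal O_A$ of an $\mathcal O$-algebra $A$. Let $\mathcal O_A^0(n)(X_1,\dots,X_n)$ be the coproduct, over $m\ge n$ and subsets $S=\{s_1<\dots<s_n\}\subset\{1,\dots,m\}$, of $z(\mathcal O(m))\otimes Y_1\otimes\cdots\otimes Y_m$ with $Y_{s_j}=X_j$ and $Y_i=A$ for $i\notin S$. Let $\mathcal O_A^1(n)(X_1,\dots,X_n)$ be the coproduct, over such $(m,S)$ and families of integers $k_i\ge0$ ($i\notin S$), of $z(\mathcal O(m))\otimes W_1\otimes\cdots\otimes W_m$ with $W_{s_j}=X_j$ and $W_i=z(\mathcal O(k_i))\otimes A^{\otimes k_i}$ for $i\notin S$. There are two natural maps $\mathcal O_A^1(n)\rightrightarrows\mathcal O_A^0(n)$, given respectively by the algebra structure maps $z(\mathcal O(k_i))\otimes A^{\otimes k_i}\to A$ and by the operad compositions of $\mathcal O(m)$ with all the $\mathcal O(k_i)$; they have a common section defined by the operad unit. $\mathcal O_A(n)$ is their (pointwise, reflexive) coequalizer. Compositions $\circ_i$ in $\mathcal O_A$ are induced by the operad compositions of $\mathcal O$ (substituting a summand $(m',S')$ into the $i$-th distinguished slot of a summand $(m,S)$), and the unit is induced by $X_1\cong\mathbb I\otimes X_1\to z(\mathcal O(1))\otimes X_1$. One has $\mathcal O_A(0)=A$. Latching maps. $\mathbf 2=\{0<1\}$. Given $F\colon\mathcal C^t\to\mathcal C$ and maps $f_i\colon Y_i\to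 Z_i$, regarded as functors $f_i\colon\mathbf2\to\mathcal C$, one has the composite functor $F(f_1,\dots,f_t)\colon\mathbf2^t\to\mathcal C$. Its latching map at $(1,\dots,1)$ is the natural map $\operatorname{colim}_{x\ne(1,\dots,1)}F(f_1,\dots,f_t)(x)\to F(Z_1,\dots,Z_t)$; a map out of its source is determined by its restrictions to the values at the $t$ objects of $\mathbf2^t$ with exactly one coordinate equal to $0$. *)

theory Defs
  imports Main "HOL-Library.FuncSet"
begin

section \<open>Categories, functors, adjunctions, (co)limits\<close>

record ('o, 'm) category =
  Obj :: "'o set"
  Arr :: "'m set"
  Dom :: "'m \<Rightarrow> 'o"
  Cod :: "'m \<Rightarrow> 'o"
  Ide :: "'o \<Rightarrow> 'm"
  Comp :: "'m \<Rightarrow> 'm \<Rightarrow> 'm"  (infixl "\<cdot>\<index>" 65)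

definition hom :: "('o, 'm, 'x) category_scheme \<Rightarrow> 'o \<Rightarrow> 'o \<Rightarrow> 'm set" where
  "hom C X Y = {f \<in> Arr C. Dom C f = X \<and> Cod C f = Y}"

locale category =
  fixes C :: "('o, 'm, 'x) category_scheme" (structure)
  assumes Dom_closed: "f \<in> Arr C \<Longrightarrow> Dom C f \<in> Obj C"
    and Cod_closed: "f \<in> Arr C \<Longrightarrow> Cod C f \<in> Obj C"
    and Ide_hom: "X \<in> Obj C \<Longrightarrow> Ide C X \<in> hom C X X"
    and Comp_hom: "\<lbrakk>f \<in> hom C X Y; g \<in> hom C Y Z\<rbrakk> \<Longrightarrow> g \<cdot> f \<in> hom C X Z"
    and Comp_Ide: "f \<in> hom C X Y \<Longrightarrow> f \<cdot> Ide C X = f"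
    and Ide_Comp: "f \<in> hom C X Y \<Longrightarrow> Ide C Y \<cdot> f = f"
    and Comp_assoc: "\<lbrakk>f \<in> hom C W X; g \<in> hom C X Y; h \<in> hom C Y Z\<rbrakk>
                      \<Longrightarrow> (h \<cdot> g) \<cdot> f = h \<cdot> (g \<cdot> f)"

definition is_inverse :: "('o, 'm, 'x) category_scheme \<Rightarrow> 'm \<Rightarrow> 'm \<Rightarrow> bool" where
  "is_inverse C f g \<longleftrightarrow> g \<in> hom C (Cod C f) (Dom C f) \<and>
     g \<cdot>\<^bsub>C\<^esub> f = Ide C (Dom C f) \<and> f \<cdot>\<^bsub>C\<^esub> g = Ide C (Cod C f)"

definition iso :: "('o, 'm, 'x) category_scheme \<Rightarrow> 'o \<Rightarrow> 'o \<Rightarrow> 'm set" where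
  "iso C X Y = {f \<in> hom C X Y. \<exists>g. is_inverse C f g}"

definition inverse_arr :: "('o, 'm, 'x) category_scheme \<Rightarrow> 'm \<Rightarrow> 'm" where
  "inverse_arr C f = (THE g. is_inverse C f g)"

definition full_subcat :: "('o, 'm) category \<Rightarrow> 'o set \<Rightarrow> ('o, 'm) category" where
  "full_subcat C S = C\<lparr>Obj := Obj C \<inter> S, Arr := {f \<in> Arr C. Dom C f \<in> S \<and> Cod C f \<in> S}\<rparr>"

record ('o1, 'm1, 'o2, 'm2) func =
  FOb :: "'o1 \<Rightarrow> 'o2"
  FArr :: "'m1 \<Rightarrow> 'm2"

definition is_functor ::
  "('o1, 'm1, 'x) category_scheme \<Rightarrow> ('o2, 'm2, 'y) category_scheme
   \<Rightarrow> ('o1, 'm1, 'o2, 'm2, 'z) func_scheme \<Rightarrow> bool" where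
  "is_functor C D F \<longleftrightarrow>
     (\<forall>X \<in> Obj C. FOb F X \<in> Obj D) \<and>
     (\<forall>f \<in> Arr C. FArr F f \<in> hom D (FOb F (Dom C f)) (FOb F (Cod C f))) \<and>
     (\<forall>X \<in> Obj C. FArr F (Ide C X) = Ide D (FOb F X)) \<and>
     (\<forall>f \<in> Arr C. \<forall>g \<in> Arr C. Cod C f = Dom C g \<longrightarrow>
        FArr F (g \<cdot>\<^bsub>C\<^esub> f) = FArr F g \<cdot>\<^bsub>D\<^esub> FArr F f)"

text \<open>\<open>\<Phi> X Y\<close> is the adjunction bijection from \<open>D(F X, Y)\<close> to \<open>C(X, G Y)\<close>, sending
  an arrow to its adjoint.\<close>
definition adjunction ::
  "('o1, 'm1, 'x) category_scheme \<Rightarrow> ('o2, 'm2, 'y) category_scheme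
   \<Rightarrow> ('o1, 'm1, 'o2, 'm2, 'z) func_scheme \<Rightarrow> ('o2, 'm2, 'o1, 'm1, 'w) func_scheme
   \<Rightarrow> ('o1 \<Rightarrow> 'o2 \<Rightarrow> 'm2 \<Rightarrow> 'm1) \<Rightarrow> bool" where
  "adjunction C D F G \<Phi> \<longleftrightarrow>
     is_functor C D F \<and> is_functor D C G \<and>
     (\<forall>X \<in> Obj C. \<forall>Y \<in> Obj D. bij_betw (\<Phi> X Y) (hom D (FOb F X) Y) (hom C X (FOb G Y))) \<and>
     (\<forall>X \<in> Obj C. \<forall>X' \<in> Obj C. \<forall>Y \<in> Obj D. \<forall>Y' \<in> Obj D.
        \<forall>a \<in> hom C X' X. \<forall>b \<in> hom D Y Y'. \<forall>h \<in> hom D (FOb F X) Y.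
          \<Phi> X' Y' (b \<cdot>\<^bsub>D\<^esub> h \<cdot>\<^bsub>D\<^esub> FArr F a) = FArr G b \<cdot>\<^bsub>C\<^esub> \<Phi> X Y h \<cdot>\<^bsub>C\<^esub> a)"

definition has_right_adjoint ::
  "('o1, 'm1, 'x) category_scheme \<Rightarrow> ('o2, 'm2, 'y) category_scheme
   \<Rightarrow> ('o1, 'm1, 'o2, 'm2, 'z) func_scheme \<Rightarrow> bool" where
  "has_right_adjoint C D F \<longleftrightarrow>
     (\<exists>(G :: ('o2, 'm2, 'o1, 'm1) func) \<Phi>. adjunction C D F G \<Phi>)"

definition is_colimit ::
  "('i, 'k, 'y) category_scheme \<Rightarrow> ('o, 'm, 'x) category_scheme
   \<Rightarrow> ('i, 'k, 'o, 'm, 'z) func_scheme \<Rightarrow> 'o \<Rightarrow> ('i \<Rightarrow> 'm) \<Rightarrow> bool" where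
  "is_colimit J C D c \<iota> \<longleftrightarrow>
     c \<in> Obj C \<and>
     (\<forall>j \<in> Obj J. \<iota> j \<in> hom C (FOb D j) c) \<and>
     (\<forall>u \<in> Arr J. \<iota> (Cod J u) \<cdot>\<^bsub>C\<^esub> FArr D u = \<iota> (Dom J u)) \<and>
     (\<forall>X \<in> Obj C. \<forall>h.
        (\<forall>j \<in> Obj J. h j \<in> hom C (FOb D j) X) \<and>
        (\<forall>u \<in> Arr J. h (Cod J u) \<cdot>\<^bsub>C\<^esub> FArr D u = h (Dom J u)) \<longrightarrow>
        (\<exists>!k. k \<in> hom C c X \<and> (\<forall>j \<in> Obj J. k \<cdot>\<^bsub>C\<^esub> \<iota> j = h j)))"

definition is_limit ::
  "('i, 'k, 'y) category_scheme \<Rightarrow> ('o, 'm, 'x) category_scheme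
   \<Rightarrow> ('i, 'k, 'o, 'm, 'z) func_scheme \<Rightarrow> 'o \<Rightarrow> ('i \<Rightarrow> 'm) \<Rightarrow> bool" where
  "is_limit J C D c \<pi> \<longleftrightarrow>
     c \<in> Obj C \<and>
     (\<forall>j \<in> Obj J. \<pi> j \<in> hom C c (FOb D j)) \<and>
     (\<forall>u \<in> Arr J. FArr D u \<cdot>\<^bsub>C\<^esub> \<pi> (Dom J u) = \<pi> (Cod J u)) \<and>
     (\<forall>X \<in> Obj C. \<forall>h.
        (\<forall>j \<in> Obj J. h j \<in> hom C X (FOb D j)) \<and>
        (\<forall>u \<in> Arr J. FArr D u \<cdot>\<^bsub>C\<^esub> h (Dom J u) = h (Cod J u)) \<longrightarrow>
        (\<exists>!k. k \<in> hom C X c \<and> (\<forall>j \<in> Obj J. \<pi> j \<cdot>\<^bsub>C\<^esub> k = h j)))"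

text \<open>``Small'' means indexed by a category whose objects and arrows are taken from the type
  \<open>'u\<close>, which plays the role of the universe of small sets.\<close>
definition bicomplete :: "'u itself \<Rightarrow> ('o, 'm, 'x) category_scheme \<Rightarrow> bool" where
  "bicomplete (_ :: 'u itself) C \<longleftrightarrow>
     (\<forall>(J :: ('u, 'u) category) (D :: ('u, 'u, 'o, 'm) func).
        category J \<and> is_functor J C D \<longrightarrow>
        (\<exists>c \<iota>. is_colimit J C D c \<iota>) \<and> (\<exists>c \<pi>. is_limit J C D c \<pi>))"

definition is_coproduct ::
  "('o, 'm, 'x) category_scheme \<Rightarrow> 'i set \<Rightarrow> ('i \<Rightarrow> 'o) \<Rightarrow> 'o \<Rightarrow> ('i \<Rightarrow> 'm) \<Rightarrow> bool" where
  "is_coproduct C I D c \<iota> \<longleftrightarrow>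
     c \<in> Obj C \<and> (\<forall>i \<in> I. \<iota> i \<in> hom C (D i) c) \<and>
     (\<forall>X \<in> Obj C. \<forall>h. (\<forall>i \<in> I. h i \<in> hom C (D i) X) \<longrightarrow>
        (\<exists>!k. k \<in> hom C c X \<and> (\<forall>i \<in> I. k \<cdot>\<^bsub>C\<^esub> \<iota> i = h i)))"

definition is_coequalizer ::
  "('o, 'm, 'x) category_scheme \<Rightarrow> 'm \<Rightarrow> 'm \<Rightarrow> 'm \<Rightarrow> bool" where
  "is_coequalizer C d d' q \<longleftrightarrow>
     d \<in> Arr C \<and> d' \<in> hom C (Dom C d) (Cod C d) \<and>
     q \<in> Arr C \<and> Dom C q = Cod C d \<and> q \<cdot>\<^bsub>C\<^esub> d = q \<cdot>\<^bsub>C\<^esub> d' \<and>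
     (\<forall>h \<in> Arr C. Dom C h = Cod C d \<and> h \<cdot>\<^bsub>C\<^esub> d = h \<cdot>\<^bsub>C\<^esub> d' \<longrightarrow>
        (\<exists>!k. k \<in> hom C (Cod C q) (Cod C h) \<and> k \<cdot>\<^bsub>C\<^esub> q = h))"

text \<open>\<open>f\<close> is the top, \<open>g\<close> the left, \<open>g'\<close> the right and \<open>f'\<close> the bottom arrow of the square.\<close>
definition is_pushout ::
  "('o, 'm, 'x) category_scheme \<Rightarrow> 'm \<Rightarrow> 'm \<Rightarrow> 'm \<Rightarrow> 'm \<Rightarrow> bool" where
  "is_pushout C f g g' f' \<longleftrightarrow>
     f \<in> Arr C \<and> g \<in> Arr C \<and> Dom C f = Dom C g \<and>
     g' \<in> Arr C \<and> Dom C g' = Cod C f \<and> f' \<in> hom C (Cod C g) (Cod C g') \<and>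
     g' \<cdot>\<^bsub>C\<^esub> f = f' \<cdot>\<^bsub>C\<^esub> g \<and>
     (\<forall>X \<in> Obj C. \<forall>h \<in> hom C (Cod C f) X. \<forall>k \<in> hom C (Cod C g) X.
        h \<cdot>\<^bsub>C\<^esub> f = k \<cdot>\<^bsub>C\<^esub> g \<longrightarrow>
        (\<exists>!l. l \<in> hom C (Cod C g') X \<and> l \<cdot>\<^bsub>C\<^esub> g' = h \<and> l \<cdot>\<^bsub>C\<^esub> f' = k))"

text \<open>Chosen colimits and coproducts.\<close>

definition colim ::
  "('i, 'k, 'y) category_scheme \<Rightarrow> ('o, 'm, 'x) category_scheme
   \<Rightarrow> ('i, 'k, 'o, 'm, 'z) func_scheme \<Rightarrow> 'o \<times> ('i \<Rightarrow> 'm)" where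
  "colim J C D = (SOME p. is_colimit J C D (fst p) (snd p))"

definition coprod ::
  "('o, 'm, 'x) category_scheme \<Rightarrow> 'i set \<Rightarrow> ('i \<Rightarrow> 'o) \<Rightarrow> 'o \<times> ('i \<Rightarrow> 'm)" where
  "coprod C I D = (SOME p. is_coproduct C I D (fst p) (snd p))"

definition copair ::
  "('o, 'm, 'x) category_scheme \<Rightarrow> 'i set \<Rightarrow> ('i \<Rightarrow> 'o) \<Rightarrow> 'o \<Rightarrow> ('i \<Rightarrow> 'm) \<Rightarrow> 'm" where
  "copair C I D X h =
     (THE k. k \<in> hom C (fst (coprod C I D)) X \<and> (\<forall>i \<in> I. k \<cdot>\<^bsub>C\<^esub> snd (coprod C I D) i = h i))"

section \<open>Monoidal categories\<close>

text \<open>\<open>\<otimes>\<close> is the tensor product of objects, \<open>\<boxtimes>\<close> that of arrows. The associator is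
  \<open>(X \<otimes> Y) \<otimes> Z \<rightarrow> X \<otimes> (Y \<otimes> Z)\<close> and the unitors are \<open>I \<otimes> X \<rightarrow> X\<close>, \<open>X \<otimes> I \<rightarrow> X\<close>.\<close>
record ('o, 'm) monoidal = "('o, 'm) category" +
  TenO :: "'o \<Rightarrow> 'o \<Rightarrow> 'o"  (infixr "\<otimes>\<index>" 75)
  TenA :: "'m \<Rightarrow> 'm \<Rightarrow> 'm"  (infixr "\<boxtimes>\<index>" 75)
  Unit :: 'o
  Assoc :: "'o \<Rightarrow> 'o \<Rightarrow> 'o \<Rightarrow> 'm"
  LUnit :: "'o \<Rightarrow> 'm"
  RUnit :: "'o \<Rightarrow> 'm"

locale monoidal_category = category C
  for C :: "('o, 'm, 'x) monoidal_scheme" (structure) +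
  assumes TenO_closed: "\<lbrakk>X \<in> Obj C; Y \<in> Obj C\<rbrakk> \<Longrightarrow> X \<otimes> Y \<in> Obj C"
    and TenA_hom: "\<lbrakk>f \<in> hom C X X'; g \<in> hom C Y Y'\<rbrakk> \<Longrightarrow> f \<boxtimes> g \<in> hom C (X \<otimes> Y) (X' \<otimes> Y')"
    and TenA_Ide: "\<lbrakk>X \<in> Obj C; Y \<in> Obj C\<rbrakk> \<Longrightarrow> Ide C X \<boxtimes> Ide C Y = Ide C (X \<otimes> Y)"
    and TenA_Comp: "\<lbrakk>f \<in> hom C X X'; f' \<in> hom C X' X''; g \<in> hom C Y Y'; g' \<in> hom C Y' Y''\<rbrakk>
          \<Longrightarrow> (f' \<cdot> f) \<boxtimes> (g' \<cdot> g) = (f' \<boxtimes> g') \<cdot> (f \<boxtimes> g)"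
    and Unit_closed: "Unit C \<in> Obj C"
    and Assoc_iso: "\<lbrakk>X \<in> Obj C; Y \<in> Obj C; Z \<in> Obj C\<rbrakk>
          \<Longrightarrow> Assoc C X Y Z \<in> iso C ((X \<otimes> Y) \<otimes> Z) (X \<otimes> (Y \<otimes> Z))"
    and LUnit_iso: "X \<in> Obj C \<Longrightarrow> LUnit C X \<in> iso C (Unit C \<otimes> X) X"
    and RUnit_iso: "X \<in> Obj C \<Longrightarrow> RUnit C X \<in> iso C (X \<otimes> Unit C) X"
    and Assoc_natural: "\<lbrakk>f \<in> hom C X X'; g \<in> hom C Y Y'; h \<in> hom C Z Z'\<rbrakk>
          \<Longrightarrow> Assoc C X' Y' Z' \<cdot> ((f \<boxtimes> g) \<boxtimes> h) = (f \<boxtimes> (g \<boxtimes> h)) \<cdot> Assoc C X Y Z"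
    and LUnit_natural: "f \<in> hom C X X' \<Longrightarrow> LUnit C X' \<cdot> (Ide C (Unit C) \<boxtimes> f) = f \<cdot> LUnit C X"
    and RUnit_natural: "f \<in> hom C X X' \<Longrightarrow> RUnit C X' \<cdot> (f \<boxtimes> Ide C (Unit C)) = f \<cdot> RUnit C X"
    and pentagon: "\<lbrakk>W \<in> Obj C; X \<in> Obj C; Y \<in> Obj C; Z \<in> Obj C\<rbrakk>
          \<Longrightarrow> Assoc C W X (Y \<otimes> Z) \<cdot> Assoc C (W \<otimes> X) Y Z
              = (Ide C W \<boxtimes> Assoc C X Y Z) \<cdot> Assoc C W (X \<otimes> Y) Z \<cdot> (Assoc C W X Y \<boxtimes> Ide C Z)"
    and triangle: "\<lbrakk>X \<in> Obj C; Y \<in> Obj C\<rbrakk>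
          \<Longrightarrow> (Ide C X \<boxtimes> LUnit C Y) \<cdot> Assoc C X (Unit C) Y = RUnit C X \<boxtimes> Ide C Y"

definition biclosed :: "('o, 'm, 'x) monoidal_scheme \<Rightarrow> bool" where
  "biclosed C \<longleftrightarrow> (\<forall>X \<in> Obj C.
     has_right_adjoint C C \<lparr>FOb = (\<lambda>Y. Y \<otimes>\<^bsub>C\<^esub> X), FArr = (\<lambda>f. f \<boxtimes>\<^bsub>C\<^esub> Ide C X)\<rparr> \<and>
     has_right_adjoint C C \<lparr>FOb = (\<lambda>Y. X \<otimes>\<^bsub>C\<^esub> Y), FArr = (\<lambda>f. Ide C X \<boxtimes>\<^bsub>C\<^esub> f)\<rparr>)"

record ('o, 'm) braided = "('o, 'm) monoidal" +
  Braid :: "'o \<Rightarrow> 'o \<Rightarrow> 'm"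

locale symmetric_monoidal_category = monoidal_category V
  for V :: "('o, 'm, 'x) braided_scheme" (structure) +
  assumes Braid_hom: "\<lbrakk>X \<in> Obj V; Y \<in> Obj V\<rbrakk> \<Longrightarrow> Braid V X Y \<in> hom V (X \<otimes> Y) (Y \<otimes> X)"
    and Braid_natural: "\<lbrakk>f \<in> hom V X X'; g \<in> hom V Y Y'\<rbrakk>
          \<Longrightarrow> Braid V X' Y' \<cdot> (f \<boxtimes> g) = (g \<boxtimes> f) \<cdot> Braid V X Y"
    and Braid_involutive: "\<lbrakk>X \<in> Obj V; Y \<in> Obj V\<rbrakk>
          \<Longrightarrow> Braid V Y X \<cdot> Braid V X Y = Ide V (X \<otimes> Y)"
    and hexagon: "\<lbrakk>X \<in> Obj V; Y \<in> Obj V; Z \<in> Obj V\<rbrakk>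
          \<Longrightarrow> Assoc V Y Z X \<cdot> Braid V X (Y \<otimes> Z) \<cdot> Assoc V X Y Z
              = (Ide V Y \<boxtimes> Braid V X Z) \<cdot> Assoc V Y X Z \<cdot> (Braid V X Y \<boxtimes> Ide V Z)"

definition closed_monoidal :: "('o, 'm, 'x) monoidal_scheme \<Rightarrow> bool" where
  "closed_monoidal V \<longleftrightarrow> (\<forall>X \<in> Obj V.
     has_right_adjoint V V \<lparr>FOb = (\<lambda>Y. Y \<otimes>\<^bsub>V\<^esub> X), FArr = (\<lambda>f. f \<boxtimes>\<^bsub>V\<^esub> Ide V X)\<rparr>)"

definition strong_monoidal ::
  "('o1, 'm1, 'x) monoidal_scheme \<Rightarrow> ('o2, 'm2, 'y) monoidal_scheme
   \<Rightarrow> ('o1, 'm1, 'o2, 'm2, 'z) func_scheme \<Rightarrow> ('o1 \<Rightarrow> 'o1 \<Rightarrow> 'm2) \<Rightarrow> 'm2 \<Rightarrow> bool" where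
  "strong_monoidal V D F \<mu> \<epsilon> \<longleftrightarrow>
     is_functor V D F \<and>
     (\<forall>X \<in> Obj V. \<forall>Y \<in> Obj V. \<mu> X Y \<in> iso D (FOb F X \<otimes>\<^bsub>D\<^esub> FOb F Y) (FOb F (X \<otimes>\<^bsub>V\<^esub> Y))) \<and>
     \<epsilon> \<in> iso D (Unit D) (FOb F (Unit V)) \<and>
     (\<forall>f \<in> Arr V. \<forall>g \<in> Arr V.
        FArr F (f \<boxtimes>\<^bsub>V\<^esub> g) \<cdot>\<^bsub>D\<^esub> \<mu> (Dom V f) (Dom V g)
        = \<mu> (Cod V f) (Cod V g) \<cdot>\<^bsub>D\<^esub> (FArr F f \<boxtimes>\<^bsub>D\<^esub> FArr F g)) \<and>
     (\<forall>X \<in> Obj V. \<forall>Y \<in> Obj V. \<forall>Z \<in> Obj V.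
        FArr F (Assoc V X Y Z) \<cdot>\<^bsub>D\<^esub> \<mu> (X \<otimes>\<^bsub>V\<^esub> Y) Z \<cdot>\<^bsub>D\<^esub> (\<mu> X Y \<boxtimes>\<^bsub>D\<^esub> Ide D (FOb F Z))
        = \<mu> X (Y \<otimes>\<^bsub>V\<^esub> Z) \<cdot>\<^bsub>D\<^esub> (Ide D (FOb F X) \<boxtimes>\<^bsub>D\<^esub> \<mu> Y Z)
            \<cdot>\<^bsub>D\<^esub> Assoc D (FOb F X) (FOb F Y) (FOb F Z)) \<and>
     (\<forall>X \<in> Obj V.
        FArr F (LUnit V X) \<cdot>\<^bsub>D\<^esub> \<mu> (Unit V) X \<cdot>\<^bsub>D\<^esub> (\<epsilon> \<boxtimes>\<^bsub>D\<^esub> Ide D (FOb F X)) = LUnit D (FOb F X)) \<and>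
     (\<forall>X \<in> Obj V.
        FArr F (RUnit V X) \<cdot>\<^bsub>D\<^esub> \<mu> X (Unit V) \<cdot>\<^bsub>D\<^esub> (Ide D (FOb F X) \<boxtimes>\<^bsub>D\<^esub> \<epsilon>) = RUnit D (FOb F X))"

definition strong_braided_monoidal ::
  "('o1, 'm1, 'x) braided_scheme \<Rightarrow> ('o2, 'm2, 'y) braided_scheme
   \<Rightarrow> ('o1, 'm1, 'o2, 'm2, 'z) func_scheme \<Rightarrow> ('o1 \<Rightarrow> 'o1 \<Rightarrow> 'm2) \<Rightarrow> 'm2 \<Rightarrow> bool" where
  "strong_braided_monoidal V D F \<mu> \<epsilon> \<longleftrightarrow>
     strong_monoidal V D F \<mu> \<epsilon> \<and>
     (\<forall>X \<in> Obj V. \<forall>Y \<in> Obj V.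
        FArr F (Braid V X Y) \<cdot>\<^bsub>D\<^esub> \<mu> X Y = \<mu> Y X \<cdot>\<^bsub>D\<^esub> Braid D (FOb F X) (FOb F Y))"

subsection \<open>The Drinfeld center\<close>

definition half_braiding ::
  "('o, 'm, 'x) monoidal_scheme \<Rightarrow> 'o \<Rightarrow> ('o \<Rightarrow> 'm) \<Rightarrow> bool" where
  "half_braiding C X \<beta> \<longleftrightarrow>
     X \<in> Obj C \<and> \<beta> \<in> extensional (Obj C) \<and>
     (\<forall>Y \<in> Obj C. \<beta> Y \<in> iso C (X \<otimes>\<^bsub>C\<^esub> Y) (Y \<otimes>\<^bsub>C\<^esub> X)) \<and>
     (\<forall>f \<in> Arr C. \<beta> (Cod C f) \<cdot>\<^bsub>C\<^esub> (Ide C X \<boxtimes>\<^bsub>C\<^esub> f) = (f \<boxtimes>\<^bsub>C\<^esub> Ide C X) \<cdot>\<^bsub>C\<^esub> \<beta> (Dom C f)) \<and>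
     (\<forall>Y \<in> Obj C. \<forall>Z \<in> Obj C.
        Assoc C Y Z X \<cdot>\<^bsub>C\<^esub> \<beta> (Y \<otimes>\<^bsub>C\<^esub> Z) \<cdot>\<^bsub>C\<^esub> Assoc C X Y Z
        = (Ide C Y \<boxtimes>\<^bsub>C\<^esub> \<beta> Z) \<cdot>\<^bsub>C\<^esub> Assoc C Y X Z \<cdot>\<^bsub>C\<^esub> (\<beta> Y \<boxtimes>\<^bsub>C\<^esub> Ide C Z))"

definition center_ten ::
  "('o, 'm, 'x) monoidal_scheme \<Rightarrow> 'o \<times> ('o \<Rightarrow> 'm) \<Rightarrow> 'o \<times> ('o \<Rightarrow> 'm) \<Rightarrow> 'o \<times> ('o \<Rightarrow> 'm)" where
  "center_ten C P Q = (case (P, Q) of ((X, \<beta>), (X', \<beta>')) \<Rightarrow>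
     (X \<otimes>\<^bsub>C\<^esub> X',
      \<lambda>Y \<in> Obj C. Assoc C Y X X' \<cdot>\<^bsub>C\<^esub> (\<beta> Y \<boxtimes>\<^bsub>C\<^esub> Ide C X') \<cdot>\<^bsub>C\<^esub> inverse_arr C (Assoc C X Y X')
                  \<cdot>\<^bsub>C\<^esub> (Ide C X \<boxtimes>\<^bsub>C\<^esub> \<beta>' Y) \<cdot>\<^bsub>C\<^esub> Assoc C X X' Y))"

definition center_unit :: "('o, 'm, 'x) monoidal_scheme \<Rightarrow> 'o \<times> ('o \<Rightarrow> 'm)" where
  "center_unit C = (Unit C, \<lambda>Y \<in> Obj C. inverse_arr C (RUnit C Y) \<cdot>\<^bsub>C\<^esub> LUnit C Y)"

text \<open>An arrow of the center is a triple (source, underlying arrow of \<open>C\<close>, target).\<close>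
definition center ::
  "('o, 'm, 'x) monoidal_scheme
   \<Rightarrow> ('o \<times> ('o \<Rightarrow> 'm), ('o \<times> ('o \<Rightarrow> 'm)) \<times> 'm \<times> ('o \<times> ('o \<Rightarrow> 'm))) braided" where
  "center C = (let T = center_ten C; I = center_unit C in
     \<lparr>Obj = {(X, \<beta>). half_braiding C X \<beta>},
      Arr = {((X, \<beta>), f, (X', \<beta>')). half_braiding C X \<beta> \<and> half_braiding C X' \<beta>' \<and> f \<in> hom C X X' \<and>
               (\<forall>Y \<in> Obj C. (Ide C Y \<boxtimes>\<^bsub>C\<^esub> f) \<cdot>\<^bsub>C\<^esub> \<beta> Y = \<beta>' Y \<cdot>\<^bsub>C\<^esub> (f \<boxtimes>\<^bsub>C\<^esub> Ide C Y))},
      Dom = (\<lambda>(P, f, Q). P),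
      Cod = (\<lambda>(P, f, Q). Q),
      Ide = (\<lambda>P. (P, Ide C (fst P), P)),
      Comp = (\<lambda>(P', g, Q') (P, f, Q). (P, g \<cdot>\<^bsub>C\<^esub> f, Q')),
      TenO = T,
      TenA = (\<lambda>(P, f, Q) (P', f', Q'). (T P P', f \<boxtimes>\<^bsub>C\<^esub> f', T Q Q')),
      Unit = I,
      Assoc = (\<lambda>P Q R. (T (T P Q) R, Assoc C (fst P) (fst Q) (fst R), T P (T Q R))),
      LUnit = (\<lambda>P. (T I P, LUnit C (fst P), P)),
      RUnit = (\<lambda>P. (T P I, RUnit C (fst P), P)),
      Braid = (\<lambda>P Q. (T P Q, snd P (fst Q), T Q P))\<rparr>)"

text \<open>The functor \<open>z : V \<rightarrow> C\<close> with its constraints \<open>\<mu> : z V \<otimes> z W \<rightarrow> z (V \<otimes> W)\<close> and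
  \<open>\<epsilon> : I \<rightarrow> z I\<close>, and the isomorphisms \<open>\<zeta> : z V \<otimes> X \<rightarrow> X \<otimes> z V\<close>.\<close>
record ('ov, 'mv, 'oc, 'mc) central = "('ov, 'mv, 'oc, 'mc) func" +
  Mu :: "'ov \<Rightarrow> 'ov \<Rightarrow> 'mc"
  Eps :: 'mc
  Zeta :: "'ov \<Rightarrow> 'oc \<Rightarrow> 'mc"

definition center_obj ::
  "('oc, 'mc, 'y) monoidal_scheme \<Rightarrow> ('ov, 'mv, 'oc, 'mc, 'z) central_scheme
   \<Rightarrow> 'ov \<Rightarrow> 'oc \<times> ('oc \<Rightarrow> 'mc)" where
  "center_obj C z V = (FOb z V, \<lambda>X \<in> Obj C. Zeta z V X)"

definition central_functor ::
  "('ov, 'mv, 'x) braided_scheme \<Rightarrow> ('oc, 'mc, 'y) monoidal_scheme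
   \<Rightarrow> ('ov, 'mv, 'oc, 'mc, 'z) central_scheme \<Rightarrow> bool" where
  "central_functor V C z \<longleftrightarrow>
     strong_monoidal V C z (Mu z) (Eps z) \<and>
     strong_braided_monoidal V (center C)
       \<lparr>FOb = center_obj C z,
        FArr = (\<lambda>f. (center_obj C z (Dom V f), FArr z f, center_obj C z (Cod V f)))\<rparr>
       (\<lambda>X Y. (center_ten C (center_obj C z X) (center_obj C z Y), Mu z X Y,
               center_obj C z (X \<otimes>\<^bsub>V\<^esub> Y)))
       (center_unit C, Eps z, center_obj C z (Unit V))"

section \<open>Operads and their algebras\<close>

text \<open>\<open>OComp P i p q\<close> is \<open>\<circ>\<^sub>i : P(p) \<otimes> P(q) \<rightarrow> P(p+q-1)\<close>.\<close>
record ('o, 'm) operad =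
  OOb :: "nat \<Rightarrow> 'o"
  OUnit :: 'm
  OComp :: "nat \<Rightarrow> nat \<Rightarrow> nat \<Rightarrow> 'm"

locale operad = symmetric_monoidal_category V
  for V :: "('o, 'm, 'x) braided_scheme" (structure) +
  fixes P :: "('o, 'm) operad"
  assumes OOb_closed: "OOb P n \<in> Obj V"
    and OUnit_hom: "OUnit P \<in> hom V (Unit V) (OOb P 1)"
    and OComp_hom: "\<lbrakk>1 \<le> i; i \<le> p\<rbrakk>
          \<Longrightarrow> OComp P i p q \<in> hom V (OOb P p \<otimes> OOb P q) (OOb P (p + q - 1))"
    and sequential: "\<lbrakk>1 \<le> i; i \<le> p; 1 \<le> j; j \<le> q\<rbrakk>
          \<Longrightarrow> OComp P (i + j - 1) (p + q - 1) r \<cdot> (OComp P i p q \<boxtimes> Ide V (OOb P r))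
              = OComp P i p (q + r - 1) \<cdot> (Ide V (OOb P p) \<boxtimes> OComp P j q r)
                  \<cdot> Assoc V (OOb P p) (OOb P q) (OOb P r)"
    and parallel: "\<lbrakk>1 \<le> i; i < k; k \<le> p\<rbrakk>
          \<Longrightarrow> OComp P (k + q - 1) (p + q - 1) r \<cdot> (OComp P i p q \<boxtimes> Ide V (OOb P r))
              = OComp P i (p + r - 1) q \<cdot> (OComp P k p r \<boxtimes> Ide V (OOb P q))
                  \<cdot> inverse_arr V (Assoc V (OOb P p) (OOb P r) (OOb P q))
                  \<cdot> (Ide V (OOb P p) \<boxtimes> Braid V (OOb P q) (OOb P r))
                  \<cdot> Assoc V (OOb P p) (OOb P q) (OOb P r)"
    and left_unit: "OComp P 1 1 q \<cdot> (OUnit P \<boxtimes> Ide V (OOb P q)) = LUnit V (OOb P q)"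
    and right_unit: "\<lbrakk>1 \<le> i; i \<le> p\<rbrakk>
          \<Longrightarrow> OComp P i p 1 \<cdot> (Ide V (OOb P p) \<boxtimes> OUnit P) = RUnit V (OOb P p)"

text \<open>Iterated tensor products are bracketed to the right and end in the unit object:
  \<open>tens C [X\<^sub>1, \<dots>, X\<^sub>n] = X\<^sub>1 \<otimes> (\<dots> \<otimes> (X\<^sub>n \<otimes> I))\<close>.\<close>
primrec tens :: "('o, 'm, 'x) monoidal_scheme \<Rightarrow> 'o list \<Rightarrow> 'o" where
  "tens C [] = Unit C"
| "tens C (X # Xs) = X \<otimes>\<^bsub>C\<^esub> tens C Xs"

primrec tensA :: "('o, 'm, 'x) monoidal_scheme \<Rightarrow> 'm list \<Rightarrow> 'm" where
  "tensA C [] = Ide C (Unit C)"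
| "tensA C (f # fs) = f \<boxtimes>\<^bsub>C\<^esub> tensA C fs"

text \<open>The canonical isomorphism \<open>tens C Ws \<otimes> tens C Zs \<rightarrow> tens C (Ws @ Zs)\<close>.\<close>
primrec tens_append :: "('o, 'm, 'x) monoidal_scheme \<Rightarrow> 'o list \<Rightarrow> 'o list \<Rightarrow> 'm" where
  "tens_append C [] Zs = LUnit C (tens C Zs)"
| "tens_append C (W # Ws) Zs =
     (Ide C W \<boxtimes>\<^bsub>C\<^esub> tens_append C Ws Zs) \<cdot>\<^bsub>C\<^esub> Assoc C W (tens C Ws) (tens C Zs)"

text \<open>\<open>optens C z P [Y\<^sub>1, \<dots>, Y\<^sub>m] = z(P(m)) \<otimes> Y\<^sub>1 \<otimes> \<dots> \<otimes> Y\<^sub>m\<close>, and its action on arrows of the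
  \<open>Y\<^sub>i\<close>.\<close>
definition optens ::
  "('oc, 'mc, 'y) monoidal_scheme \<Rightarrow> ('ov, 'mv, 'oc, 'mc, 'z) central_scheme
   \<Rightarrow> ('ov, 'mv) operad \<Rightarrow> 'oc list \<Rightarrow> 'oc" where
  "optens C z P Ys = FOb z (OOb P (length Ys)) \<otimes>\<^bsub>C\<^esub> tens C Ys"

definition optensA ::
  "('oc, 'mc, 'y) monoidal_scheme \<Rightarrow> ('ov, 'mv, 'oc, 'mc, 'z) central_scheme
   \<Rightarrow> ('ov, 'mv) operad \<Rightarrow> 'mc list \<Rightarrow> 'mc" where
  "optensA C z P fs = Ide C (FOb z (OOb P (length fs))) \<boxtimes>\<^bsub>C\<^esub> tensA C fs"

text \<open>The isomorphism
  \<open>tens C (Ys @ [z V \<otimes> tens C Ws] @ Zs) \<rightarrow> z V \<otimes> tens C (Ys @ Ws @ Zs)\<close>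
  moving \<open>z V\<close> to the front past the \<open>Ys\<close>.\<close>
primrec pull_front ::
  "('oc, 'mc, 'y) monoidal_scheme \<Rightarrow> ('ov, 'mv, 'oc, 'mc, 'z) central_scheme
   \<Rightarrow> 'ov \<Rightarrow> 'oc list \<Rightarrow> 'oc list \<Rightarrow> 'oc list \<Rightarrow> 'mc" where
  "pull_front C z V [] Ws Zs =
     (Ide C (FOb z V) \<boxtimes>\<^bsub>C\<^esub> tens_append C Ws Zs) \<cdot>\<^bsub>C\<^esub> Assoc C (FOb z V) (tens C Ws) (tens C Zs)"
| "pull_front C z V (Y # Ys) Ws Zs =
     (let R = tens C (Ys @ Ws @ Zs) in
      Assoc C (FOb z V) Y R \<cdot>\<^bsub>C\<^esub> (inverse_arr C (Zeta z V Y) \<boxtimes>\<^bsub>C\<^esub> Ide C R)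
      \<cdot>\<^bsub>C\<^esub> inverse_arr C (Assoc C Y (FOb z V) R) \<cdot>\<^bsub>C\<^esub> (Ide C Y \<boxtimes>\<^bsub>C\<^esub> pull_front C z V Ys Ws Zs))"

text \<open>Operad composition in the slot after \<open>Ys\<close>:
  \<open>optens C z P (Ys @ [optens C z P Ws] @ Zs) \<rightarrow> optens C z P (Ys @ Ws @ Zs)\<close>.\<close>
definition graft ::
  "('oc, 'mc, 'y) monoidal_scheme \<Rightarrow> ('ov, 'mv, 'oc, 'mc, 'z) central_scheme
   \<Rightarrow> ('ov, 'mv) operad \<Rightarrow> 'oc list \<Rightarrow> 'oc list \<Rightarrow> 'oc list \<Rightarrow> 'mc" where
  "graft C z P Ys Ws Zs =
     (let i = length Ys + 1; p = length Ys + 1 + length Zs; q = length Ws;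
          Vp = OOb P p; Vq = OOb P q; R = tens C (Ys @ Ws @ Zs) in
      ((FArr z (OComp P i p q) \<cdot>\<^bsub>C\<^esub> Mu z Vp Vq) \<boxtimes>\<^bsub>C\<^esub> Ide C R)
      \<cdot>\<^bsub>C\<^esub> inverse_arr C (Assoc C (FOb z Vp) (FOb z Vq) R)
      \<cdot>\<^bsub>C\<^esub> (Ide C (FOb z Vp) \<boxtimes>\<^bsub>C\<^esub> pull_front C z Vq Ys Ws Zs))"

text \<open>The map \<open>X \<cong> I \<otimes> X \<rightarrow> z(P(1)) \<otimes> X\<close> given by the operad unit; note that
  \<open>optens C z P [X] = z(P(1)) \<otimes> (X \<otimes> I)\<close>.\<close>
definition opunit ::
  "('oc, 'mc, 'y) monoidal_scheme \<Rightarrow> ('ov, 'mv, 'oc, 'mc, 'z) central_scheme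
   \<Rightarrow> ('ov, 'mv) operad \<Rightarrow> 'oc \<Rightarrow> 'mc" where
  "opunit C z P X =
     ((FArr z (OUnit P) \<cdot>\<^bsub>C\<^esub> Eps z) \<boxtimes>\<^bsub>C\<^esub> inverse_arr C (RUnit C X)) \<cdot>\<^bsub>C\<^esub> inverse_arr C (LUnit C X)"

text \<open>An algebra is a pair of an object \<open>A\<close> and the family of structure maps
  \<open>\<alpha> n : z(P(n)) \<otimes> A\<^sup>n \<rightarrow> A\<close>.\<close>
definition is_algebra ::
  "('oc, 'mc, 'y) monoidal_scheme \<Rightarrow> ('ov, 'mv, 'oc, 'mc, 'z) central_scheme
   \<Rightarrow> ('ov, 'mv) operad \<Rightarrow> 'oc \<times> (nat \<Rightarrow> 'mc) \<Rightarrow> bool" where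
  "is_algebra C z P Aa \<longleftrightarrow> (case Aa of (A, \<alpha>) \<Rightarrow>
     A \<in> Obj C \<and>
     (\<forall>n. \<alpha> n \<in> hom C (optens C z P (replicate n A)) A) \<and>
     (\<forall>i p q. 1 \<le> i \<and> i \<le> p \<longrightarrow>
        \<alpha> (p + q - 1) \<cdot>\<^bsub>C\<^esub> graft C z P (replicate (i - 1) A) (replicate q A) (replicate (p - i) A)
        = \<alpha> p \<cdot>\<^bsub>C\<^esub> optensA C z P
                      (replicate (i - 1) (Ide C A) @ [\<alpha> q] @ replicate (p - i) (Ide C A))) \<and>
     \<alpha> 1 \<cdot>\<^bsub>C\<^esub> opunit C z P A = Ide C A)"

text \<open>An arrow is a triple (source, underlying arrow of \<open>C\<close>, target).\<close>
definition algebras ::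
  "('oc, 'mc, 'y) monoidal_scheme \<Rightarrow> ('ov, 'mv, 'oc, 'mc, 'z) central_scheme
   \<Rightarrow> ('ov, 'mv) operad
   \<Rightarrow> ('oc \<times> (nat \<Rightarrow> 'mc), ('oc \<times> (nat \<Rightarrow> 'mc)) \<times> 'mc \<times> ('oc \<times> (nat \<Rightarrow> 'mc))) category" where
  "algebras C z P =
     \<lparr>Obj = {Aa. is_algebra C z P Aa},
      Arr = {((A, \<alpha>), h, (B, \<beta>)). is_algebra C z P (A, \<alpha>) \<and> is_algebra C z P (B, \<beta>) \<and>
               h \<in> hom C A B \<and>
               (\<forall>n. h \<cdot>\<^bsub>C\<^esub> \<alpha> n = \<beta> n \<cdot>\<^bsub>C\<^esub> optensA C z P (replicate n h))},
      Dom = (\<lambda>(Aa, h, Bb). Aa),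
      Cod = (\<lambda>(Aa, h, Bb). Bb),
      Ide = (\<lambda>Aa. (Aa, Ide C (fst Aa), Aa)),
      Comp = (\<lambda>(Aa', g, Bb') (Aa, h, Bb). (Aa, g \<cdot>\<^bsub>C\<^esub> h, Bb'))\<rparr>"

definition forgetful ::
  "('o \<times> (nat \<Rightarrow> 'm), ('o \<times> (nat \<Rightarrow> 'm)) \<times> 'm \<times> ('o \<times> (nat \<Rightarrow> 'm)), 'o, 'm) func" where
  "forgetful = \<lparr>FOb = fst, FArr = (\<lambda>(Aa, h, Bb). h)\<rparr>"

section \<open>The enveloping functor-operad\<close>

text \<open>The data of a functor-operad. An object \<open>(X\<^sub>1, \<dots>, X\<^sub>n)\<close> of \<open>C\<^sup>n\<close> and an arrow of \<open>C\<^sup>n\<close> are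
  lists of length \<open>n\<close>, so \<open>FOOb\<close> and \<open>FOArr\<close> restricted to lists of length \<open>n\<close> form \<open>F(n)\<close>.
  The composition \<open>F(p)(Xs, F(q)(Ys), Zs) \<rightarrow> F(p+q-1)(Xs, Ys, Zs)\<close> with \<open>i = length Xs + 1\<close> is
  \<open>FOComp F Xs Ys Zs\<close>. For the enveloping functor-operad constructed below, functoriality,
  naturality and the operad relations are consequences of the construction.\<close>
record ('o, 'm) functor_operad =
  FOOb :: "'o list \<Rightarrow> 'o"
  FOArr :: "'m list \<Rightarrow> 'm"
  FOComp :: "'o list \<Rightarrow> 'o list \<Rightarrow> 'o list \<Rightarrow> 'm"
  FOUnit :: "'o \<Rightarrow> 'm"

text \<open>A pair \<open>(m, S)\<close> with \<open>S \<subseteq> {1..m}\<close> is encoded as a list of length \<open>m\<close> with entry \<open>None\<close> at the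
  positions in \<open>S\<close> and \<open>Some ()\<close> elsewhere; a triple \<open>(m, S, (k\<^sub>i)\<^sub>i)\<close> as such a list with
  entries \<open>Some k\<^sub>i\<close> off \<open>S\<close>. \<open>fill\<close> puts \<open>X\<^sub>1, \<dots>, X\<^sub>n\<close> in the distinguished positions.\<close>
fun fill :: "'a option list \<Rightarrow> 'a list \<Rightarrow> 'a list" where
  "fill [] Xs = []"
| "fill (None # w) Xs = hd Xs # fill w (tl Xs)"
| "fill (Some a # w) Xs = a # fill w Xs"

definition patterns :: "nat \<Rightarrow> 'a option list set" where
  "patterns n = {w. count_list w None = n}"

definition forget_arity :: "nat option list \<Rightarrow> unit option list" where
  "forget_arity w = map (map_option (\<lambda>_. ())) w"

definition flatten :: "nat option list \<Rightarrow> unit option list" where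
  "flatten w = concat (map (\<lambda>s. case s of None \<Rightarrow> [None] | Some k \<Rightarrow> replicate k (Some ())) w)"

definition factors0 :: "'o \<Rightarrow> unit option list \<Rightarrow> 'o list \<Rightarrow> 'o list" where
  "factors0 A w Xs = fill (map (map_option (\<lambda>_. A)) w) Xs"

definition factors1 ::
  "('oc, 'mc, 'y) monoidal_scheme \<Rightarrow> ('ov, 'mv, 'oc, 'mc, 'z) central_scheme
   \<Rightarrow> ('ov, 'mv) operad \<Rightarrow> 'oc \<Rightarrow> nat option list \<Rightarrow> 'oc list \<Rightarrow> 'oc list" where
  "factors1 C z P A w Xs = fill (map (map_option (\<lambda>k. optens C z P (replicate k A))) w) Xs"

text \<open>The operad composition of all the entries \<open>Some k\<close> of \<open>w\<close>, performed from left to right;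
  \<open>Ys\<close> are the tensor factors already treated. It is a map
  \<open>optens C z P (Ys @ factors1 C z P A w Xs) \<rightarrow> optens C z P (Ys @ factors0 A (flatten w) Xs)\<close>.\<close>
fun graft_all ::
  "('oc, 'mc, 'y) monoidal_scheme \<Rightarrow> ('ov, 'mv, 'oc, 'mc, 'z) central_scheme
   \<Rightarrow> ('ov, 'mv) operad \<Rightarrow> 'oc \<Rightarrow> 'oc list \<Rightarrow> nat option list \<Rightarrow> 'oc list \<Rightarrow> 'mc" where
  "graft_all C z P A Ys [] Xs = Ide C (optens C z P Ys)"
| "graft_all C z P A Ys (None # w) Xs = graft_all C z P A (Ys @ [hd Xs]) w (tl Xs)"
| "graft_all C z P A Ys (Some k # w) Xs =
     graft_all C z P A (Ys @ replicate k A) w Xs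
     \<cdot>\<^bsub>C\<^esub> graft C z P Ys (replicate k A) (factors1 C z P A w Xs)"

definition env0 ::
  "('oc, 'mc, 'y) monoidal_scheme \<Rightarrow> ('ov, 'mv, 'oc, 'mc, 'z) central_scheme
   \<Rightarrow> ('ov, 'mv) operad \<Rightarrow> 'oc \<Rightarrow> 'oc list \<Rightarrow> 'oc \<times> (unit option list \<Rightarrow> 'mc)" where
  "env0 C z P A Xs = coprod C (patterns (length Xs)) (\<lambda>w. optens C z P (factors0 A w Xs))"

text \<open>The two maps from the coproduct over \<open>(m, S, (k\<^sub>i)\<^sub>i)\<close>.\<close>

definition env_alg ::
  "('oc, 'mc, 'y) monoidal_scheme \<Rightarrow> ('ov, 'mv, 'oc, 'mc, 'z) central_scheme
   \<Rightarrow> ('ov, 'mv) operad \<Rightarrow> 'oc \<times> (nat \<Rightarrow> 'mc) \<Rightarrow> 'oc list \<Rightarrow> 'mc" where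
  "env_alg C z P Aa Xs = (case Aa of (A, \<alpha>) \<Rightarrow>
     copair C (patterns (length Xs)) (\<lambda>w. optens C z P (factors1 C z P A w Xs))
       (fst (env0 C z P A Xs))
       (\<lambda>w. snd (env0 C z P A Xs) (forget_arity w)
             \<cdot>\<^bsub>C\<^esub> optensA C z P (fill (map (map_option \<alpha>) w) (map (Ide C) Xs))))"

definition env_op ::
  "('oc, 'mc, 'y) monoidal_scheme \<Rightarrow> ('ov, 'mv, 'oc, 'mc, 'z) central_scheme
   \<Rightarrow> ('ov, 'mv) operad \<Rightarrow> 'oc \<times> (nat \<Rightarrow> 'mc) \<Rightarrow> 'oc list \<Rightarrow> 'mc" where
  "env_op C z P Aa Xs = (case Aa of (A, \<alpha>) \<Rightarrow>
     copair C (patterns (length Xs)) (\<lambda>w. optens C z P (factors1 C z P A w Xs))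
       (fst (env0 C z P A Xs))
       (\<lambda>w. snd (env0 C z P A Xs) (flatten w) \<cdot>\<^bsub>C\<^esub> graft_all C z P A [] w Xs))"

text \<open>In arity \<open>0\<close> the coequalizer is (split and) given by \<open>A\<close> with its structure maps; we choose
  this one, so that the enveloping functor-operad has value \<open>A\<close> in arity \<open>0\<close>, on the nose.\<close>
definition env_coeq ::
  "('oc, 'mc, 'y) monoidal_scheme \<Rightarrow> ('ov, 'mv, 'oc, 'mc, 'z) central_scheme
   \<Rightarrow> ('ov, 'mv) operad \<Rightarrow> 'oc \<times> (nat \<Rightarrow> 'mc) \<Rightarrow> 'oc list \<Rightarrow> 'mc" where
  "env_coeq C z P Aa Xs = (SOME q.
     is_coequalizer C (env_alg C z P Aa Xs) (env_op C z P Aa Xs) q \<and>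
     (Xs = [] \<longrightarrow> Cod C q = fst Aa \<and>
        (\<forall>w \<in> patterns 0. q \<cdot>\<^bsub>C\<^esub> snd (env0 C z P (fst Aa) []) w = snd Aa (length w))))"

definition env_ob ::
  "('oc, 'mc, 'y) monoidal_scheme \<Rightarrow> ('ov, 'mv, 'oc, 'mc, 'z) central_scheme
   \<Rightarrow> ('ov, 'mv) operad \<Rightarrow> 'oc \<times> (nat \<Rightarrow> 'mc) \<Rightarrow> 'oc list \<Rightarrow> 'oc" where
  "env_ob C z P Aa Xs = Cod C (env_coeq C z P Aa Xs)"

text \<open>The canonical map \<open>z(P(m)) \<otimes> Y\<^sub>1 \<otimes> \<dots> \<otimes> Y\<^sub>m \<rightarrow> P\<^sub>A(n)(X\<^sub>1, \<dots>, X\<^sub>n)\<close> of the summand \<open>w\<close>.\<close>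
definition env_in ::
  "('oc, 'mc, 'y) monoidal_scheme \<Rightarrow> ('ov, 'mv, 'oc, 'mc, 'z) central_scheme
   \<Rightarrow> ('ov, 'mv) operad \<Rightarrow> 'oc \<times> (nat \<Rightarrow> 'mc) \<Rightarrow> unit option list \<Rightarrow> 'oc list \<Rightarrow> 'mc" where
  "env_in C z P Aa w Xs = env_coeq C z P Aa Xs \<cdot>\<^bsub>C\<^esub> snd (env0 C z P (fst Aa) Xs) w"

definition env_arr ::
  "('oc, 'mc, 'y) monoidal_scheme \<Rightarrow> ('ov, 'mv, 'oc, 'mc, 'z) central_scheme
   \<Rightarrow> ('ov, 'mv) operad \<Rightarrow> 'oc \<times> (nat \<Rightarrow> 'mc) \<Rightarrow> 'mc list \<Rightarrow> 'mc" where
  "env_arr C z P Aa fs = (let Xs = map (Dom C) fs; Ys = map (Cod C) fs in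
     THE h. h \<in> hom C (env_ob C z P Aa Xs) (env_ob C z P Aa Ys) \<and>
       (\<forall>w \<in> patterns (length fs).
          h \<cdot>\<^bsub>C\<^esub> env_in C z P Aa w Xs
          = env_in C z P Aa w Ys
            \<cdot>\<^bsub>C\<^esub> optensA C z P (fill (map (map_option (\<lambda>_. Ide C (fst Aa))) w) fs)))"

definition env_comp ::
  "('oc, 'mc, 'y) monoidal_scheme \<Rightarrow> ('ov, 'mv, 'oc, 'mc, 'z) central_scheme
   \<Rightarrow> ('ov, 'mv) operad \<Rightarrow> 'oc \<times> (nat \<Rightarrow> 'mc) \<Rightarrow> 'oc list \<Rightarrow> 'oc list \<Rightarrow> 'oc list \<Rightarrow> 'mc" where
  "env_comp C z P Aa Xs Ys Zs =
     (let A = fst Aa; XYZs = Xs @ [env_ob C z P Aa Ys] @ Zs in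
      THE h. h \<in> hom C (env_ob C z P Aa XYZs) (env_ob C z P Aa (Xs @ Ys @ Zs)) \<and>
        (\<forall>u \<in> patterns (length Xs). \<forall>w \<in> patterns (length Ys). \<forall>v \<in> patterns (length Zs).
           h \<cdot>\<^bsub>C\<^esub> env_in C z P Aa (u @ [None] @ v) XYZs
             \<cdot>\<^bsub>C\<^esub> optensA C z P (map (Ide C) (factors0 A u Xs) @ [env_in C z P Aa w Ys]
                                @ map (Ide C) (factors0 A v Zs))
           = env_in C z P Aa (u @ w @ v) (Xs @ Ys @ Zs)
             \<cdot>\<^bsub>C\<^esub> graft C z P (factors0 A u Xs) (factors0 A w Ys) (factors0 A v Zs)))"

definition enveloping ::
  "('oc, 'mc, 'y) monoidal_scheme \<Rightarrow> ('ov, 'mv, 'oc, 'mc, 'z) central_scheme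
   \<Rightarrow> ('ov, 'mv) operad \<Rightarrow> 'oc \<times> (nat \<Rightarrow> 'mc) \<Rightarrow> ('oc, 'mc) functor_operad" where
  "enveloping C z P Aa =
     \<lparr>FOOb = env_ob C z P Aa,
      FOArr = env_arr C z P Aa,
      FOComp = env_comp C z P Aa,
      FOUnit = (\<lambda>X. env_in C z P Aa [None] [X] \<cdot>\<^bsub>C\<^esub> opunit C z P X)\<rparr>"

section \<open>Latching maps\<close>

text \<open>The poset \<open>2\<^sup>t\<close>, with \<open>False < True\<close> for \<open>0 < 1\<close>; an arrow is a pair \<open>(x, y)\<close> with
  \<open>x \<le> y\<close>.\<close>
definition cube :: "nat \<Rightarrow> (bool list, bool list \<times> bool list) category" where
  "cube t =
     \<lparr>Obj = {x. length x = t},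
      Arr = {(x, y). length x = t \<and> list_all2 (\<le>) x y},
      Dom = fst, Cod = snd, Ide = (\<lambda>x. (x, x)), Comp = (\<lambda>g f. (fst f, snd g))\<rparr>"

text \<open>An arrow \<open>f\<close> regarded as a functor from \<open>2\<close>.\<close>
definition edgeO :: "('o, 'm, 'x) category_scheme \<Rightarrow> 'm \<Rightarrow> bool \<Rightarrow> 'o" where
  "edgeO C f a = (if a then Cod C f else Dom C f)"

definition edgeA :: "('o, 'm, 'x) category_scheme \<Rightarrow> 'm \<Rightarrow> bool \<times> bool \<Rightarrow> 'm" where
  "edgeA C f = (\<lambda>(a, b). if a = b then Ide C (edgeO C f a) else f)"

text \<open>The composite functor \<open>F(f\<^sub>1, \<dots>, f\<^sub>t)\<close>, for a functor \<open>F\<close> from \<open>C\<^sup>t\<close> to \<open>C\<close>.\<close>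
definition cube_functor ::
  "('o, 'm, 'x) category_scheme \<Rightarrow> ('o list \<Rightarrow> 'o) \<Rightarrow> ('m list \<Rightarrow> 'm) \<Rightarrow> 'm list
   \<Rightarrow> (bool list, bool list \<times> bool list, 'o, 'm) func" where
  "cube_functor C FO FA fs =
     \<lparr>FOb = (\<lambda>x. FO (map2 (edgeO C) fs x)),
      FArr = (\<lambda>(x, y). FA (map2 (edgeA C) fs (zip x y)))\<rparr>"

definition latching ::
  "('o, 'm, 'x) category_scheme \<Rightarrow> nat
   \<Rightarrow> (bool list, bool list \<times> bool list, 'o, 'm) func \<Rightarrow> 'o \<times> (bool list \<Rightarrow> 'm)" where
  "latching C t D = colim (full_subcat (cube t) (- {replicate t True})) C D"

definition latching_map ::
  "('o, 'm, 'x) category_scheme \<Rightarrow> nat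
   \<Rightarrow> (bool list, bool list \<times> bool list, 'o, 'm) func \<Rightarrow> 'm" where
  "latching_map C t D =
     (THE k. k \<in> hom C (fst (latching C t D)) (FOb D (replicate t True)) \<and>
        (\<forall>x \<in> Obj (cube t) - {replicate t True}.
           k \<cdot>\<^bsub>C\<^esub> snd (latching C t D) x = FArr D (x, replicate t True)))"

end

theory Submission
  imports Defs "HOL-Library.Countable"
begin

text \<open>
  The enveloping functor-operad \<open>P\<^sub>A\<close> is a coequalizer of two maps, one of which lets the algebra act
  at all undistinguished letters of a word and the other of which composes all the operations. The
  operad unit makes this the same as imposing a relation at one letter at a time: wherever an
  operation stands at a letter \<open>A\<close>, it may either act on its arguments or be composed into the word
  (\<open>balanced_iff\<close>). So a map out of \<open>P\<^sub>A(n)(X\<^sub>1, \<dots>, X\<^sub>n)\<close> is a family of maps on words that satisfies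
  the one-letter relations (\<open>env_universal\<close>). In arity \<open>0\<close> the unit also splits the coequalizer,
  which gives \<open>A\<close> (\<open>arity_0_coequalizer\<close>).

  This description makes the nullary composition
  \<open>P\<^sub>A(n+1)(\<dots>, A, \<dots>) \<rightarrow> P\<^sub>A(n)(\<dots>, \<dots>)\<close> transparent: it forgets that one letter \<open>A\<close> is distinguished and is
  the identity on each summand (\<open>env_comp_nullary\<close>). In particular it is natural in the other slots
  (\<open>env_comp_nat\<close>), and two such compositions in different slots commute (\<open>env_comp_commute\<close>). Write
  \<open>attach\<close> for the map \<open>P\<^sub>A(n+1)(\<dots>, Y, \<dots>) \<rightarrow> P\<^sub>A(n)(\<dots>, \<dots>)\<close> that first replaces \<open>Y\<close> by \<open>A\<close> along \<open>gbar\<close>; it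
  inherits both properties.

  The sequence is built by recursion, every stage being a pushout of the latching map along the
  attaching map. What has to be shown is that the attaching map exists. A map out of the latching
  object is prescribed by its values on the maximal vertices of the punctured cube, where exactly one
  coordinate is \<open>Y\<close>, and two prescribed values have to agree on the vertex where both coordinates
  are \<open>Y\<close> (\<open>latch_extend\<close>). There, by naturality, \<open>attach\<close> in one slot after \<open>f\<close> in the other slot is
  \<open>f\<close> after \<open>attach\<close>; by the previous pushout square, the map to the current stage composed with \<open>f\<close> in
  one slot is \<open>attach\<close> in that slot, followed by the map to the stage before and the inclusion. So both
  values become composites of two maps \<open>attach\<close>, taken in the two possible orders, and these are equal
  (\<open>attach_compatible_Suc\<close>).

  The technical input is that grafting an operation into a word is natural and satisfies the two unit
  laws (\<open>graft_nat\<close>, \<open>graft_right_unit\<close>, \<open>graft_left_unit\<close>). For the unit laws, the operation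
  has to be moved to the front of the word by the half-braidings, so these laws rest on the
  compatibility of the unit \<open>\<epsilon>\<close> of \<open>z\<close> with the half-braiding of the unit object, and on Kelly's
  coherence laws for the unitors.
\<close>

section \<open>Calculus of arrows\<close>

context category
begin

lemma homD: "f \<in> hom C X Y \<Longrightarrow> f \<in> Arr C" "f \<in> hom C X Y \<Longrightarrow> Dom C f = X" "f \<in> hom C X Y \<Longrightarrow> Cod C f = Y"
  by (auto simp: hom_def)

lemma hom_Dom_Cod: "f \<in> Arr C \<Longrightarrow> f \<in> hom C (Dom C f) (Cod C f)"
  by (auto simp: hom_def)

lemma Obj_of_hom: "f \<in> hom C X Y \<Longrightarrow> X \<in> Obj C" "f \<in> hom C X Y \<Longrightarrow> Y \<in> Obj C"
  using Dom_closed Cod_closed by (auto simp: hom_def)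

lemma Ide_arr [simp]:
  assumes "X \<in> Obj C"
  shows "Ide C X \<in> Arr C" "Dom C (Ide C X) = X" "Cod C (Ide C X) = X"
  using Ide_hom[OF assms] by (auto simp: hom_def)

lemma Comp_arr [simp]:
  assumes "f \<in> Arr C" "g \<in> Arr C" "Dom C g = Cod C f"
  shows "g \<cdot> f \<in> Arr C" "Dom C (g \<cdot> f) = Dom C f" "Cod C (g \<cdot> f) = Cod C g"
  using Comp_hom[of f "Dom C f" "Cod C f" g "Cod C g"] assms by (auto simp: hom_def)

lemma Dom_Cod_Obj [simp]: "f \<in> Arr C \<Longrightarrow> Dom C f \<in> Obj C" "f \<in> Arr C \<Longrightarrow> Cod C f \<in> Obj C"
  by (auto intro: Dom_closed Cod_closed)

lemma Comp_Ide_simp [simp]: "\<lbrakk>f \<in> Arr C; Dom C f = X\<rbrakk> \<Longrightarrow> f \<cdot> Ide C X = f"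
  using Comp_Ide hom_Dom_Cod by blast

lemma Ide_Comp_simp [simp]: "\<lbrakk>f \<in> Arr C; Cod C f = Y\<rbrakk> \<Longrightarrow> Ide C Y \<cdot> f = f"
  using Ide_Comp hom_Dom_Cod by blast

lemma assoc_simp [simp]:
  "\<lbrakk>f \<in> Arr C; g \<in> Arr C; h \<in> Arr C; Dom C g = Cod C f; Dom C h = Cod C g\<rbrakk>
   \<Longrightarrow> (h \<cdot> g) \<cdot> f = h \<cdot> (g \<cdot> f)"
  using Comp_assoc[of f "Dom C f" "Cod C f" g "Cod C g" h "Cod C h"] by (auto simp: hom_def)

text \<open>Composites are normalised by bracketing them to the right. In a longer composite the left-hand
  side \<open>a \<cdot> b\<close> of an equation is then not a subterm; this form of the equation still applies.\<close>
lemma Comp_eq_extend: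
  "\<lbrakk>a \<cdot> b = c; a \<in> Arr C; b \<in> Arr C; k \<in> Arr C; Dom C a = Cod C b; Dom C b = Cod C k\<rbrakk>
   \<Longrightarrow> a \<cdot> (b \<cdot> k) = c \<cdot> k"
  by (metis assoc_simp)

lemma inverse_unique:
  assumes f: "f \<in> Arr C" and "is_inverse C f g" "is_inverse C f h"
  shows "g = h"
proof -
  have g: "g \<in> Arr C" "Dom C g = Cod C f" "Cod C g = Dom C f" "g \<cdot> f = Ide C (Dom C f)"
    and h: "h \<in> Arr C" "Dom C h = Cod C f" "Cod C h = Dom C f" "f \<cdot> h = Ide C (Cod C f)"
    using assms by (auto simp: is_inverse_def hom_def)
  have "(g \<cdot> f) \<cdot> h = g \<cdot> (f \<cdot> h)"
    using f g h by (subst assoc_simp) auto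
  then show ?thesis
    using g h f by simp
qed

lemma inverse_arr:
  assumes "f \<in> iso C X Y"
  shows "inverse_arr C f \<in> Arr C" "Dom C (inverse_arr C f) = Y" "Cod C (inverse_arr C f) = X"
    "inverse_arr C f \<cdot> f = Ide C X" "f \<cdot> inverse_arr C f = Ide C Y"
proof -
  obtain g where g: "is_inverse C f g" and f: "f \<in> hom C X Y"
    using assms by (auto simp: iso_def)
  have "inverse_arr C f = g"
    unfolding inverse_arr_def using g inverse_unique[of f] f by (intro the_equality) (auto simp: hom_def)
  then show "inverse_arr C f \<in> Arr C" "Dom C (inverse_arr C f) = Y" "Cod C (inverse_arr C f) = X"
    "inverse_arr C f \<cdot> f = Ide C X" "f \<cdot> inverse_arr C f = Ide C Y"
    using g f by (auto simp: is_inverse_def hom_def)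
qed

lemma iso_arr: "f \<in> iso C X Y \<Longrightarrow> f \<in> Arr C" "f \<in> iso C X Y \<Longrightarrow> Dom C f = X" "f \<in> iso C X Y \<Longrightarrow> Cod C f = Y"
  by (auto simp: iso_def hom_def)

lemma inverse_cancel:
  assumes "f \<in> iso C X Y" "k \<in> Arr C"
  shows "Cod C k = X \<Longrightarrow> inverse_arr C f \<cdot> (f \<cdot> k) = k"
    and "Cod C k = Y \<Longrightarrow> f \<cdot> (inverse_arr C f \<cdot> k) = k"
proof -
  note [simp] = inverse_arr[OF assms(1)] iso_arr[OF assms(1)] assms(2)
  show "inverse_arr C f \<cdot> (f \<cdot> k) = k" if "Cod C k = X"
    using Comp_eq_extend[of "inverse_arr C f" f "Ide C X" k] that by simp
  show "f \<cdot> (inverse_arr C f \<cdot> k) = k" if "Cod C k = Y"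
    using Comp_eq_extend[of f "inverse_arr C f" "Ide C Y" k] that by simp
qed

lemmas iso_simps = iso_arr inverse_arr inverse_cancel

lemma iso_cancel_right:
  assumes "f \<in> iso C X Y" "a \<in> Arr C" "b \<in> Arr C" "Dom C a = Y" "Dom C b = Y" "a \<cdot> f = b \<cdot> f"
  shows "a = b"
proof -
  note [simp] = inverse_arr[OF assms(1)] iso_arr[OF assms(1)] assms(2-5)
  have "(a \<cdot> f) \<cdot> inverse_arr C f = (b \<cdot> f) \<cdot> inverse_arr C f"
    by (simp only: assms(6))
  then show ?thesis by simp
qed

lemma iso_cancel_left:
  assumes "f \<in> iso C X Y" "a \<in> Arr C" "b \<in> Arr C" "Cod C a = X" "Cod C b = X" "f \<cdot> a = f \<cdot> b"
  shows "a = b"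
  using inverse_cancel(1)[OF assms(1)] assms by metis

lemma isoI:
  "\<lbrakk>f \<in> Arr C; g \<in> Arr C; Dom C f = X; Cod C f = Y; Dom C g = Y; Cod C g = X;
    g \<cdot> f = Ide C X; f \<cdot> g = Ide C Y\<rbrakk> \<Longrightarrow> f \<in> iso C X Y"
  by (auto simp: iso_def is_inverse_def hom_def)

lemma Comp_iso:
  assumes "f \<in> iso C X Y" "g \<in> iso C Y Z"
  shows "g \<cdot> f \<in> iso C X Z"
  by (rule isoI[where g = "inverse_arr C f \<cdot> inverse_arr C g"])
    (simp_all add: inverse_arr[OF assms(1)] inverse_arr[OF assms(2)] iso_arr[OF assms(1)]
       iso_arr[OF assms(2)] inverse_cancel[OF assms(1)] inverse_cancel[OF assms(2)])

abbreviation "cinv \<equiv> inverse_arr C"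
abbreviation "ids \<equiv> map (Ide C)"
abbreviation "doms \<equiv> map (Dom C)"
abbreviation "cods \<equiv> map (Cod C)"

abbreviation composable :: "'m list \<Rightarrow> 'm list \<Rightarrow> bool" where
  "composable \<equiv> list_all2 (\<lambda>g f. g \<in> Arr C \<and> f \<in> Arr C \<and> Dom C g = Cod C f)"

lemma composable_Ide:
  assumes "set xs \<subseteq> Arr C"
  shows "composable xs (ids (doms xs))"
    and "map2 (\<cdot>) xs (ids (doms xs)) = xs"
    and "composable (ids (cods xs)) xs"
    and "map2 (\<cdot>) (ids (cods xs)) xs = xs"
  using assms by (induction xs) auto

end

section \<open>Coherence in monoidal categories\<close>

context monoidal_category
begin

lemma TenO_Obj [simp]: "\<lbrakk>X \<in> Obj C; Y \<in> Obj C\<rbrakk> \<Longrightarrow> X \<otimes> Y \<in> Obj C"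
  by (rule TenO_closed)

lemma Unit_Obj [simp]: "Unit C \<in> Obj C"
  by (rule Unit_closed)

lemma TenA_arr [simp]:
  assumes "f \<in> Arr C" "g \<in> Arr C"
  shows "f \<boxtimes> g \<in> Arr C" "Dom C (f \<boxtimes> g) = Dom C f \<otimes> Dom C g" "Cod C (f \<boxtimes> g) = Cod C f \<otimes> Cod C g"
  using TenA_hom[OF hom_Dom_Cod hom_Dom_Cod, OF assms] by (auto simp: hom_def)

lemma TenA_Ide_simp [simp]: "\<lbrakk>X \<in> Obj C; Y \<in> Obj C\<rbrakk> \<Longrightarrow> Ide C X \<boxtimes> Ide C Y = Ide C (X \<otimes> Y)"
  by (rule TenA_Ide)

lemma interchange:
  "\<lbrakk>f \<in> Arr C; f' \<in> Arr C; g \<in> Arr C; g' \<in> Arr C; Dom C f' = Cod C f; Dom C g' = Cod C g\<rbrakk>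
   \<Longrightarrow> (f' \<boxtimes> g') \<cdot> (f \<boxtimes> g) = (f' \<cdot> f) \<boxtimes> (g' \<cdot> g)"
  using TenA_Comp[OF hom_Dom_Cod _ hom_Dom_Cod, of f f' "Cod C f'" g g' "Cod C g'"]
  by (auto simp: hom_def)

lemma interchange_extend:
  "\<lbrakk>f \<in> Arr C; f' \<in> Arr C; g \<in> Arr C; g' \<in> Arr C; Dom C f' = Cod C f; Dom C g' = Cod C g;
    k \<in> Arr C; Cod C k = Dom C f \<otimes> Dom C g\<rbrakk>
   \<Longrightarrow> (f' \<boxtimes> g') \<cdot> ((f \<boxtimes> g) \<cdot> k) = ((f' \<cdot> f) \<boxtimes> (g' \<cdot> g)) \<cdot> k"
  by (intro Comp_eq_extend interchange) auto

lemma TenA_iso: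
  assumes "f \<in> iso C X X'" "g \<in> iso C Y Y'"
  shows "f \<boxtimes> g \<in> iso C (X \<otimes> Y) (X' \<otimes> Y')"
proof -
  note [simp] = inverse_arr[OF assms(1)] inverse_arr[OF assms(2)]
    iso_arr[OF assms(1)] iso_arr[OF assms(2)]
  have [simp]: "X \<in> Obj C" "X' \<in> Obj C" "Y \<in> Obj C" "Y' \<in> Obj C"
    using iso_arr[OF assms(1)] iso_arr[OF assms(2)] Dom_closed Cod_closed by blast+
  show ?thesis
    by (rule isoI[where g = "cinv f \<boxtimes> cinv g"])
      (simp_all add: interchange)
qed

lemma Ide_iso: "X \<in> Obj C \<Longrightarrow> Ide C X \<in> iso C X X"
  by (rule isoI[where g = "Ide C X"]) auto

lemmas Assoc_simps [simp] = iso_simps[OF Assoc_iso]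
lemmas LUnit_simps [simp] = iso_simps[OF LUnit_iso]
lemmas RUnit_simps [simp] = iso_simps[OF RUnit_iso]

lemma Assoc_nat:
  assumes "f \<in> Arr C" "g \<in> Arr C" "h \<in> Arr C"
  shows "Assoc C (Cod C f) (Cod C g) (Cod C h) \<cdot> ((f \<boxtimes> g) \<boxtimes> h)
         = (f \<boxtimes> (g \<boxtimes> h)) \<cdot> Assoc C (Dom C f) (Dom C g) (Dom C h)"
  using Assoc_natural[OF hom_Dom_Cod hom_Dom_Cod hom_Dom_Cod] assms by blast

lemma Assoc_inverse_nat:
  assumes [simp]: "f \<in> Arr C" "g \<in> Arr C" "h \<in> Arr C"
  shows "cinv (Assoc C (Cod C f) (Cod C g) (Cod C h)) \<cdot> (f \<boxtimes> (g \<boxtimes> h))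
         = ((f \<boxtimes> g) \<boxtimes> h) \<cdot> cinv (Assoc C (Dom C f) (Dom C g) (Dom C h))"
proof (rule iso_cancel_right[OF Assoc_iso[of "Dom C f" "Dom C g" "Dom C h"]])
  show "(cinv (Assoc C (Cod C f) (Cod C g) (Cod C h)) \<cdot> (f \<boxtimes> (g \<boxtimes> h)))
          \<cdot> Assoc C (Dom C f) (Dom C g) (Dom C h)
        = (((f \<boxtimes> g) \<boxtimes> h) \<cdot> cinv (Assoc C (Dom C f) (Dom C g) (Dom C h)))
          \<cdot> Assoc C (Dom C f) (Dom C g) (Dom C h)"
    by (simp add: Assoc_nat[OF assms, symmetric])
qed simp_all

lemma Unit_tensor_faithful:
  assumes [simp]: "f \<in> Arr C" "g \<in> Arr C" "Dom C f = Dom C g" "Cod C f = Cod C g"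
    and eq: "Ide C (Unit C) \<boxtimes> f = Ide C (Unit C) \<boxtimes> g"
  shows "f = g"
proof (rule iso_cancel_right[OF LUnit_iso[of "Dom C g"]])
  show "f \<cdot> LUnit C (Dom C g) = g \<cdot> LUnit C (Dom C g)"
    using LUnit_natural[of f "Dom C g" "Cod C g"] LUnit_natural[of g "Dom C g" "Cod C g"] eq
    by (simp add: hom_def)
qed simp_all

lemma tensor_Unit_faithful:
  assumes [simp]: "f \<in> Arr C" "g \<in> Arr C" "Dom C f = Dom C g" "Cod C f = Cod C g"
    and eq: "f \<boxtimes> Ide C (Unit C) = g \<boxtimes> Ide C (Unit C)"
  shows "f = g"
proof (rule iso_cancel_right[OF RUnit_iso[of "Dom C g"]])
  show "f \<cdot> RUnit C (Dom C g) = g \<cdot> RUnit C (Dom C g)"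
    using RUnit_natural[of f "Dom C g" "Cod C g"] RUnit_natural[of g "Dom C g" "Cod C g"] eq
    by (simp add: hom_def)
qed simp_all

text \<open>Kelly's coherence laws, which follow from the pentagon and the triangle. Tensoring with the unit
  object is faithful because the unitors are natural isomorphisms. After this tensoring, both sides
  become parts of a pentagon whose other sides are known by the triangle and naturality.\<close>
lemma LUnit_tensor:
  assumes [simp]: "X \<in> Obj C" "Y \<in> Obj C"
  shows "LUnit C (X \<otimes> Y) \<cdot> Assoc C (Unit C) X Y = LUnit C X \<boxtimes> Ide C Y"
proof (rule Unit_tensor_faithful)
  let ?I = "Unit C"
  have pent: "(Ide C ?I \<boxtimes> Assoc C ?I X Y) \<cdot> (Assoc C ?I (?I \<otimes> X) Y \<cdot> (Assoc C ?I ?I X \<boxtimes> Ide C Y))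
      = Assoc C ?I ?I (X \<otimes> Y) \<cdot> Assoc C (?I \<otimes> ?I) X Y"
    using pentagon[of ?I ?I X Y] by simp
  have "(Ide C ?I \<boxtimes> (LUnit C (X \<otimes> Y) \<cdot> Assoc C ?I X Y))
          \<cdot> (Assoc C ?I (?I \<otimes> X) Y \<cdot> (Assoc C ?I ?I X \<boxtimes> Ide C Y))
      = (Ide C ?I \<boxtimes> LUnit C (X \<otimes> Y)) \<cdot> ((Ide C ?I \<boxtimes> Assoc C ?I X Y)
          \<cdot> (Assoc C ?I (?I \<otimes> X) Y \<cdot> (Assoc C ?I ?I X \<boxtimes> Ide C Y)))"
    by (simp add: interchange_extend)
  also have "\<dots> = (RUnit C ?I \<boxtimes> Ide C (X \<otimes> Y)) \<cdot> Assoc C (?I \<otimes> ?I) X Y"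
    unfolding pent by (subst Comp_eq_extend[OF triangle]) simp_all
  also have "\<dots> = Assoc C ?I X Y \<cdot> ((RUnit C ?I \<boxtimes> Ide C X) \<boxtimes> Ide C Y)"
    using Assoc_nat[of "RUnit C ?I" "Ide C X" "Ide C Y"] by simp
  also have "\<dots> = Assoc C ?I X Y \<cdot> (((Ide C ?I \<boxtimes> LUnit C X) \<boxtimes> Ide C Y) \<cdot> (Assoc C ?I ?I X \<boxtimes> Ide C Y))"
    by (simp add: interchange triangle)
  also have "\<dots> = (Ide C ?I \<boxtimes> (LUnit C X \<boxtimes> Ide C Y))
          \<cdot> (Assoc C ?I (?I \<otimes> X) Y \<cdot> (Assoc C ?I ?I X \<boxtimes> Ide C Y))"
    using Comp_eq_extend[OF Assoc_nat[of "Ide C ?I" "LUnit C X" "Ide C Y"]] by simp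
  finally have eq: "(Ide C ?I \<boxtimes> (LUnit C (X \<otimes> Y) \<cdot> Assoc C ?I X Y))
          \<cdot> (Assoc C ?I (?I \<otimes> X) Y \<cdot> (Assoc C ?I ?I X \<boxtimes> Ide C Y))
      = (Ide C ?I \<boxtimes> (LUnit C X \<boxtimes> Ide C Y))
          \<cdot> (Assoc C ?I (?I \<otimes> X) Y \<cdot> (Assoc C ?I ?I X \<boxtimes> Ide C Y))" .
  have "Assoc C ?I (?I \<otimes> X) Y \<cdot> (Assoc C ?I ?I X \<boxtimes> Ide C Y)
        \<in> iso C (((?I \<otimes> ?I) \<otimes> X) \<otimes> Y) (?I \<otimes> ((?I \<otimes> X) \<otimes> Y))"
    by (intro Comp_iso[OF TenA_iso Assoc_iso] Assoc_iso Ide_iso) simp_all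
  from iso_cancel_right[OF this _ _ _ _ eq]
  show "Ide C ?I \<boxtimes> (LUnit C (X \<otimes> Y) \<cdot> Assoc C ?I X Y) = Ide C ?I \<boxtimes> LUnit C X \<boxtimes> Ide C Y"
    by simp
qed simp_all

lemma RUnit_tensor:
  assumes [simp]: "X \<in> Obj C" "Y \<in> Obj C"
  shows "(Ide C X \<boxtimes> RUnit C Y) \<cdot> Assoc C X Y (Unit C) = RUnit C (X \<otimes> Y)"
proof (rule tensor_Unit_faithful)
  let ?I = "Unit C"
  have "Assoc C X Y ?I \<cdot> (((Ide C X \<boxtimes> RUnit C Y) \<cdot> Assoc C X Y ?I) \<boxtimes> Ide C ?I)
      = Assoc C X Y ?I \<cdot> (((Ide C X \<boxtimes> RUnit C Y) \<boxtimes> Ide C ?I) \<cdot> (Assoc C X Y ?I \<boxtimes> Ide C ?I))"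
    by (simp add: interchange)
  also have "\<dots> = (Ide C X \<boxtimes> (RUnit C Y \<boxtimes> Ide C ?I)) \<cdot> (Assoc C X (Y \<otimes> ?I) ?I \<cdot> (Assoc C X Y ?I \<boxtimes> Ide C ?I))"
    using Comp_eq_extend[OF Assoc_nat[of "Ide C X" "RUnit C Y" "Ide C ?I"]] by simp
  also have "\<dots> = (Ide C X \<boxtimes> (Ide C Y \<boxtimes> LUnit C ?I)) \<cdot> ((Ide C X \<boxtimes> Assoc C Y ?I ?I)
        \<cdot> (Assoc C X (Y \<otimes> ?I) ?I \<cdot> (Assoc C X Y ?I \<boxtimes> Ide C ?I)))"
    by (simp add: interchange_extend triangle)
  also have "(Ide C X \<boxtimes> Assoc C Y ?I ?I) \<cdot> (Assoc C X (Y \<otimes> ?I) ?I \<cdot> (Assoc C X Y ?I \<boxtimes> Ide C ?I))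
      = Assoc C X Y (?I \<otimes> ?I) \<cdot> Assoc C (X \<otimes> Y) ?I ?I"
    using pentagon[of X Y ?I ?I] by simp
  also have "(Ide C X \<boxtimes> (Ide C Y \<boxtimes> LUnit C ?I)) \<cdot> (Assoc C X Y (?I \<otimes> ?I) \<cdot> Assoc C (X \<otimes> Y) ?I ?I)
      = Assoc C X Y ?I \<cdot> ((Ide C (X \<otimes> Y) \<boxtimes> LUnit C ?I) \<cdot> Assoc C (X \<otimes> Y) ?I ?I)"
    using Comp_eq_extend[OF Assoc_nat[of "Ide C X" "Ide C Y" "LUnit C ?I", symmetric],
        of "Assoc C (X \<otimes> Y) ?I ?I"] by simp
  also have "\<dots> = Assoc C X Y ?I \<cdot> (RUnit C (X \<otimes> Y) \<boxtimes> Ide C ?I)"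
    by (simp add: triangle)
  finally show "((Ide C X \<boxtimes> RUnit C Y) \<cdot> Assoc C X Y ?I) \<boxtimes> Ide C ?I = RUnit C (X \<otimes> Y) \<boxtimes> Ide C ?I"
    by (rule iso_cancel_left[OF Assoc_iso[of X Y ?I], rotated -1]) simp_all
qed simp_all

lemma LUnit_Unit: "LUnit C (Unit C) = RUnit C (Unit C)"
proof (rule tensor_Unit_faithful)
  let ?I = "Unit C"
  have "LUnit C (?I \<otimes> ?I) = Ide C ?I \<boxtimes> LUnit C ?I"
    using LUnit_natural[of "LUnit C ?I" "?I \<otimes> ?I" ?I]
    by (auto simp: hom_def intro!: iso_cancel_left[OF LUnit_iso[of ?I], of "LUnit C (?I \<otimes> ?I)"])
  then have "LUnit C ?I \<boxtimes> Ide C ?I = (Ide C ?I \<boxtimes> LUnit C ?I) \<cdot> Assoc C ?I ?I ?I"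
    using LUnit_tensor[of ?I ?I] by simp
  then show "LUnit C ?I \<boxtimes> Ide C ?I = RUnit C ?I \<boxtimes> Ide C ?I"
    by (simp add: triangle)
qed simp_all

end

section \<open>Countable colimits\<close>

lemma coproduct_arr:
  assumes "is_coproduct C I D c \<iota>"
  shows "c \<in> Obj C" "i \<in> I \<Longrightarrow> \<iota> i \<in> hom C (D i) c"
proof -
  show "c \<in> Obj C"
    using assms unfolding is_coproduct_def by (elim conjE)
  have "\<forall>i\<in>I. \<iota> i \<in> hom C (D i) c"
    using assms unfolding is_coproduct_def by (elim conjE)
  then show "i \<in> I \<Longrightarrow> \<iota> i \<in> hom C (D i) c"
    by blast
qed

lemma coequalizerD:
  assumes "is_coequalizer C d d' q"
  shows "q \<in> Arr C" "Dom C q = Cod C d" "q \<cdot>\<^bsub>C\<^esub> d = q \<cdot>\<^bsub>C\<^esub> d'"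
proof -
  show "q \<in> Arr C"
    using assms unfolding is_coequalizer_def by (elim conjE)
  show "Dom C q = Cod C d"
    using assms unfolding is_coequalizer_def by (elim conjE)
  show "q \<cdot>\<^bsub>C\<^esub> d = q \<cdot>\<^bsub>C\<^esub> d'"
    using assms unfolding is_coequalizer_def by (elim conjE)
qed

lemma coequalizer_universal:
  assumes "is_coequalizer C d d' q" "h \<in> Arr C" "Dom C h = Cod C d" "h \<cdot>\<^bsub>C\<^esub> d = h \<cdot>\<^bsub>C\<^esub> d'"
  shows "\<exists>!k. k \<in> hom C (Cod C q) (Cod C h) \<and> k \<cdot>\<^bsub>C\<^esub> q = h"
proof -
  have "\<forall>h\<in>Arr C. Dom C h = Cod C d \<and> h \<cdot>\<^bsub>C\<^esub> d = h \<cdot>\<^bsub>C\<^esub> d' \<longrightarrow>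
      (\<exists>!k. k \<in> hom C (Cod C q) (Cod C h) \<and> k \<cdot>\<^bsub>C\<^esub> q = h)"
    using assms(1) unfolding is_coequalizer_def by (elim conjE)
  from mp[OF bspec[OF this assms(2)] conjI[OF assms(3,4)]] show ?thesis .
qed

lemma ex1_unique: "\<lbrakk>\<exists>!x. Q x; Q a; Q b\<rbrakk> \<Longrightarrow> a = b"
  by blast

lemma coproduct_universal:
  assumes "is_coproduct C I D c \<iota>" "X \<in> Obj C" "\<forall>i\<in>I. h i \<in> hom C (D i) X"
  shows "\<exists>!k. k \<in> hom C c X \<and> (\<forall>i\<in>I. k \<cdot>\<^bsub>C\<^esub> \<iota> i = h i)"
proof -
  have "\<forall>X\<in>Obj C. \<forall>h. (\<forall>i\<in>I. h i \<in> hom C (D i) X) \<longrightarrow>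
      (\<exists>!k. k \<in> hom C c X \<and> (\<forall>i\<in>I. k \<cdot>\<^bsub>C\<^esub> \<iota> i = h i))"
    using assms(1) unfolding is_coproduct_def by (elim conjE)
  from mp[OF spec[OF bspec[OF this assms(2)], of h] assms(3)] show ?thesis .
qed

lemma colimit_universal:
  assumes "is_colimit J C D c \<iota>" "X \<in> Obj C" "\<forall>j\<in>Obj J. h j \<in> hom C (FOb D j) X"
    "\<forall>u\<in>Arr J. h (Cod J u) \<cdot>\<^bsub>C\<^esub> FArr D u = h (Dom J u)"
  shows "\<exists>!k. k \<in> hom C c X \<and> (\<forall>j\<in>Obj J. k \<cdot>\<^bsub>C\<^esub> \<iota> j = h j)"
proof -
  have "\<forall>X\<in>Obj C. \<forall>h. (\<forall>j\<in>Obj J. h j \<in> hom C (FOb D j) X) \<and>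
        (\<forall>u\<in>Arr J. h (Cod J u) \<cdot>\<^bsub>C\<^esub> FArr D u = h (Dom J u)) \<longrightarrow>
        (\<exists>!k. k \<in> hom C c X \<and> (\<forall>j\<in>Obj J. k \<cdot>\<^bsub>C\<^esub> \<iota> j = h j))"
    using assms(1) unfolding is_colimit_def by (elim conjE)
  from mp[OF spec[OF bspec[OF this assms(2)], of h] conjI[OF assms(3,4)]] show ?thesis .
qed

text \<open>The universe \<open>'u\<close> is infinite, so it contains a copy of any countable index category.\<close>
lemma countable_colimit:
  fixes J :: "('i::countable, 'k::countable) category" and C :: "('o, 'm, 'x) category_scheme"
    and D :: "('i, 'k, 'o, 'm) func"
  assumes inf: "infinite (UNIV :: 'u set)" and bic: "bicomplete TYPE('u) C"
    and J: "category J" and D: "is_functor J C D"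
  shows "\<exists>c \<iota>. is_colimit J C D c \<iota>"
proof -
  obtain e :: "nat \<Rightarrow> 'u" where e: "inj e"
    using infinite_countable_subset[OF inf] by auto
  define p :: "'i \<Rightarrow> 'u" where "p = e \<circ> to_nat"
  define q :: "'k \<Rightarrow> 'u" where "q = e \<circ> to_nat"
  have p: "inj p" and q: "inj q"
    unfolding p_def q_def by (auto intro: inj_compose e)
  have pi [simp]: "inv p (p i) = i" and qi [simp]: "inv q (q k) = k" for i k
    using p q by (auto simp: inv_f_f)
  have p_eq [simp]: "p i = p j \<longleftrightarrow> i = j" and q_eq [simp]: "q k = q l \<longleftrightarrow> k = l" for i j k l
    using p q by (auto simp: inj_eq)
  define J' :: "('u, 'u) category" where
    "J' = \<lparr>Obj = p ` Obj J, Arr = q ` Arr J, Dom = \<lambda>u. p (Dom J (inv q u)),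
           Cod = \<lambda>u. p (Cod J (inv q u)), Ide = \<lambda>x. q (Ide J (inv p x)),
           Comp = \<lambda>u v. q (inv q u \<cdot>\<^bsub>J\<^esub> inv q v)\<rparr>"
  define D' :: "('u, 'u, 'o, 'm) func" where
    "D' = \<lparr>FOb = \<lambda>x. FOb D (inv p x), FArr = \<lambda>u. FArr D (inv q u)\<rparr>"
  interpret J: category J by (rule J)
  have "category J'"
    apply unfold_locales
           apply (simp_all add: J'_def hom_def)
    apply auto
    done
  moreover have "is_functor J' C D'"
    using D by (auto simp: is_functor_def J'_def D'_def hom_def)
  ultimately obtain c \<iota> where col: "is_colimit J' C D' c \<iota>"
    using bic unfolding bicomplete_def by blast
  have "is_colimit J C D c (\<lambda>j. \<iota> (p j))"
    unfolding is_colimit_def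
  proof (intro conjI ballI allI impI)
    show "c \<in> Obj C"
      using col by (simp add: is_colimit_def)
    show "\<iota> (p j) \<in> hom C (FOb D j) c" if "j \<in> Obj J" for j
      using col that by (auto simp: is_colimit_def J'_def D'_def)
    show "\<iota> (p (Cod J u)) \<cdot>\<^bsub>C\<^esub> FArr D u = \<iota> (p (Dom J u))" if "u \<in> Arr J" for u
      using col that by (auto simp: is_colimit_def J'_def D'_def)
    fix X h
    assume X: "X \<in> Obj C" and h: "(\<forall>j\<in>Obj J. h j \<in> hom C (FOb D j) X) \<and>
      (\<forall>u\<in>Arr J. h (Cod J u) \<cdot>\<^bsub>C\<^esub> FArr D u = h (Dom J u))"
    have "\<exists>!k. k \<in> hom C c X \<and> (\<forall>j\<in>Obj J'. k \<cdot>\<^bsub>C\<^esub> \<iota> j = h (inv p j))"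
      by (rule colimit_universal[OF col X]) (use h in \<open>simp_all add: J'_def D'_def\<close>)
    then show "\<exists>!k. k \<in> hom C c X \<and> (\<forall>j\<in>Obj J. k \<cdot>\<^bsub>C\<^esub> \<iota> (p j) = h j)"
      by (simp add: J'_def)
  qed
  then show ?thesis by blast
qed

context category
begin

lemma countable_coproduct:
  fixes I :: "'i::countable set"
  assumes inf: "infinite (UNIV :: 'u set)" and bic: "bicomplete TYPE('u) C"
    and D: "\<And>i. i \<in> I \<Longrightarrow> D i \<in> Obj C"
  shows "\<exists>c \<iota>. is_coproduct C I D c \<iota>"
proof -
  define J :: "('i, 'i) category" where
    "J = \<lparr>Obj = I, Arr = I, Dom = \<lambda>i. i, Cod = \<lambda>i. i, Ide = \<lambda>i. i, Comp = \<lambda>i j. i\<rparr>"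
  define F where "F = \<lparr>FOb = D, FArr = \<lambda>i. Ide C (D i)\<rparr>"
  have "category J"
    by unfold_locales (auto simp: J_def hom_def)
  moreover have "is_functor J C F"
    using D by (auto simp: J_def F_def is_functor_def hom_def)
  ultimately obtain c \<iota> where col: "is_colimit J C F c \<iota>"
    using countable_colimit[OF inf bic] by blast
  have "h i \<cdot> Ide C (D i) = h i" if "h i \<in> hom C (D i) X" for h i X
    using that Comp_Ide by blast
  then have cone: "(\<forall>i\<in>I. h i \<in> hom C (D i) X) \<longleftrightarrow>
      (\<forall>i\<in>I. h i \<in> hom C (D i) X) \<and> (\<forall>i\<in>I. h i \<cdot> Ide C (D i) = h i)" for h X
    by blast
  have "is_coproduct C I D c \<iota>"
    using col unfolding is_coproduct_def is_colimit_def by (subst cone) (simp add: J_def F_def)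
  then show ?thesis by blast
qed

lemma coequalizer_exists:
  assumes inf: "infinite (UNIV :: 'u set)" and bic: "bicomplete TYPE('u) C"
    and d: "d \<in> Arr C" "d' \<in> hom C (Dom C d) (Cod C d)"
  shows "\<exists>q. is_coequalizer C d d' q"
proof -
  \<comment> \<open>The walking parallel pair, with \<open>Inl b\<close> the identity of the object \<open>b\<close>.\<close>
  define J :: "(bool, bool + bool) category" where
    "J = \<lparr>Obj = UNIV, Arr = UNIV, Dom = case_sum id (\<lambda>_. False), Cod = case_sum id (\<lambda>_. True),
          Ide = Inl, Comp = \<lambda>g f. case f of Inl _ \<Rightarrow> g | Inr _ \<Rightarrow> f\<rparr>"
  define ob where "ob b = (if b then Cod C d else Dom C d)" for b
  define F :: "(bool, bool + bool, 'o, 'm) func" where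
    "F = \<lparr>FOb = ob, FArr = case_sum (\<lambda>b. Ide C (ob b)) (\<lambda>b. if b then d' else d)\<rparr>"
  have d': "d' \<in> Arr C" "Dom C d' = Dom C d" "Cod C d' = Cod C d"
    using d by (auto simp: hom_def)
  have "category J"
    by unfold_locales (auto simp: J_def hom_def split: sum.splits)
  moreover have "is_functor J C F"
    using d d' by (auto simp: J_def F_def is_functor_def hom_def ob_def split: sum.splits if_splits)
  ultimately obtain c \<iota> where col: "is_colimit J C F c \<iota>"
    using countable_colimit[OF inf bic] by blast
  have \<iota>: "\<iota> True \<in> hom C (Cod C d) c" "\<iota> True \<cdot> d = \<iota> False" "\<iota> True \<cdot> d' = \<iota> False"
    using col unfolding is_colimit_def J_def F_def ob_def
    by (simp_all add: all_bool_eq split_sum_all)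
  have "is_coequalizer C d d' (\<iota> True)"
    unfolding is_coequalizer_def
  proof (intro conjI ballI impI)
    fix h assume "h \<in> Arr C" and h: "Dom C h = Cod C d \<and> h \<cdot> d = h \<cdot> d'"
    define H where "H b = (if b then h else h \<cdot> d)" for b
    have "(\<forall>j\<in>Obj J. H j \<in> hom C (FOb F j) (Cod C h)) \<and>
        (\<forall>u\<in>Arr J. H (Cod J u) \<cdot> FArr F u = H (Dom J u))"
      using \<open>h \<in> Arr C\<close> h d d' by (auto simp: J_def F_def ob_def H_def hom_def split: sum.splits)
    then have univ: "\<exists>!k. k \<in> hom C c (Cod C h) \<and> (\<forall>j\<in>Obj J. k \<cdot> \<iota> j = H j)"
      using \<open>h \<in> Arr C\<close> by (intro colimit_universal[OF col]) simp_all
    have "(\<forall>j\<in>Obj J. k \<cdot> \<iota> j = H j) \<longleftrightarrow> k \<cdot> \<iota> True = h" if "k \<in> hom C c (Cod C h)" for k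
    proof -
      have "k \<cdot> \<iota> False = (k \<cdot> \<iota> True) \<cdot> d"
        using that \<iota> d by (auto simp: hom_def simp flip: \<iota>(2))
      then show ?thesis by (auto simp: J_def H_def all_bool_eq)
    qed
    then have "k \<in> hom C c (Cod C h) \<and> (\<forall>j\<in>Obj J. k \<cdot> \<iota> j = H j) \<longleftrightarrow>
        k \<in> hom C c (Cod C h) \<and> k \<cdot> \<iota> True = h" for k
      by blast
    moreover have "Cod C (\<iota> True) = c"
      using \<iota>(1) by (simp add: hom_def)
    ultimately show "\<exists>!k. k \<in> hom C (Cod C (\<iota> True)) (Cod C h) \<and> k \<cdot> \<iota> True = h"
      using univ by simp
  qed (use \<iota> d in \<open>auto simp: hom_def\<close>)
  then show ?thesis by blast
qed

text \<open>A pushout is a coequalizer of two arrows into the coproduct of the two targets.\<close>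
lemma pushout_exists:
  assumes inf: "infinite (UNIV :: 'u set)" and bic: "bicomplete TYPE('u) C"
    and f: "f \<in> Arr C" and g: "g \<in> Arr C" and fg: "Dom C f = Dom C g"
  shows "\<exists>g' f'. is_pushout C f g g' f'"
proof -
  define D where "D b = (if b then Cod C f else Cod C g)" for b
  obtain c \<iota> where cop: "is_coproduct C UNIV D c \<iota>"
    using countable_coproduct[OF inf bic, of UNIV D] f g unfolding D_def
    by (metis Cod_closed)
  have \<iota>: "\<iota> True \<in> Arr C" "Dom C (\<iota> True) = Cod C f" "Cod C (\<iota> True) = c"
      "\<iota> False \<in> Arr C" "Dom C (\<iota> False) = Cod C g" "Cod C (\<iota> False) = c"
    using cop by (auto simp: is_coproduct_def hom_def D_def all_bool_eq)
  note [simp] = \<iota> f g fg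
  obtain q where coeq: "is_coequalizer C (\<iota> True \<cdot> f) (\<iota> False \<cdot> g) q"
    using coequalizer_exists[OF inf bic, of "\<iota> True \<cdot> f" "\<iota> False \<cdot> g"] by (auto simp: hom_def)
  have q [simp]: "q \<in> Arr C" "Dom C q = c" and q_eq: "q \<cdot> (\<iota> True \<cdot> f) = q \<cdot> (\<iota> False \<cdot> g)"
    using coeq by (auto simp: is_coequalizer_def)
  have "is_pushout C f g (q \<cdot> \<iota> True) (q \<cdot> \<iota> False)"
    unfolding is_pushout_def
  proof (intro conjI ballI impI)
    fix X h k assume X: "X \<in> Obj C" and h: "h \<in> hom C (Cod C f) X" and k: "k \<in> hom C (Cod C g) X"
      and eq: "h \<cdot> f = k \<cdot> g"
    have "\<exists>!m. m \<in> hom C c X \<and> (\<forall>b\<in>UNIV. m \<cdot> \<iota> b = (if b then h else k))"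
      by (rule coproduct_universal[OF cop X]) (use h k in \<open>simp add: D_def\<close>)
    then have "\<exists>!m. m \<in> hom C c X \<and> m \<cdot> \<iota> True = h \<and> m \<cdot> \<iota> False = k"
      by (simp add: all_bool_eq conj_commute)
    then obtain m where m: "m \<in> hom C c X" "m \<cdot> \<iota> True = h" "m \<cdot> \<iota> False = k"
      and m_unique: "\<And>m'. \<lbrakk>m' \<in> hom C c X; m' \<cdot> \<iota> True = h; m' \<cdot> \<iota> False = k\<rbrakk> \<Longrightarrow> m' = m"
      by blast
    have [simp]: "m \<in> Arr C" "Dom C m = c" and [simp]: "Cod C m = X"
      using m by (auto simp: hom_def)
    have "m \<cdot> (\<iota> True \<cdot> f) = (m \<cdot> \<iota> True) \<cdot> f" "m \<cdot> (\<iota> False \<cdot> g) = (m \<cdot> \<iota> False) \<cdot> g"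
      by simp_all
    then have m_eq: "m \<cdot> (\<iota> True \<cdot> f) = m \<cdot> (\<iota> False \<cdot> g)"
      using m eq by simp
    have univ: "\<forall>h\<in>Arr C. Dom C h = c \<and> h \<cdot> (\<iota> True \<cdot> f) = h \<cdot> (\<iota> False \<cdot> g) \<longrightarrow>
        (\<exists>!k. k \<in> hom C (Cod C q) (Cod C h) \<and> k \<cdot> q = h)"
      using coeq by (simp add: is_coequalizer_def)
    have "\<exists>!l. l \<in> hom C (Cod C q) X \<and> l \<cdot> q = m"
      using bspec[OF univ \<open>m \<in> Arr C\<close>] m_eq by simp
    then obtain l where l: "l \<in> hom C (Cod C q) X" "l \<cdot> q = m"
      and l_unique: "\<And>l'. \<lbrakk>l' \<in> hom C (Cod C q) X; l' \<cdot> q = m\<rbrakk> \<Longrightarrow> l' = l"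
      by blast
    have reassoc: "l' \<cdot> (q \<cdot> \<iota> b) = (l' \<cdot> q) \<cdot> \<iota> b" if "l' \<in> hom C (Cod C q) X" for l' b
      using that by (cases b) (auto simp: hom_def)
    show "\<exists>!l. l \<in> hom C (Cod C (q \<cdot> \<iota> True)) X \<and> l \<cdot> (q \<cdot> \<iota> True) = h \<and> l \<cdot> (q \<cdot> \<iota> False) = k"
    proof (rule ex1I[of _ l])
      show "l \<in> hom C (Cod C (q \<cdot> \<iota> True)) X \<and> l \<cdot> (q \<cdot> \<iota> True) = h \<and> l \<cdot> (q \<cdot> \<iota> False) = k"
        using l m reassoc[OF l(1)] by simp
      fix l' assume l': "l' \<in> hom C (Cod C (q \<cdot> \<iota> True)) X \<and> l' \<cdot> (q \<cdot> \<iota> True) = h \<and> l' \<cdot> (q \<cdot> \<iota> False) = k"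
      then have hom': "l' \<in> hom C (Cod C q) X"
        by simp
      have "l' \<cdot> q = m"
        using l' hom' reassoc[OF hom'] by (intro m_unique) (simp_all add: hom_def)
      then show "l' = l"
        using hom' l_unique by blast
    qed
  qed (simp_all add: hom_def q_eq)
  then show ?thesis by blast
qed

lemma coprod_is_coproduct:
  assumes "\<exists>c \<iota>. is_coproduct C I D c \<iota>"
  shows "is_coproduct C I D (fst (coprod C I D)) (snd (coprod C I D))"
  unfolding coprod_def by (rule someI_ex) (use assms in auto)

lemma copair:
  assumes "\<exists>c \<iota>. is_coproduct C I D c \<iota>" "X \<in> Obj C" "\<And>i. i \<in> I \<Longrightarrow> h i \<in> hom C (D i) X"
  shows "copair C I D X h \<in> hom C (fst (coprod C I D)) X"
    and "i \<in> I \<Longrightarrow> copair C I D X h \<cdot> snd (coprod C I D) i = h i"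
proof -
  have "\<exists>!k. k \<in> hom C (fst (coprod C I D)) X \<and> (\<forall>i\<in>I. k \<cdot> snd (coprod C I D) i = h i)"
    using coproduct_universal[OF coprod_is_coproduct[OF assms(1)] assms(2)] assms(3) by blast
  from theI'[OF this, folded copair_def]
  show "copair C I D X h \<in> hom C (fst (coprod C I D)) X"
    "i \<in> I \<Longrightarrow> copair C I D X h \<cdot> snd (coprod C I D) i = h i"
    by auto
qed

lemma coprod_ext:
  assumes "\<exists>c \<iota>. is_coproduct C I D c \<iota>"
    and "a \<in> hom C (fst (coprod C I D)) X" "b \<in> hom C (fst (coprod C I D)) X"
    and eq: "\<And>i. i \<in> I \<Longrightarrow> a \<cdot> snd (coprod C I D) i = b \<cdot> snd (coprod C I D) i"
  shows "a = b"
proof -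
  have "X \<in> Obj C"
    using Obj_of_hom assms(2) by blast
  have "\<forall>i\<in>I. snd (coprod C I D) i \<in> hom C (D i) (fst (coprod C I D))"
    using coprod_is_coproduct[OF assms(1)] by (simp add: is_coproduct_def)
  then have "\<forall>i\<in>I. b \<cdot> snd (coprod C I D) i \<in> hom C (D i) X"
    using assms(3) Comp_hom by blast
  then have "\<exists>!k. k \<in> hom C (fst (coprod C I D)) X \<and>
      (\<forall>i\<in>I. k \<cdot> snd (coprod C I D) i = b \<cdot> snd (coprod C I D) i)"
    by (rule coproduct_universal[OF coprod_is_coproduct[OF assms(1)] \<open>X \<in> Obj C\<close>])
  then show ?thesis
    using assms(2,3) eq by blast
qed

end

section \<open>Tensor words and the insertion of operations\<close>

context monoidal_category
begin

lemma LUnit_nat: "f \<in> Arr C \<Longrightarrow> LUnit C (Cod C f) \<cdot> (Ide C (Unit C) \<boxtimes> f) = f \<cdot> LUnit C (Dom C f)"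
  using LUnit_natural hom_Dom_Cod by blast

lemma LUnit_inverse_nat:
  assumes [simp]: "f \<in> Arr C"
  shows "cinv (LUnit C (Cod C f)) \<cdot> f = (Ide C (Unit C) \<boxtimes> f) \<cdot> cinv (LUnit C (Dom C f))"
proof (rule iso_cancel_right[OF LUnit_iso[of "Dom C f"]])
  show "(cinv (LUnit C (Cod C f)) \<cdot> f) \<cdot> LUnit C (Dom C f)
      = ((Ide C (Unit C) \<boxtimes> f) \<cdot> cinv (LUnit C (Dom C f))) \<cdot> LUnit C (Dom C f)"
    by (simp add: LUnit_nat[symmetric])
qed simp_all

lemma LUnit_tensor_inverse:
  assumes [simp]: "X \<in> Obj C" "Y \<in> Obj C"
  shows "Assoc C (Unit C) X Y \<cdot> (cinv (LUnit C X) \<boxtimes> Ide C Y) = cinv (LUnit C (X \<otimes> Y))"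
proof (rule iso_cancel_left[OF LUnit_iso[of "X \<otimes> Y"]])
  show "LUnit C (X \<otimes> Y) \<cdot> (Assoc C (Unit C) X Y \<cdot> (cinv (LUnit C X) \<boxtimes> Ide C Y))
      = LUnit C (X \<otimes> Y) \<cdot> cinv (LUnit C (X \<otimes> Y))"
    by (simp add: Comp_eq_extend[OF LUnit_tensor] interchange)
qed simp_all

lemma triangle_inverse:
  assumes [simp]: "X \<in> Obj C" "Y \<in> Obj C"
  shows "cinv (Assoc C X (Unit C) Y) \<cdot> (Ide C X \<boxtimes> cinv (LUnit C Y))
         = cinv (RUnit C X) \<boxtimes> Ide C Y"
proof (rule iso_cancel_left[OF TenA_iso[OF RUnit_iso[of X] Ide_iso[of Y]]])
  have "(RUnit C X \<boxtimes> Ide C Y) \<cdot> (cinv (Assoc C X (Unit C) Y) \<cdot> (Ide C X \<boxtimes> cinv (LUnit C Y)))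
      = Ide C (X \<otimes> Y)"
    by (simp add: interchange flip: triangle)
  then show "(RUnit C X \<boxtimes> Ide C Y) \<cdot> (cinv (Assoc C X (Unit C) Y) \<cdot> (Ide C X \<boxtimes> cinv (LUnit C Y)))
      = (RUnit C X \<boxtimes> Ide C Y) \<cdot> (cinv (RUnit C X) \<boxtimes> Ide C Y)"
    by (simp add: interchange)
qed simp_all

lemma tens_Obj [simp]: "set Xs \<subseteq> Obj C \<Longrightarrow> tens C Xs \<in> Obj C"
  by (induction Xs) auto

lemma tensA_arr [simp]:
  assumes "set fs \<subseteq> Arr C"
  shows "tensA C fs \<in> Arr C" "Dom C (tensA C fs) = tens C (doms fs)"
    "Cod C (tensA C fs) = tens C (cods fs)"
  using assms by (induction fs) auto

lemma tensA_Ide [simp]: "set Xs \<subseteq> Obj C \<Longrightarrow> tensA C (ids Xs) = Ide C (tens C Xs)"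
  by (induction Xs) auto

lemma tensA_Comp:
  "composable gs fs
   \<Longrightarrow> tensA C gs \<cdot> tensA C fs = tensA C (map2 (\<cdot>) gs fs)"
proof (induction rule: list_all2_induct)
  case (Cons g gs f fs)
  have "set gs \<subseteq> Arr C" "set fs \<subseteq> Arr C" "doms gs = cods fs"
    using Cons(2) by (induction rule: list_all2_induct) auto
  with Cons show ?case by (simp add: interchange)
qed simp

lemma map_Dom_Ide [simp]: "set Xs \<subseteq> Obj C \<Longrightarrow> doms (ids Xs) = Xs"
  by (induction Xs) auto

lemma map_Dom_comp_Ide [simp]: "set Xs \<subseteq> Obj C \<Longrightarrow> map (Dom C \<circ> Ide C) Xs = Xs"
  and map_Cod_comp_Ide [simp]: "set Xs \<subseteq> Obj C \<Longrightarrow> map (Cod C \<circ> Ide C) Xs = Xs"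
  by (induction Xs) auto

lemma image_Obj [simp]:
  "set fs \<subseteq> Arr C \<Longrightarrow> Dom C ` set fs \<subseteq> Obj C" "set fs \<subseteq> Arr C \<Longrightarrow> Cod C ` set fs \<subseteq> Obj C"
  using Dom_closed Cod_closed by auto

lemma Ide_image_Arr [simp]: "set Xs \<subseteq> Obj C \<Longrightarrow> Ide C ` set Xs \<subseteq> Arr C"
  by auto

lemma tens_append_arr [simp]:
  assumes "set Ws \<subseteq> Obj C" "set Zs \<subseteq> Obj C"
  shows "tens_append C Ws Zs \<in> Arr C" "Dom C (tens_append C Ws Zs) = tens C Ws \<otimes> tens C Zs"
    "Cod C (tens_append C Ws Zs) = tens C (Ws @ Zs)"
  using assms by (induction Ws) auto

text \<open>The iterated associators are natural; with \<open>pull_front_nat\<close> this gives naturality of grafting.\<close>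
lemma tens_append_nat:
  assumes "set ws \<subseteq> Arr C" "set zs \<subseteq> Arr C"
  shows "tens_append C (cods ws) (cods zs) \<cdot> (tensA C ws \<boxtimes> tensA C zs)
         = tensA C (ws @ zs) \<cdot> tens_append C (doms ws) (doms zs)"
  using assms(1)
proof (induction ws)
  case Nil
  then show ?case
    using LUnit_nat[of "tensA C zs"] assms(2) by simp
next
  case (Cons w ws)
  have [simp]: "w \<in> Arr C" "set ws \<subseteq> Arr C" "set zs \<subseteq> Arr C"
    using assms(2) Cons.prems by auto
  let ?c = "tens_append C (cods ws) (cods zs)"
  let ?d = "tens_append C (doms ws) (doms zs)"
  have "tens_append C (cods (w # ws)) (cods zs) \<cdot> (tensA C (w # ws) \<boxtimes> tensA C zs)
      = (Ide C (Cod C w) \<boxtimes> ?c) \<cdot> ((w \<boxtimes> (tensA C ws \<boxtimes> tensA C zs))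
          \<cdot> Assoc C (Dom C w) (tens C (doms ws)) (tens C (doms zs)))"
    using Assoc_nat[of w "tensA C ws" "tensA C zs"] by simp
  also have "\<dots> = (w \<boxtimes> (?c \<cdot> (tensA C ws \<boxtimes> tensA C zs)))
          \<cdot> Assoc C (Dom C w) (tens C (doms ws)) (tens C (doms zs))"
    by (simp add: interchange_extend)
  also have "\<dots> = (w \<boxtimes> (tensA C (ws @ zs) \<cdot> ?d))
          \<cdot> Assoc C (Dom C w) (tens C (doms ws)) (tens C (doms zs))"
    using Cons by simp
  also have "\<dots> = tensA C ((w # ws) @ zs) \<cdot> tens_append C (doms (w # ws)) (doms zs)"
    by (simp add: interchange_extend)
  finally show ?case .
qed

lemma tens_append_Nil:
  "set Ws \<subseteq> Obj C \<Longrightarrow> tens_append C Ws [] = RUnit C (tens C Ws)"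
  by (induction Ws) (simp_all add: LUnit_Unit RUnit_tensor)

end

locale operad_central = monoidal_category C + operad: operad V P
  for C :: "('oc, 'mc) monoidal" (structure) and V :: "('ov, 'mv) braided"
    and z :: "('ov, 'mv, 'oc, 'mc) central" and P :: "('ov, 'mv) operad" +
  assumes central: "central_functor V C z"
begin

abbreviation "otens \<equiv> optens C z P"
abbreviation "otensA \<equiv> optensA C z P"
abbreviation "ograft \<equiv> graft C z P"
abbreviation "ounit \<equiv> opunit C z P"

lemma z_Obj [simp]: "X \<in> Obj V \<Longrightarrow> FOb z X \<in> Obj C"
  using central by (auto simp: central_functor_def strong_monoidal_def is_functor_def)

lemma z_Arr [simp]:
  "f \<in> Arr V \<Longrightarrow> FArr z f \<in> Arr C" "f \<in> Arr V \<Longrightarrow> Dom C (FArr z f) = FOb z (Dom V f)"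
  "f \<in> Arr V \<Longrightarrow> Cod C (FArr z f) = FOb z (Cod V f)"
  using central by (auto simp: central_functor_def strong_monoidal_def is_functor_def hom_def)

lemma z_Ide: "X \<in> Obj V \<Longrightarrow> FArr z (Ide V X) = Ide C (FOb z X)"
  using central by (auto simp: central_functor_def strong_monoidal_def is_functor_def)

lemma z_Comp:
  "\<lbrakk>f \<in> Arr V; g \<in> Arr V; Cod V f = Dom V g\<rbrakk> \<Longrightarrow> FArr z (g \<cdot>\<^bsub>V\<^esub> f) = FArr z g \<cdot> FArr z f"
  using central by (auto simp: central_functor_def strong_monoidal_def is_functor_def)

lemma Mu_arr [simp]:
  assumes "X \<in> Obj V" "Y \<in> Obj V"
  shows "Mu z X Y \<in> Arr C" "Dom C (Mu z X Y) = FOb z X \<otimes> FOb z Y"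
    "Cod C (Mu z X Y) = FOb z (X \<otimes>\<^bsub>V\<^esub> Y)"
  using central assms by (auto simp: central_functor_def strong_monoidal_def iso_def hom_def)

lemma Mu_nat:
  "\<lbrakk>f \<in> Arr V; g \<in> Arr V\<rbrakk> \<Longrightarrow> FArr z (f \<boxtimes>\<^bsub>V\<^esub> g) \<cdot> Mu z (Dom V f) (Dom V g)
     = Mu z (Cod V f) (Cod V g) \<cdot> (FArr z f \<boxtimes> FArr z g)"
  using central by (auto simp: central_functor_def strong_monoidal_def)

lemma Eps_arr [simp]: "Eps z \<in> Arr C" "Dom C (Eps z) = Unit C" "Cod C (Eps z) = FOb z (Unit V)"
  using central by (auto simp: central_functor_def strong_monoidal_def iso_def hom_def)

lemma Mu_units:
  assumes "X \<in> Obj V"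
  shows "FArr z (LUnit V X) \<cdot> (Mu z (Unit V) X \<cdot> (Eps z \<boxtimes> Ide C (FOb z X))) = LUnit C (FOb z X)"
    and "FArr z (RUnit V X) \<cdot> (Mu z X (Unit V) \<cdot> (Ide C (FOb z X) \<boxtimes> Eps z)) = RUnit C (FOb z X)"
  using central assms unfolding central_functor_def strong_monoidal_def by simp_all

lemma Zeta_iso:
  assumes "X \<in> Obj V" "Y \<in> Obj C"
  shows "Zeta z X Y \<in> iso C (FOb z X \<otimes> Y) (Y \<otimes> FOb z X)"
proof -
  have "center_obj C z X \<in> Obj (center C)"
    using central assms(1)
    by (simp add: central_functor_def strong_braided_monoidal_def strong_monoidal_def is_functor_def)
  then have "half_braiding C (FOb z X) (\<lambda>Y\<in>Obj C. Zeta z X Y)"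
    by (simp add: center_def Let_def center_obj_def)
  then show ?thesis
    using assms(2) by (simp add: half_braiding_def)
qed

lemma Zeta_nat:
  assumes "X \<in> Obj V" and [simp]: "f \<in> Arr C"
  shows "Zeta z X (Cod C f) \<cdot> (Ide C (FOb z X) \<boxtimes> f) = (f \<boxtimes> Ide C (FOb z X)) \<cdot> Zeta z X (Dom C f)"
proof -
  have "center_obj C z X \<in> Obj (center C)"
    using central assms(1)
    by (simp add: central_functor_def strong_braided_monoidal_def strong_monoidal_def is_functor_def)
  then have "half_braiding C (FOb z X) (\<lambda>Y\<in>Obj C. Zeta z X Y)"
    by (simp add: center_def Let_def center_obj_def)
  then have "\<forall>f\<in>Arr C. (\<lambda>Y\<in>Obj C. Zeta z X Y) (Cod C f) \<cdot> (Ide C (FOb z X) \<boxtimes> f)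
      = (f \<boxtimes> Ide C (FOb z X)) \<cdot> (\<lambda>Y\<in>Obj C. Zeta z X Y) (Dom C f)"
    unfolding half_braiding_def by blast
  from bspec[OF this assms(2)] show ?thesis
    by simp
qed

lemma Zeta_central:
  assumes "f \<in> Arr V" and [simp]: "Y \<in> Obj C"
  shows "(Ide C Y \<boxtimes> FArr z f) \<cdot> Zeta z (Dom V f) Y = Zeta z (Cod V f) Y \<cdot> (FArr z f \<boxtimes> Ide C Y)"
proof -
  have "(center_obj C z (Dom V f), FArr z f, center_obj C z (Cod V f)) \<in> Arr (center C)"
    using central assms(1)
    by (simp add: central_functor_def strong_braided_monoidal_def strong_monoidal_def is_functor_def
        hom_def)
  then show ?thesis
    by (auto simp: center_def Let_def center_obj_def dest: bspec[OF _ assms(2)])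
qed

text \<open>The half-braiding of the unit object of the center is built from the unitors; \<open>Eps z\<close> is an arrow
  of the center out of it.\<close>
lemma Zeta_Eps:
  assumes [simp]: "Y \<in> Obj C"
  shows "(Ide C Y \<boxtimes> Eps z) \<cdot> (cinv (RUnit C Y) \<cdot> LUnit C Y)
    = Zeta z (Unit V) Y \<cdot> (Eps z \<boxtimes> Ide C Y)"
proof -
  have "(center_unit C, Eps z, center_obj C z (Unit V)) \<in> Arr (center C)"
    using central
    by (simp add: central_functor_def strong_braided_monoidal_def strong_monoidal_def is_functor_def
        iso_def hom_def)
  then show ?thesis
    by (auto simp: center_def Let_def center_obj_def center_unit_def dest: bspec[OF _ assms])
qed

lemmas Zeta_simps [simp] = iso_simps[OF Zeta_iso]

lemma Zeta_inverse_nat: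
  assumes [simp]: "X \<in> Obj V" "f \<in> Arr C"
  shows "cinv (Zeta z X (Cod C f)) \<cdot> (f \<boxtimes> Ide C (FOb z X))
         = (Ide C (FOb z X) \<boxtimes> f) \<cdot> cinv (Zeta z X (Dom C f))"
proof (rule iso_cancel_right[OF Zeta_iso[of X "Dom C f"]])
  have "(cinv (Zeta z X (Cod C f)) \<cdot> (f \<boxtimes> Ide C (FOb z X))) \<cdot> Zeta z X (Dom C f)
      = cinv (Zeta z X (Cod C f)) \<cdot> (Zeta z X (Cod C f) \<cdot> (Ide C (FOb z X) \<boxtimes> f))"
    by (simp add: Zeta_nat)
  also have "\<dots> = Ide C (FOb z X) \<boxtimes> f"
    by (rule inverse_cancel(1)[OF Zeta_iso]) simp_all
  also have "\<dots> = ((Ide C (FOb z X) \<boxtimes> f) \<cdot> cinv (Zeta z X (Dom C f))) \<cdot> Zeta z X (Dom C f)"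
    by (simp add: inverse_arr[OF Zeta_iso])
  finally show "(cinv (Zeta z X (Cod C f)) \<cdot> (f \<boxtimes> Ide C (FOb z X))) \<cdot> Zeta z X (Dom C f)
     = ((Ide C (FOb z X) \<boxtimes> f) \<cdot> cinv (Zeta z X (Dom C f))) \<cdot> Zeta z X (Dom C f)" .
qed simp_all

lemma operad_arr [simp]:
  "OOb P n \<in> Obj V"
  "OUnit P \<in> Arr V" "Dom V (OUnit P) = Unit V" "Cod V (OUnit P) = OOb P (Suc 0)"
  "\<lbrakk>Suc 0 \<le> i; i \<le> p\<rbrakk> \<Longrightarrow> OComp P i p q \<in> Arr V"
  "\<lbrakk>Suc 0 \<le> i; i \<le> p\<rbrakk> \<Longrightarrow> Dom V (OComp P i p q) = OOb P p \<otimes>\<^bsub>V\<^esub> OOb P q"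
  "\<lbrakk>Suc 0 \<le> i; i \<le> p\<rbrakk> \<Longrightarrow> Cod V (OComp P i p q) = OOb P (p + q - Suc 0)"
  using operad.OOb_closed operad.OUnit_hom operad.OComp_hom[of i p q] by (auto simp: hom_def)

lemma optens_Obj [simp]: "set Ys \<subseteq> Obj C \<Longrightarrow> otens Ys \<in> Obj C"
  by (simp add: optens_def)

lemma optensA_arr [simp]:
  assumes "set fs \<subseteq> Arr C"
  shows "otensA fs \<in> Arr C" "Dom C (otensA fs) = otens (doms fs)"
    "Cod C (otensA fs) = otens (cods fs)"
  using assms by (simp_all add: optensA_def optens_def)

lemma optensA_Ide [simp]: "set Xs \<subseteq> Obj C \<Longrightarrow> otensA (ids Xs) = Ide C (otens Xs)"
  by (simp add: optensA_def optens_def)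

lemma optensA_Comp:
  assumes "composable gs fs"
  shows "otensA gs \<cdot> otensA fs = otensA (map2 (\<cdot>) gs fs)"
proof -
  have "set gs \<subseteq> Arr C" "set fs \<subseteq> Arr C" "doms gs = cods fs" "length gs = length fs"
    using assms by (induction rule: list_all2_induct) auto
  then show ?thesis
    using tensA_Comp[OF assms] by (simp add: optensA_def interchange)
qed

lemma pull_front_arr [simp]:
  assumes "X \<in> Obj V" "set Ys \<subseteq> Obj C" "set Ws \<subseteq> Obj C" "set Zs \<subseteq> Obj C"
  shows "pull_front C z X Ys Ws Zs \<in> Arr C"
    "Dom C (pull_front C z X Ys Ws Zs) = tens C (Ys @ [FOb z X \<otimes> tens C Ws] @ Zs)"
    "Cod C (pull_front C z X Ys Ws Zs) = FOb z X \<otimes> tens C (Ys @ Ws @ Zs)"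
  using assms by (induction Ys) (simp_all add: Let_def)

lemma pull_front_nat:
  assumes [simp]: "X \<in> Obj V" "set ws \<subseteq> Arr C" "set zs \<subseteq> Arr C"
  shows "set ys \<subseteq> Arr C \<Longrightarrow>
    pull_front C z X (cods ys) (cods ws) (cods zs)
      \<cdot> tensA C (ys @ [Ide C (FOb z X) \<boxtimes> tensA C ws] @ zs)
    = (Ide C (FOb z X) \<boxtimes> tensA C (ys @ ws @ zs))
      \<cdot> pull_front C z X (doms ys) (doms ws) (doms zs)"
proof (induction ys)
  case Nil
  have "pull_front C z X [] (cods ws) (cods zs)
      \<cdot> ((Ide C (FOb z X) \<boxtimes> tensA C ws) \<boxtimes> tensA C zs)
    = (Ide C (FOb z X) \<boxtimes> tens_append C (cods ws) (cods zs))
        \<cdot> ((Ide C (FOb z X) \<boxtimes> (tensA C ws \<boxtimes> tensA C zs))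
        \<cdot> Assoc C (FOb z X) (tens C (doms ws)) (tens C (doms zs)))"
    using Assoc_nat[of "Ide C (FOb z X)" "tensA C ws" "tensA C zs"] by simp
  also have "\<dots> = (Ide C (FOb z X) \<boxtimes> tensA C (ws @ zs)) \<cdot> pull_front C z X [] (doms ws) (doms zs)"
    using tens_append_nat[of ws zs] by (simp add: interchange_extend)
  finally show ?case by simp
next
  case (Cons y ys)
  have [simp]: "y \<in> Arr C" "set ys \<subseteq> Arr C"
    using Cons.prems by auto
  let ?F = "FOb z X"
  let ?T = "tensA C (ys @ ws @ zs)"
  let ?R = "tens C (doms ys @ doms ws @ doms zs)"
  let ?R' = "tens C (cods ys @ cods ws @ cods zs)"
  let ?pf = "pull_front C z X (doms ys) (doms ws) (doms zs)"
  let ?pf' = "pull_front C z X (cods ys) (cods ws) (cods zs)"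
  have IH: "?pf' \<cdot> tensA C (ys @ (Ide C ?F \<boxtimes> tensA C ws) # zs) = (Ide C ?F \<boxtimes> ?T) \<cdot> ?pf"
    using Cons by simp
  have "(Ide C (Cod C y) \<boxtimes> ?pf') \<cdot> (y \<boxtimes> tensA C (ys @ (Ide C ?F \<boxtimes> tensA C ws) # zs))
      = (y \<boxtimes> (Ide C ?F \<boxtimes> ?T)) \<cdot> (Ide C (Dom C y) \<boxtimes> ?pf)"
    by (simp add: interchange IH)
  then have "pull_front C z X (cods (y # ys)) (cods ws) (cods zs)
      \<cdot> (y \<boxtimes> tensA C (ys @ (Ide C ?F \<boxtimes> tensA C ws) # zs))
    = Assoc C ?F (Cod C y) ?R' \<cdot> ((cinv (Zeta z X (Cod C y)) \<boxtimes> Ide C ?R')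
        \<cdot> (cinv (Assoc C (Cod C y) ?F ?R') \<cdot> ((y \<boxtimes> (Ide C ?F \<boxtimes> ?T)) \<cdot> (Ide C (Dom C y) \<boxtimes> ?pf))))"
    by (simp add: Let_def)
  also have "cinv (Assoc C (Cod C y) ?F ?R') \<cdot> ((y \<boxtimes> (Ide C ?F \<boxtimes> ?T)) \<cdot> (Ide C (Dom C y) \<boxtimes> ?pf))
    = ((y \<boxtimes> Ide C ?F) \<boxtimes> ?T) \<cdot> (cinv (Assoc C (Dom C y) ?F ?R) \<cdot> (Ide C (Dom C y) \<boxtimes> ?pf))"
    using Comp_eq_extend[OF Assoc_inverse_nat[of y "Ide C ?F" ?T], of "Ide C (Dom C y) \<boxtimes> ?pf"] by simp
  also have "(cinv (Zeta z X (Cod C y)) \<boxtimes> Ide C ?R') \<cdot>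
        (((y \<boxtimes> Ide C ?F) \<boxtimes> ?T) \<cdot> (cinv (Assoc C (Dom C y) ?F ?R) \<cdot> (Ide C (Dom C y) \<boxtimes> ?pf)))
    = ((Ide C ?F \<boxtimes> y) \<boxtimes> ?T) \<cdot> ((cinv (Zeta z X (Dom C y)) \<boxtimes> Ide C ?R)
        \<cdot> (cinv (Assoc C (Dom C y) ?F ?R) \<cdot> (Ide C (Dom C y) \<boxtimes> ?pf)))"
    using Zeta_inverse_nat[of X y] by (simp add: interchange_extend)
  also have "Assoc C ?F (Cod C y) ?R' \<cdot> (((Ide C ?F \<boxtimes> y) \<boxtimes> ?T) \<cdot> ((cinv (Zeta z X (Dom C y)) \<boxtimes> Ide C ?R)
        \<cdot> (cinv (Assoc C (Dom C y) ?F ?R) \<cdot> (Ide C (Dom C y) \<boxtimes> ?pf))))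
    = (Ide C ?F \<boxtimes> (y \<boxtimes> ?T)) \<cdot> (Assoc C ?F (Dom C y) ?R \<cdot> ((cinv (Zeta z X (Dom C y)) \<boxtimes> Ide C ?R)
        \<cdot> (cinv (Assoc C (Dom C y) ?F ?R) \<cdot> (Ide C (Dom C y) \<boxtimes> ?pf))))"
    using Comp_eq_extend[OF Assoc_nat[of "Ide C ?F" y ?T], of "(cinv (Zeta z X (Dom C y)) \<boxtimes> Ide C ?R)
        \<cdot> (cinv (Assoc C (Dom C y) ?F ?R) \<cdot> (Ide C (Dom C y) \<boxtimes> ?pf))"] by simp
  finally show ?case
    by (simp add: Let_def)
qed

lemma graft_arr [simp]:
  assumes [simp]: "set Ys \<subseteq> Obj C" "set Ws \<subseteq> Obj C" "set Zs \<subseteq> Obj C"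
  shows "ograft Ys Ws Zs \<in> Arr C"
    "Dom C (ograft Ys Ws Zs) = otens (Ys @ [otens Ws] @ Zs)"
    "Cod C (ograft Ys Ws Zs) = otens (Ys @ Ws @ Zs)"
  by (simp_all add: graft_def Let_def optens_def add_ac)

lemma graft_nat:
  assumes [simp]: "set ys \<subseteq> Arr C" "set ws \<subseteq> Arr C" "set zs \<subseteq> Arr C"
  shows "ograft (cods ys) (cods ws) (cods zs)
      \<cdot> otensA (ys @ [otensA ws] @ zs)
    = otensA (ys @ ws @ zs) \<cdot> ograft (doms ys) (doms ws) (doms zs)"
proof -
  let ?p = "Suc (length ys + length zs)" and ?q = "length ws"
  let ?Vp = "OOb P ?p" and ?Vq = "OOb P ?q"
  let ?T = "tensA C (ys @ ws @ zs)"
  let ?R = "tens C (doms ys @ doms ws @ doms zs)"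
  let ?R' = "tens C (cods ys @ cods ws @ cods zs)"
  let ?pf = "pull_front C z ?Vq (doms ys) (doms ws) (doms zs)"
  let ?pf' = "pull_front C z ?Vq (cods ys) (cods ws) (cods zs)"
  let ?m = "FArr z (OComp P (Suc (length ys)) ?p ?q) \<cdot> Mu z ?Vp ?Vq"
  have pf: "?pf' \<cdot> tensA C (ys @ (Ide C (FOb z ?Vq) \<boxtimes> tensA C ws) # zs) = (Ide C (FOb z ?Vq) \<boxtimes> ?T) \<cdot> ?pf"
    using pull_front_nat[of ?Vq ws zs ys] by simp
  have "ograft (cods ys) (cods ws) (cods zs)
      \<cdot> otensA (ys @ [otensA ws] @ zs)
    = (?m \<boxtimes> Ide C ?R') \<cdot> (cinv (Assoc C (FOb z ?Vp) (FOb z ?Vq) ?R')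
      \<cdot> ((Ide C (FOb z ?Vp) \<boxtimes> ?pf')
      \<cdot> (Ide C (FOb z ?Vp) \<boxtimes> tensA C (ys @ (Ide C (FOb z ?Vq) \<boxtimes> tensA C ws) # zs))))"
    by (simp add: graft_def Let_def optensA_def)
  also have "(Ide C (FOb z ?Vp) \<boxtimes> ?pf')
      \<cdot> (Ide C (FOb z ?Vp) \<boxtimes> tensA C (ys @ (Ide C (FOb z ?Vq) \<boxtimes> tensA C ws) # zs))
    = (Ide C (FOb z ?Vp) \<boxtimes> (Ide C (FOb z ?Vq) \<boxtimes> ?T)) \<cdot> (Ide C (FOb z ?Vp) \<boxtimes> ?pf)"
    by (simp add: interchange pf)
  also have "cinv (Assoc C (FOb z ?Vp) (FOb z ?Vq) ?R')
      \<cdot> ((Ide C (FOb z ?Vp) \<boxtimes> (Ide C (FOb z ?Vq) \<boxtimes> ?T)) \<cdot> (Ide C (FOb z ?Vp) \<boxtimes> ?pf))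
    = ((Ide C (FOb z ?Vp) \<boxtimes> Ide C (FOb z ?Vq)) \<boxtimes> ?T)
      \<cdot> (cinv (Assoc C (FOb z ?Vp) (FOb z ?Vq) ?R) \<cdot> (Ide C (FOb z ?Vp) \<boxtimes> ?pf))"
    using Comp_eq_extend[OF Assoc_inverse_nat[of "Ide C (FOb z ?Vp)" "Ide C (FOb z ?Vq)" ?T],
        of "Ide C (FOb z ?Vp) \<boxtimes> ?pf"] by simp
  also have "(?m \<boxtimes> Ide C ?R') \<cdot> (((Ide C (FOb z ?Vp) \<boxtimes> Ide C (FOb z ?Vq)) \<boxtimes> ?T)
      \<cdot> (cinv (Assoc C (FOb z ?Vp) (FOb z ?Vq) ?R) \<cdot> (Ide C (FOb z ?Vp) \<boxtimes> ?pf)))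
    = (Ide C (FOb z (OOb P (?p + ?q - Suc 0))) \<boxtimes> ?T) \<cdot> ((?m \<boxtimes> Ide C ?R)
      \<cdot> (cinv (Assoc C (FOb z ?Vp) (FOb z ?Vq) ?R) \<cdot> (Ide C (FOb z ?Vp) \<boxtimes> ?pf)))"
    by (simp add: interchange_extend)
  finally show ?thesis
    by (simp add: graft_def Let_def optensA_def add_ac)
qed

definition op_unit :: 'mc where
  "op_unit = FArr z (OUnit P) \<cdot> Eps z"

lemma op_unit_arr [simp]:
  "op_unit \<in> Arr C" "Dom C op_unit = Unit C" "Cod C op_unit = FOb z (OOb P (Suc 0))"
  by (simp_all add: op_unit_def)

text \<open>The arrow \<open>op_unit\<close> underlies a composite of arrows of the center, so it can be moved past any
  object at the cost of unitors only.\<close>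
lemma Zeta_op_unit:
  assumes [simp]: "Y \<in> Obj C"
  shows "cinv (Zeta z (OOb P (Suc 0)) Y) \<cdot> (Ide C Y \<boxtimes> op_unit)
    = (op_unit \<boxtimes> Ide C Y) \<cdot> (cinv (LUnit C Y) \<cdot> RUnit C Y)"
proof (rule iso_cancel_left[OF Zeta_iso[of "OOb P (Suc 0)" Y]])
  have "Zeta z (OOb P (Suc 0)) Y \<cdot> ((op_unit \<boxtimes> Ide C Y) \<cdot> (cinv (LUnit C Y) \<cdot> RUnit C Y))
      = (Zeta z (OOb P (Suc 0)) Y \<cdot> (FArr z (OUnit P) \<boxtimes> Ide C Y))
          \<cdot> ((Eps z \<boxtimes> Ide C Y) \<cdot> (cinv (LUnit C Y) \<cdot> RUnit C Y))"
    by (simp add: op_unit_def interchange_extend)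
  also have "\<dots> = (Ide C Y \<boxtimes> FArr z (OUnit P)) \<cdot> ((Zeta z (Unit V) Y \<cdot> (Eps z \<boxtimes> Ide C Y))
          \<cdot> (cinv (LUnit C Y) \<cdot> RUnit C Y))"
    using Comp_eq_extend[OF Zeta_central[of "OUnit P" Y, symmetric],
        of "(Eps z \<boxtimes> Ide C Y) \<cdot> (cinv (LUnit C Y) \<cdot> RUnit C Y)"] by simp
  also have "\<dots> = Ide C Y \<boxtimes> op_unit"
    unfolding Zeta_Eps[OF assms, symmetric] by (simp add: op_unit_def interchange)
  finally show "Zeta z (OOb P (Suc 0)) Y \<cdot> (cinv (Zeta z (OOb P (Suc 0)) Y) \<cdot> (Ide C Y \<boxtimes> op_unit))
      = Zeta z (OOb P (Suc 0)) Y \<cdot> ((op_unit \<boxtimes> Ide C Y) \<cdot> (cinv (LUnit C Y) \<cdot> RUnit C Y))"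
    by (simp add: inverse_cancel(2)[OF Zeta_iso])
qed simp_all

lemma opunit_arr [simp]:
  assumes "X \<in> Obj C"
  shows "ounit X \<in> Arr C" "Dom C (ounit X) = X" "Cod C (ounit X) = otens [X]"
  using assms by (simp_all add: opunit_def optens_def)

lemma opunit_eq: "ounit X = (op_unit \<boxtimes> cinv (RUnit C X)) \<cdot> cinv (LUnit C X)"
  by (simp add: opunit_def op_unit_def)

text \<open>A unit that is created at some letter and pulled to the front is a unit created at the front. Each
  step past a letter \<open>Y\<close> is \<open>Zeta_op_unit\<close>, and the unitors cancel by the triangle and
  \<open>LUnit_tensor\<close>.\<close>
lemma pull_front_opunit:
  assumes [simp]: "X \<in> Obj C" "set Zs \<subseteq> Obj C"
  shows "set Ys \<subseteq> Obj C \<Longrightarrow>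
    pull_front C z (OOb P (Suc 0)) Ys [X] Zs
      \<cdot> tensA C (ids Ys @ [ounit X] @ ids Zs)
    = (op_unit \<boxtimes> Ide C (tens C (Ys @ [X] @ Zs))) \<cdot> cinv (LUnit C (tens C (Ys @ [X] @ Zs)))"
proof (induction Ys)
  case Nil
  let ?T = "tens C Zs" and ?F = "FOb z (OOb P (Suc 0))"
  have "pull_front C z (OOb P (Suc 0)) [] [X] Zs \<cdot> (ounit X \<boxtimes> Ide C ?T)
      = (Ide C ?F \<boxtimes> (RUnit C X \<boxtimes> Ide C ?T)) \<cdot> (Assoc C ?F (X \<otimes> Unit C) ?T
          \<cdot> (((op_unit \<boxtimes> cinv (RUnit C X)) \<boxtimes> Ide C ?T)
          \<cdot> (cinv (LUnit C X) \<boxtimes> Ide C ?T)))"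
    by (simp add: triangle opunit_eq interchange)
  also have "\<dots> = (Ide C ?F \<boxtimes> (RUnit C X \<boxtimes> Ide C ?T)) \<cdot> ((op_unit \<boxtimes> (cinv (RUnit C X) \<boxtimes> Ide C ?T))
          \<cdot> (Assoc C (Unit C) X ?T \<cdot> (cinv (LUnit C X) \<boxtimes> Ide C ?T)))"
    using Comp_eq_extend[OF Assoc_nat[of op_unit "cinv (RUnit C X)" "Ide C ?T"],
        of "cinv (LUnit C X) \<boxtimes> Ide C ?T"] by simp
  also have "\<dots> = (op_unit \<boxtimes> Ide C (X \<otimes> ?T)) \<cdot> cinv (LUnit C (X \<otimes> ?T))"
    by (simp add: interchange_extend interchange LUnit_tensor_inverse)
  finally show ?case by simp
next
  case (Cons Y Ys)
  let ?R = "tens C (Ys @ X # Zs)" and ?F = "FOb z (OOb P (Suc 0))"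
  have [simp]: "Y \<in> Obj C" "set Ys \<subseteq> Obj C"
    using Cons.prems by auto
  have IH: "pull_front C z (OOb P (Suc 0)) Ys [X] Zs
      \<cdot> tensA C (ids Ys @ ounit X # ids Zs)
    = (op_unit \<boxtimes> Ide C ?R) \<cdot> cinv (LUnit C ?R)"
    using Cons by simp
  have "pull_front C z (OOb P (Suc 0)) (Y # Ys) [X] Zs
      \<cdot> (Ide C Y \<boxtimes> tensA C (ids Ys @ ounit X # ids Zs))
    = Assoc C ?F Y ?R \<cdot> ((cinv (Zeta z (OOb P (Suc 0)) Y) \<boxtimes> Ide C ?R)
        \<cdot> (cinv (Assoc C Y ?F ?R) \<cdot> ((Ide C Y \<boxtimes> (op_unit \<boxtimes> Ide C ?R))
        \<cdot> (Ide C Y \<boxtimes> cinv (LUnit C ?R)))))"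
    by (simp add: Let_def interchange IH optens_def)
  also have "\<dots> = Assoc C ?F Y ?R \<cdot> ((cinv (Zeta z (OOb P (Suc 0)) Y) \<boxtimes> Ide C ?R)
        \<cdot> (((Ide C Y \<boxtimes> op_unit) \<boxtimes> Ide C ?R) \<cdot> (cinv (Assoc C Y (Unit C) ?R)
        \<cdot> (Ide C Y \<boxtimes> cinv (LUnit C ?R)))))"
    using Comp_eq_extend[OF Assoc_inverse_nat[of "Ide C Y" op_unit "Ide C ?R"],
        of "Ide C Y \<boxtimes> cinv (LUnit C ?R)"] by simp
  also have "\<dots> = Assoc C ?F Y ?R \<cdot> (((op_unit \<boxtimes> Ide C Y) \<boxtimes> Ide C ?R)
        \<cdot> (cinv (LUnit C Y) \<boxtimes> Ide C ?R))"
    using Comp_eq_extend[OF Zeta_op_unit[of Y], of "cinv (RUnit C Y)"]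
    by (simp add: triangle_inverse interchange)
  also have "\<dots> = (op_unit \<boxtimes> Ide C (Y \<otimes> ?R)) \<cdot> (Assoc C (Unit C) Y ?R \<cdot> (cinv (LUnit C Y) \<boxtimes> Ide C ?R))"
    using Comp_eq_extend[OF Assoc_nat[of op_unit "Ide C Y" "Ide C ?R"],
        of "cinv (LUnit C Y) \<boxtimes> Ide C ?R"] by simp
  also have "\<dots> = (op_unit \<boxtimes> Ide C (Y \<otimes> ?R)) \<cdot> cinv (LUnit C (Y \<otimes> ?R))"
    by (simp add: LUnit_tensor_inverse)
  finally show ?case by simp
qed

lemma OComp_right_unit:
  assumes "Suc 0 \<le> i" "i \<le> p"
  shows "FArr z (OComp P i p (Suc 0)) \<cdot> (Mu z (OOb P p) (OOb P (Suc 0))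
      \<cdot> (Ide C (FOb z (OOb P p)) \<boxtimes> op_unit)) = RUnit C (FOb z (OOb P p))"
proof -
  let ?F = "FOb z (OOb P p)"
  have eq: "OComp P i p (Suc 0) \<cdot>\<^bsub>V\<^esub> (Ide V (OOb P p) \<boxtimes>\<^bsub>V\<^esub> OUnit P) = RUnit V (OOb P p)"
    using operad.right_unit[of i p] assms by simp
  have "FArr z (OComp P i p (Suc 0)) \<cdot> (Mu z (OOb P p) (OOb P (Suc 0)) \<cdot> (Ide C ?F \<boxtimes> op_unit))
      = FArr z (OComp P i p (Suc 0)) \<cdot> ((Mu z (OOb P p) (OOb P (Suc 0))
          \<cdot> (Ide C ?F \<boxtimes> FArr z (OUnit P))) \<cdot> (Ide C ?F \<boxtimes> Eps z))"
    using assms by (simp add: op_unit_def interchange)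
  also have "Mu z (OOb P p) (OOb P (Suc 0)) \<cdot> (Ide C ?F \<boxtimes> FArr z (OUnit P))
      = FArr z (Ide V (OOb P p) \<boxtimes>\<^bsub>V\<^esub> OUnit P) \<cdot> Mu z (OOb P p) (Unit V)"
    using Mu_nat[of "Ide V (OOb P p)" "OUnit P"] by (simp add: z_Ide)
  also have "FArr z (OComp P i p (Suc 0)) \<cdot> ((FArr z (Ide V (OOb P p) \<boxtimes>\<^bsub>V\<^esub> OUnit P)
        \<cdot> Mu z (OOb P p) (Unit V)) \<cdot> (Ide C ?F \<boxtimes> Eps z))
      = FArr z (OComp P i p (Suc 0) \<cdot>\<^bsub>V\<^esub> (Ide V (OOb P p) \<boxtimes>\<^bsub>V\<^esub> OUnit P))
        \<cdot> (Mu z (OOb P p) (Unit V) \<cdot> (Ide C ?F \<boxtimes> Eps z))"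
    using assms by (subst z_Comp) simp_all
  also have "\<dots> = RUnit C ?F"
    by (simp only: eq Mu_units(2)[OF operad_arr(1)])
  finally show ?thesis .
qed

lemma OComp_left_unit:
  "FArr z (OComp P (Suc 0) (Suc 0) q) \<cdot> (Mu z (OOb P (Suc 0)) (OOb P q)
      \<cdot> (op_unit \<boxtimes> Ide C (FOb z (OOb P q)))) = LUnit C (FOb z (OOb P q))"
proof -
  let ?F = "FOb z (OOb P q)"
  have eq: "OComp P (Suc 0) (Suc 0) q \<cdot>\<^bsub>V\<^esub> (OUnit P \<boxtimes>\<^bsub>V\<^esub> Ide V (OOb P q)) = LUnit V (OOb P q)"
    using operad.left_unit[of q] by simp
  have "FArr z (OComp P (Suc 0) (Suc 0) q) \<cdot> (Mu z (OOb P (Suc 0)) (OOb P q) \<cdot> (op_unit \<boxtimes> Ide C ?F))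
      = FArr z (OComp P (Suc 0) (Suc 0) q) \<cdot> ((Mu z (OOb P (Suc 0)) (OOb P q)
          \<cdot> (FArr z (OUnit P) \<boxtimes> Ide C ?F)) \<cdot> (Eps z \<boxtimes> Ide C ?F))"
    by (simp add: op_unit_def interchange)
  also have "Mu z (OOb P (Suc 0)) (OOb P q) \<cdot> (FArr z (OUnit P) \<boxtimes> Ide C ?F)
      = FArr z (OUnit P \<boxtimes>\<^bsub>V\<^esub> Ide V (OOb P q)) \<cdot> Mu z (Unit V) (OOb P q)"
    using Mu_nat[of "OUnit P" "Ide V (OOb P q)"] by (simp add: z_Ide)
  also have "FArr z (OComp P (Suc 0) (Suc 0) q) \<cdot> ((FArr z (OUnit P \<boxtimes>\<^bsub>V\<^esub> Ide V (OOb P q))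
        \<cdot> Mu z (Unit V) (OOb P q)) \<cdot> (Eps z \<boxtimes> Ide C ?F))
      = FArr z (OComp P (Suc 0) (Suc 0) q \<cdot>\<^bsub>V\<^esub> (OUnit P \<boxtimes>\<^bsub>V\<^esub> Ide V (OOb P q)))
        \<cdot> (Mu z (Unit V) (OOb P q) \<cdot> (Eps z \<boxtimes> Ide C ?F))"
    by (subst z_Comp) simp_all
  also have "\<dots> = LUnit C ?F"
    by (simp only: eq Mu_units(1)[OF operad_arr(1)])
  finally show ?thesis .
qed

text \<open>The right unit law of the operad, transported to words: a unit operation grafted at one letter
  disappears.\<close>
lemma graft_right_unit:
  assumes [simp]: "set Ys \<subseteq> Obj C" "X \<in> Obj C" "set Zs \<subseteq> Obj C"
  shows "ograft Ys [X] Zs \<cdot> otensA (ids Ys @ [ounit X] @ ids Zs)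
    = Ide C (otens (Ys @ [X] @ Zs))"
proof -
  let ?p = "Suc (length Ys + length Zs)"
  let ?F = "FOb z (OOb P ?p)" and ?G = "FOb z (OOb P (Suc 0))" and ?R = "tens C (Ys @ X # Zs)"
  let ?m = "FArr z (OComp P (Suc (length Ys)) ?p (Suc 0)) \<cdot> Mu z (OOb P ?p) (OOb P (Suc 0))"
  have pf: "pull_front C z (OOb P (Suc 0)) Ys [X] Zs
      \<cdot> tensA C (ids Ys @ ounit X # ids Zs)
    = (op_unit \<boxtimes> Ide C ?R) \<cdot> cinv (LUnit C ?R)"
    using pull_front_opunit[of X Zs Ys] by simp
  have "ograft Ys [X] Zs \<cdot> otensA (ids Ys @ [ounit X] @ ids Zs)
      = (?m \<boxtimes> Ide C ?R) \<cdot> (cinv (Assoc C ?F ?G ?R) \<cdot> ((Ide C ?F \<boxtimes> (op_unit \<boxtimes> Ide C ?R))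
        \<cdot> (Ide C ?F \<boxtimes> cinv (LUnit C ?R))))"
    by (simp add: graft_def Let_def optensA_def optens_def interchange pf)
  also have "\<dots> = (?m \<boxtimes> Ide C ?R) \<cdot> (((Ide C ?F \<boxtimes> op_unit) \<boxtimes> Ide C ?R)
        \<cdot> (cinv (Assoc C ?F (Unit C) ?R) \<cdot> (Ide C ?F \<boxtimes> cinv (LUnit C ?R))))"
    using Comp_eq_extend[OF Assoc_inverse_nat[of "Ide C ?F" op_unit "Ide C ?R"],
        of "Ide C ?F \<boxtimes> cinv (LUnit C ?R)"] by simp
  also have "\<dots> = ((?m \<cdot> (Ide C ?F \<boxtimes> op_unit)) \<cdot> cinv (RUnit C ?F)) \<boxtimes> Ide C ?R"
    by (simp add: triangle_inverse interchange)
  also have "\<dots> = Ide C (otens (Ys @ [X] @ Zs))"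
    using OComp_right_unit[of "Suc (length Ys)" ?p] by (simp add: optens_def)
  finally show ?thesis .
qed

text \<open>The left unit law of the operad: grafting an operation into the unit operation gives it back.
  Pulling it to the front moves past the final unit object only, so this step is a right unitor.\<close>
lemma graft_left_unit:
  assumes [simp]: "set Ws \<subseteq> Obj C"
  shows "ograft [] Ws [] \<cdot> ounit (otens Ws) = Ide C (otens Ws)"
proof -
  let ?F = "FOb z (OOb P (Suc 0))" and ?G = "FOb z (OOb P (length Ws))" and ?R = "tens C Ws"
  let ?m = "FArr z (OComp P (Suc 0) (Suc 0) (length Ws)) \<cdot> Mu z (OOb P (Suc 0)) (OOb P (length Ws))"
  have pf: "pull_front C z (OOb P (length Ws)) [] Ws [] = RUnit C (?G \<otimes> ?R)"
    by (simp add: tens_append_Nil RUnit_tensor)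
  have "ograft [] Ws [] \<cdot> ounit (otens Ws)
      = (?m \<boxtimes> Ide C ?R) \<cdot> (cinv (Assoc C ?F ?G ?R) \<cdot> ((Ide C ?F \<boxtimes> RUnit C (?G \<otimes> ?R))
        \<cdot> ((op_unit \<boxtimes> cinv (RUnit C (?G \<otimes> ?R))) \<cdot> cinv (LUnit C (?G \<otimes> ?R)))))"
    by (simp add: graft_def Let_def opunit_eq pf optens_def del: pull_front.simps)
  also have "\<dots> = (?m \<boxtimes> Ide C ?R) \<cdot> (cinv (Assoc C ?F ?G ?R) \<cdot> ((op_unit \<boxtimes> (Ide C ?G \<boxtimes> Ide C ?R))
        \<cdot> (Assoc C (Unit C) ?G ?R \<cdot> (cinv (LUnit C ?G) \<boxtimes> Ide C ?R))))"
    by (simp add: interchange_extend LUnit_tensor_inverse)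
  also have "\<dots> = (?m \<boxtimes> Ide C ?R) \<cdot> (((op_unit \<boxtimes> Ide C ?G) \<boxtimes> Ide C ?R)
        \<cdot> (cinv (LUnit C ?G) \<boxtimes> Ide C ?R))"
    using Comp_eq_extend[OF Assoc_inverse_nat[of op_unit "Ide C ?G" "Ide C ?R"],
        of "Assoc C (Unit C) ?G ?R \<cdot> (cinv (LUnit C ?G) \<boxtimes> Ide C ?R)"] by simp
  also have "\<dots> = ((?m \<cdot> (op_unit \<boxtimes> Ide C ?G)) \<cdot> cinv (LUnit C ?G)) \<boxtimes> Ide C ?R"
    by (simp add: interchange)
  also have "\<dots> = Ide C (otens Ws)"
    using OComp_left_unit[of "length Ws"] by (simp add: optens_def)
  finally show ?thesis .
qed

end

section \<open>Words with distinguished letters\<close>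

abbreviation fits :: "'a option list \<Rightarrow> 'b list \<Rightarrow> bool" where
  "fits w Xs \<equiv> count_list w None = length Xs"

lemma patterns_iff: "w \<in> patterns n \<longleftrightarrow> count_list w None = n"
  by (simp add: patterns_def)

lemma count_list_map_option [simp]: "count_list (map (map_option f) w) None = count_list w None"
  by (induction w) auto

lemma count_list_replicate_Some [simp]: "count_list (replicate k (Some a)) None = 0"
  by (induction k) auto

lemma count_list_forget_arity [simp]: "count_list (forget_arity w) None = count_list w None"
  by (simp add: forget_arity_def)

lemma count_list_flatten [simp]: "count_list (flatten w) None = count_list w None"
  by (induction w) (auto simp: flatten_def split: option.splits)

lemma length_fill [simp]: "length (fill w Xs) = length w"
  by (induction w Xs rule: fill.induct) auto

lemma fill_append:
  "fits u Xs \<Longrightarrow> fill (u @ v) (Xs @ Zs) = fill u Xs @ fill v Zs"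
proof (induction u arbitrary: Xs)
  case (Cons a u)
  then show ?case by (cases a) (auto simp: length_Suc_conv eq_commute[of _ "length Xs"])
qed simp

lemma map_fill:
  "fits w Xs \<Longrightarrow> map f (fill w Xs) = fill (map (map_option f) w) (map f Xs)"
proof (induction w arbitrary: Xs)
  case (Cons a w)
  then show ?case by (cases a; cases Xs) auto
qed simp

lemma set_fill:
  "\<lbrakk>fits w Xs; set Xs \<subseteq> S; \<And>a. Some a \<in> set w \<Longrightarrow> a \<in> S\<rbrakk> \<Longrightarrow> set (fill w Xs) \<subseteq> S"
proof (induction w arbitrary: Xs)
  case (Cons a w)
  show ?case
  proof (cases a)
    case None
    with Cons.prems obtain X Xs' where "Xs = X # Xs'" "fits w Xs'"
      by (cases Xs) auto
    then show ?thesis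
      using Cons.IH[of Xs'] Cons.prems None by auto
  next
    case (Some x)
    then show ?thesis
      using Cons.IH[of Xs] Cons.prems by auto
  qed
qed simp

lemma fill_replicate [simp]: "fill (replicate k (Some a)) Xs = replicate k a"
  by (induction k) auto

lemma factors0_simps [simp]:
  "factors0 a [] Xs = []"
  "factors0 a (None # w) (X # Xs) = X # factors0 a w Xs"
  "factors0 a (Some b # w) Xs = a # factors0 a w Xs"
  by (simp_all add: factors0_def)

lemma length_factors0 [simp]: "length (factors0 a w Xs) = length w"
  by (simp add: factors0_def)

lemma factors0_replicate [simp]: "factors0 a (replicate k (Some b)) Xs = replicate k a"
  by (simp add: factors0_def)

lemma factors0_append [simp]:
  "fits u Xs
   \<Longrightarrow> factors0 a (u @ v) (Xs @ Zs) = factors0 a u Xs @ factors0 a v Zs"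
  by (simp add: factors0_def fill_append)

lemma factors0_append_Some [simp]:
  "fits u Xs \<Longrightarrow> factors0 a (u @ replicate k (Some b)) Xs = factors0 a u Xs @ replicate k a"
  using factors0_append[of u Xs a "replicate k (Some b)" "[]"] by simp

lemma map_factors0 [simp]:
  "fits w Xs \<Longrightarrow> map f (factors0 a w Xs) = factors0 (f a) w (map f Xs)"
  by (simp add: factors0_def map_fill comp_def option.map_comp)

lemma set_factors0:
  "fits w Xs \<Longrightarrow> a \<in> S \<Longrightarrow> set Xs \<subseteq> S \<Longrightarrow> set (factors0 a w Xs) \<subseteq> S"
  unfolding factors0_def by (rule set_fill) (auto simp: eq_commute[of "Some _" "map_option _ _"])

lemma pattern_split:
  assumes "w \<in> patterns n" "i < n"
  obtains u v where "w = u @ None # v" "u \<in> patterns i" "v \<in> patterns (n - Suc i)"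
proof -
  have "\<exists>u v. w = u @ None # v \<and> count_list u None = i \<and> count_list v None = n - Suc i"
    using assms
  proof (induction w arbitrary: n i)
    case (Cons a w)
    show ?case
    proof (cases a)
      case None
      then have n: "n = Suc (count_list w None)"
        using Cons.prems by (simp add: patterns_iff)
      show ?thesis
      proof (cases i)
        case 0
        with None n have "a # w = [] @ None # w \<and> count_list [] None = i \<and> count_list w None = n - Suc i"
          by simp
        then show ?thesis by (intro exI)
      next
        case (Suc j)
        have "w \<in> patterns (n - 1)" "j < n - 1"
          using n Suc Cons.prems by (simp_all add: patterns_iff)
        from Cons.IH[OF this] obtain u v
          where "w = u @ None # v" "count_list u None = j" "count_list v None = n - 1 - Suc j"
          by (elim exE conjE)
        then have "a # w = (None # u) @ None # v \<and> count_list (None # u) None = i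
            \<and> count_list v None = n - Suc i"
          using None Suc by simp
        then show ?thesis by (intro exI)
      qed
    next
      case (Some b)
      then have "w \<in> patterns n"
        using Cons.prems by (simp add: patterns_iff)
      from Cons.IH[OF this Cons.prems(2)] obtain u v
        where "w = u @ None # v" "count_list u None = i" "count_list v None = n - Suc i"
        by (elim exE conjE)
      then have "a # w = (a # u) @ None # v \<and> count_list (a # u) None = i \<and> count_list v None = n - Suc i"
        using Some by simp
      then show ?thesis by (intro exI)
    qed
  qed (simp add: patterns_iff)
  with that show thesis by (auto simp: patterns_iff)
qed

lemma patterns_0: "w \<in> patterns 0 \<longleftrightarrow> w = replicate (length w) (Some ())"
proof
  show "w \<in> patterns 0 \<Longrightarrow> w = replicate (length w) (Some ())"
  proof (induction w)
    case (Cons a w)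
    then show ?case by (cases a) (auto simp: patterns_iff)
  qed simp
next
  assume "w = replicate (length w) (Some ())"
  then show "w \<in> patterns 0"
    by (metis patterns_iff count_list_replicate_Some)
qed

lemma patterns_0_E:
  assumes "w \<in> patterns 0"
  obtains k where "w = replicate k (Some ())"
  by (rule that, rule patterns_0[THEN iffD1, OF assms])

section \<open>Decorated words and the enveloping coequalizer\<close>

context monoidal_category
begin

lemma set_factors0_Obj [simp]:
  "fits w Xs \<Longrightarrow> a \<in> Obj C \<Longrightarrow> set Xs \<subseteq> Obj C \<Longrightarrow> set (factors0 a w Xs) \<subseteq> Obj C"
  by (rule set_factors0)

lemma set_factors0_Arr [simp]:
  "fits w Xs \<Longrightarrow> a \<in> Arr C \<Longrightarrow> set Xs \<subseteq> Arr C \<Longrightarrow> set (factors0 a w Xs) \<subseteq> Arr C"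
  by (rule set_factors0)

end

context operad_central
begin

lemma optensA_factor_Cod:
  assumes "set ys \<subseteq> Arr C" "set zs \<subseteq> Arr C" "a \<in> Arr C" "b \<in> Arr C" "Dom C a = Cod C b"
  shows "otensA (ids (cods ys) @ [a] @ ids (cods zs)) \<cdot> otensA (ys @ [b] @ zs)
    = otensA (ys @ [a \<cdot> b] @ zs)"
  using assms composable_Ide[OF assms(1)] composable_Ide[OF assms(2)]
  by (subst optensA_Comp) (simp_all add: list_all2_appendI)

lemma optensA_factor_Dom:
  assumes "set ys \<subseteq> Arr C" "set zs \<subseteq> Arr C" "a \<in> Arr C" "b \<in> Arr C" "Dom C a = Cod C b"
  shows "otensA (ys @ [a] @ zs) \<cdot> otensA (ids (doms ys) @ [b] @ ids (doms zs))
    = otensA (ys @ [a \<cdot> b] @ zs)"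
  using assms composable_Ide[OF assms(1)] composable_Ide[OF assms(2)]
  by (subst optensA_Comp) (simp_all add: list_all2_appendI)

lemma optensA_split:
  assumes "set ys \<subseteq> Arr C" "set zs \<subseteq> Arr C"
  shows "otensA (ys @ ids (cods zs)) \<cdot> otensA (ids (doms ys) @ zs) = otensA (ys @ zs)"
  using composable_Ide[OF assms(1)] composable_Ide[OF assms(2)]
  by (subst optensA_Comp) (simp_all add: list_all2_appendI)

lemma optensA_exchange:
  assumes "set ys \<subseteq> Arr C" "set zs \<subseteq> Arr C" and a [simp]: "a \<in> Arr C"
  shows "otensA (ids (cods ys) @ [a] @ ids (cods zs))
      \<cdot> otensA (ys @ [Ide C (Dom C a)] @ zs)
    = otensA (ys @ [Ide C (Cod C a)] @ zs)
      \<cdot> otensA (ids (doms ys) @ [a] @ ids (doms zs))"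
  using optensA_factor_Cod[OF assms(1,2) a, of "Ide C (Dom C a)"]
    optensA_factor_Dom[OF assms(1,2) _ a, of "Ide C (Cod C a)"] by simp

lemma opunit_nat:
  assumes [simp]: "f \<in> Arr C"
  shows "ounit (Cod C f) \<cdot> f = otensA [f] \<cdot> ounit (Dom C f)"
proof -
  have R: "cinv (RUnit C (Cod C f)) \<cdot> f = (f \<boxtimes> Ide C (Unit C)) \<cdot> cinv (RUnit C (Dom C f))"
  proof (rule iso_cancel_right[OF RUnit_iso[of "Dom C f"]])
    show "(cinv (RUnit C (Cod C f)) \<cdot> f) \<cdot> RUnit C (Dom C f)
        = ((f \<boxtimes> Ide C (Unit C)) \<cdot> cinv (RUnit C (Dom C f))) \<cdot> RUnit C (Dom C f)"
      using RUnit_natural[OF hom_Dom_Cod[OF assms], symmetric] by simp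
  qed simp_all
  show ?thesis
    by (simp add: opunit_eq LUnit_inverse_nat interchange_extend R optensA_def)
qed

end

text \<open>Colimits are asked for over the index types of the construction, which keeps the universe of small
  sets out of the locale.\<close>
locale operad_algebra = operad_central C V z P
  for C :: "('oc, 'mc) monoidal" (structure) and V :: "('ov, 'mv) braided"
    and z :: "('ov, 'mv, 'oc, 'mc) central" and P :: "('ov, 'mv) operad" +
  fixes A :: 'oc and \<alpha> :: "nat \<Rightarrow> 'mc"
  assumes algebra: "is_algebra C z P (A, \<alpha>)"
    and coproduct_words: "\<And>(I :: unit option list set) D. (\<And>i. i \<in> I \<Longrightarrow> D i \<in> Obj C)
      \<Longrightarrow> \<exists>c \<iota>. is_coproduct C I D c \<iota>"
    and coproduct_arity_words: "\<And>(I :: nat option list set) D. (\<And>i. i \<in> I \<Longrightarrow> D i \<in> Obj C)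
      \<Longrightarrow> \<exists>c \<iota>. is_coproduct C I D c \<iota>"
    and coequalizer: "\<And>d d'. \<lbrakk>d \<in> Arr C; d' \<in> hom C (Dom C d) (Cod C d)\<rbrakk> \<Longrightarrow> \<exists>q. is_coequalizer C d d' q"
begin

abbreviation "Aa \<equiv> (A, \<alpha>)"
abbreviation "ofactors \<equiv> factors1 C z P A"
abbreviation "ograft_all \<equiv> graft_all C z P A"
abbreviation "env0A \<equiv> env0 C z P A"
abbreviation "ealg \<equiv> env_alg C z P Aa"
abbreviation "eop \<equiv> env_op C z P Aa"
abbreviation "ecoeq \<equiv> env_coeq C z P Aa"
abbreviation "eob \<equiv> env_ob C z P Aa"
abbreviation "ein \<equiv> env_in C z P Aa"
abbreviation "earr \<equiv> env_arr C z P Aa"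
abbreviation "ecomp \<equiv> env_comp C z P Aa"

lemma A_Obj [simp]: "A \<in> Obj C"
  using algebra by (simp add: is_algebra_def)

lemma \<alpha>_arr [simp]:
  "\<alpha> n \<in> Arr C" "Dom C (\<alpha> n) = otens (replicate n A)" "Cod C (\<alpha> n) = A"
  using algebra by (auto simp: is_algebra_def hom_def)

lemma \<alpha>_unit [simp]: "\<alpha> (Suc 0) \<cdot> ounit A = Ide C A"
  using algebra by (simp add: is_algebra_def)

lemma \<alpha>_graft:
  "\<alpha> (m + k + n) \<cdot> ograft (replicate m A) (replicate k A) (replicate n A)
   = \<alpha> (Suc (m + n)) \<cdot> otensA (replicate m (Ide C A) @ [\<alpha> k] @ replicate n (Ide C A))"
proof -
  have "\<alpha> (p + q - 1) \<cdot> ograft (replicate (i - 1) A) (replicate q A) (replicate (p - i) A)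
    = \<alpha> p \<cdot> otensA (replicate (i - 1) (Ide C A) @ [\<alpha> q] @ replicate (p - i) (Ide C A))"
    if "1 \<le> i" "i \<le> p" for i p q
    using algebra that by (simp add: is_algebra_def)
  from this[of "Suc m" "Suc (m + n)" k] show ?thesis
    by (simp add: add_ac)
qed

text \<open>The relation of the enveloping coequalizer at a single letter \<open>A\<close>: an operation with arguments \<open>A\<close>
  at this letter may act through \<open>\<alpha>\<close> or be grafted into the word. Splitting \<open>Xs\<close> along with the word
  records which distinguished objects stand to its left.\<close>
definition balanced :: "'oc list \<Rightarrow> (unit option list \<Rightarrow> 'mc) \<Rightarrow> bool" where
  "balanced Xs H \<longleftrightarrow> (\<forall>Xs1 Xs2 u v k.
     Xs = Xs1 @ Xs2 \<longrightarrow> u \<in> patterns (length Xs1) \<longrightarrow> v \<in> patterns (length Xs2) \<longrightarrow>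
     H (u @ [Some ()] @ v)
       \<cdot> otensA (ids (factors0 A u Xs1) @ [\<alpha> k] @ ids (factors0 A v Xs2))
     = H (u @ replicate k (Some ()) @ v)
       \<cdot> ograft (factors0 A u Xs1) (replicate k A) (factors0 A v Xs2))"

definition cocone :: "'oc list \<Rightarrow> 'oc \<Rightarrow> (unit option list \<Rightarrow> 'mc) \<Rightarrow> bool" where
  "cocone Xs T H \<longleftrightarrow> (\<forall>w\<in>patterns (length Xs). H w \<in> hom C (otens (factors0 A w Xs)) T)"

lemma balancedD:
  assumes "balanced (Xs1 @ Xs2) H" "u \<in> patterns (length Xs1)" "v \<in> patterns (length Xs2)"
  shows "H (u @ [Some ()] @ v)
       \<cdot> otensA (ids (factors0 A u Xs1) @ [\<alpha> k] @ ids (factors0 A v Xs2))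
     = H (u @ replicate k (Some ()) @ v)
       \<cdot> ograft (factors0 A u Xs1) (replicate k A) (factors0 A v Xs2)"
  using assms unfolding balanced_def by blast

lemma cocone_arr:
  assumes "cocone Xs T H" "fits w Xs"
  shows "H w \<in> Arr C" "Dom C (H w) = otens (factors0 A w Xs)" "Cod C (H w) = T"
  using assms by (auto simp: cocone_def patterns_iff hom_def)

text \<open>The arrows by which \<open>env_alg\<close> acts on the letters of the summand \<open>w\<close>.\<close>
definition act :: "nat option list \<Rightarrow> 'oc list \<Rightarrow> 'mc list" where
  "act w Xs = fill (map (map_option \<alpha>) w) (ids Xs)"

lemma replicate_Obj [simp]: "set (replicate k A) \<subseteq> Obj C"
  by auto

lemma act_simps [simp]:
  "act [] Xs = []" "act (None # w) (X # Xs) = Ide C X # act w Xs" "act (Some k # w) Xs = \<alpha> k # act w Xs"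
  by (simp_all add: act_def)

lemma act_append [simp]:
  "fits u Xs \<Longrightarrow> act (u @ v) (Xs @ Zs) = act u Xs @ act v Zs"
  by (simp add: act_def fill_append)

lemma length_act [simp]: "length (act w Xs) = length w"
  by (simp add: act_def)

lemma factors1_simps [simp]:
  "ofactors [] Xs = []"
  "ofactors (None # w) (X # Xs) = X # ofactors w Xs"
  "ofactors (Some k # w) Xs = otens (replicate k A) # ofactors w Xs"
  by (simp_all add: factors1_def)

lemma factors1_Obj [simp]:
  assumes "fits w Xs" "set Xs \<subseteq> Obj C"
  shows "set (ofactors w Xs) \<subseteq> Obj C"
  unfolding factors1_def using assms by (intro set_fill) (auto simp: eq_commute[of "Some _" "map_option _ _"])

lemma act_arr [simp]:
  assumes "fits w Xs" "set Xs \<subseteq> Obj C"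
  shows "set (act w Xs) \<subseteq> Arr C" "doms (act w Xs) = ofactors w Xs"
    "cods (act w Xs) = factors0 A (forget_arity w) Xs"
proof -
  show "set (act w Xs) \<subseteq> Arr C"
    unfolding act_def using assms by (intro set_fill) (auto simp: eq_commute[of "Some _" "map_option _ _"])
  show "doms (act w Xs) = ofactors w Xs"
    using assms by (simp add: act_def map_fill factors1_def) (simp add: option.map_comp comp_def)
  show "cods (act w Xs) = factors0 A (forget_arity w) Xs"
    using assms by (simp add: act_def map_fill factors0_def forget_arity_def)
      (simp add: option.map_comp comp_def)
qed

lemma flatten_simps [simp]:
  "flatten [] = []" "flatten (None # w) = None # flatten w"
  "flatten (Some k # w) = replicate k (Some ()) @ flatten w"
  by (simp_all add: flatten_def)

lemma forget_arity_simps [simp]: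
  "forget_arity [] = []" "forget_arity (None # w) = None # forget_arity w"
  "forget_arity (Some k # w) = Some () # forget_arity w"
  by (simp_all add: forget_arity_def)

lemma factors0_replicate_append [simp]:
  "factors0 a (replicate k (Some b) @ w) Xs = replicate k a @ factors0 a w Xs"
  using factors0_append[of "replicate k (Some b)" "[]" a w Xs] by simp

lemma graft_all_arr [simp]:
  assumes "fits w Xs" "set Xs \<subseteq> Obj C" "set Ys \<subseteq> Obj C"
  shows "ograft_all Ys w Xs \<in> Arr C"
    "Dom C (ograft_all Ys w Xs) = otens (Ys @ ofactors w Xs)"
    "Cod C (ograft_all Ys w Xs) = otens (Ys @ factors0 A (flatten w) Xs)"
proof -
  have "ograft_all Ys w Xs \<in> hom C (otens (Ys @ ofactors w Xs))
      (otens (Ys @ factors0 A (flatten w) Xs))"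
    using assms
  proof (induction w arbitrary: Ys Xs)
    case Nil
    then show ?case by (simp add: hom_def)
  next
    case (Cons a w)
    show ?case
    proof (cases a)
      case None
      then obtain X Xs' where "Xs = X # Xs'"
        using Cons.prems by (cases Xs) auto
      then show ?thesis
        using Cons.IH[of Xs' "Ys @ [X]"] Cons.prems None by simp
    next
      case (Some k)
      have "set (replicate k A) \<subseteq> Obj C" by auto
      then show ?thesis
        using Cons.IH[of Xs "Ys @ replicate k A"] Cons.prems Some by (simp add: hom_def)
    qed
  qed
  then show "ograft_all Ys w Xs \<in> Arr C"
    "Dom C (ograft_all Ys w Xs) = otens (Ys @ ofactors w Xs)"
    "Cod C (ograft_all Ys w Xs) = otens (Ys @ factors0 A (flatten w) Xs)"
    by (auto simp: hom_def)
qed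

lemma replicate_Arr [simp]: "set (replicate k (Ide C A)) \<subseteq> Arr C"
  by auto

lemma optensA_replicate_Ide [simp]: "otensA (replicate k (Ide C A)) = Ide C (otens (replicate k A))"
  using optensA_Ide[of "replicate k A"] by simp

lemma optensA_factors0_Ide [simp]:
  "\<lbrakk>fits w Xs; set Xs \<subseteq> Obj C\<rbrakk>
   \<Longrightarrow> otensA (factors0 (Ide C A) w (ids Xs)) = Ide C (otens (factors0 A w Xs))"
  using optensA_Ide[of "factors0 A w Xs"] by simp

text \<open>Letters are treated from left to right; \<open>p\<close> is the part of the word that has been treated. In each
  step one operation is grafted by the one-letter relation, and naturality of grafting moves the
  structure maps at later letters past it.\<close>
lemma balanced_graft_all_from:
  assumes bal: "balanced (Xs1 @ Xs2) H" and coc: "cocone (Xs1 @ Xs2) T H"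
    and p: "fits p Xs1" and w: "fits w Xs2"
    and Xs: "set Xs1 \<subseteq> Obj C" "set Xs2 \<subseteq> Obj C"
  shows "H (p @ forget_arity w) \<cdot> otensA (ids (factors0 A p Xs1) @ act w Xs2)
    = H (p @ flatten w) \<cdot> ograft_all (factors0 A p Xs1) w Xs2"
  using assms
proof (induction w arbitrary: p Xs1 Xs2)
  case Nil
  then show ?case
    using cocone_arr[OF Nil(2), of p] by simp
next
  case (Cons a w)
  show ?case
  proof (cases a)
    case None
    then obtain X Xs2' where X: "Xs2 = X # Xs2'"
      using Cons.prems by (cases Xs2) auto
    then show ?thesis
      using Cons.IH[of "Xs1 @ [X]" Xs2' "p @ [None]"] Cons.prems None by simp
  next
    case (Some k)
    note prems = Cons.prems
    have w [simp]: "fits w Xs2"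
      using prems Some by simp
    note [simp] = prems(3,5,6)
    let ?p = "factors0 A p Xs1" and ?R = "act w Xs2" and ?w = "factors0 A (forget_arity w) Xs2"
    let ?K = "replicate k A" and ?G = "Ide C (otens (replicate k A))"
    have [simp]: "H (p @ Some () # forget_arity w) \<in> Arr C"
      "Dom C (H (p @ Some () # forget_arity w)) = otens (?p @ A # ?w)"
      "H (p @ replicate k (Some ()) @ forget_arity w) \<in> Arr C"
      "Dom C (H (p @ replicate k (Some ()) @ forget_arity w)) = otens (?p @ ?K @ ?w)"
      "H (p @ replicate k (Some ()) @ flatten w) \<in> Arr C"
      "Dom C (H (p @ replicate k (Some ()) @ flatten w)) = otens (?p @ ?K @ factors0 A (flatten w) Xs2)"
      by (simp_all add: cocone_arr[OF prems(2)])
    have rel: "H (p @ [Some ()] @ forget_arity w) \<cdot> otensA (ids ?p @ [\<alpha> k] @ ids ?w)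
        = H (p @ replicate k (Some ()) @ forget_arity w) \<cdot> ograft ?p ?K ?w"
      using prems by (intro balancedD) (auto simp: patterns_iff)
    have split: "otensA (ids ?p @ [\<alpha> k] @ ids ?w) \<cdot> otensA (ids ?p @ [?G] @ ?R)
        = otensA (ids ?p @ [\<alpha> k] @ ?R)"
      using optensA_factor_Cod[of "ids ?p" ?R "\<alpha> k" ?G] by simp
    have nat: "ograft ?p ?K ?w \<cdot> otensA (ids ?p @ [?G] @ ?R)
        = otensA (ids ?p @ ids ?K @ ?R) \<cdot> ograft ?p ?K (ofactors w Xs2)"
      using graft_nat[of "ids ?p" "ids ?K" ?R] by simp
    have IH: "H (p @ replicate k (Some ()) @ forget_arity w) \<cdot> otensA (ids ?p @ ids ?K @ ?R)
        = H (p @ replicate k (Some ()) @ flatten w) \<cdot> ograft_all (?p @ ?K) w Xs2"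
      using Cons.IH[of Xs1 Xs2 "p @ replicate k (Some ())"] prems by simp
    have "H (p @ forget_arity (a # w)) \<cdot> otensA (ids ?p @ act (a # w) Xs2)
        = H (p @ [Some ()] @ forget_arity w) \<cdot> (otensA (ids ?p @ [\<alpha> k] @ ids ?w)
            \<cdot> otensA (ids ?p @ [?G] @ ?R))"
      unfolding split by (simp add: Some)
    also have "\<dots> = H (p @ replicate k (Some ()) @ forget_arity w) \<cdot> (ograft ?p ?K ?w
          \<cdot> otensA (ids ?p @ [?G] @ ?R))"
      using Comp_eq_extend[OF rel, of "otensA (ids ?p @ [?G] @ ?R)"] by simp
    also have "\<dots> = H (p @ replicate k (Some ()) @ flatten w) \<cdot> (ograft_all (?p @ ?K) w Xs2
          \<cdot> ograft ?p ?K (ofactors w Xs2))"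
      unfolding nat using Comp_eq_extend[OF IH, of "ograft ?p ?K (ofactors w Xs2)"] by simp
    finally show ?thesis
      using Some by simp
  qed
qed

text \<open>A unit operation can be put at every undistinguished letter. The next lemmas show that such units
  do not change a word, whether they are grafted or act. This turns an operation at a single
  letter into an operation at every letter.\<close>
abbreviation unary :: "unit option list \<Rightarrow> nat option list" where
  "unary u \<equiv> map (map_option (\<lambda>_. Suc 0)) u"

abbreviation units :: "unit option list \<Rightarrow> 'oc list \<Rightarrow> 'mc list" where
  "units u Xs \<equiv> factors0 (ounit A) u (ids Xs)"

lemma forget_arity_unary [simp]: "forget_arity (unary u) = u"
  unfolding forget_arity_def map_map
proof (rule map_idI)
  show "(map_option (\<lambda>_. ()) \<circ> map_option (\<lambda>_. Suc 0)) a = a" for a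
    by (cases a) auto
qed

lemma flatten_append [simp]: "flatten (u @ v) = flatten u @ flatten v"
  by (simp add: flatten_def)

lemma forget_arity_append [simp]: "forget_arity (u @ v) = forget_arity u @ forget_arity v"
  by (simp add: forget_arity_def)

lemma flatten_unary [simp]: "flatten (unary u) = u"
  by (induction u) (auto simp: flatten_def split: option.splits)

lemma factors1_append [simp]:
  "fits u Xs
   \<Longrightarrow> ofactors (u @ v) (Xs @ Zs) = ofactors u Xs @ ofactors v Zs"
  by (simp add: factors1_def fill_append)

lemma factors1_unary:
  "fits u Xs
   \<Longrightarrow> ofactors (unary u) Xs = factors0 (otens [A]) u Xs"
  by (simp add: factors1_def factors0_def option.map_comp comp_def)

lemma graft_all_unary:
  assumes "fits u Xs1" "fits w Xs2"
    "set Ys \<subseteq> Obj C" "set Xs1 \<subseteq> Obj C" "set Xs2 \<subseteq> Obj C"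
  shows "ograft_all Ys (unary u @ w) (Xs1 @ Xs2)
      \<cdot> otensA (ids Ys @ units u Xs1 @ ids (ofactors w Xs2))
    = ograft_all (Ys @ factors0 A u Xs1) w Xs2"
  using assms
proof (induction u arbitrary: Ys Xs1)
  case Nil
  then show ?case
    using optensA_Ide[of "Ys @ ofactors w Xs2"] by (simp del: optensA_Ide)
next
  case (Cons a u)
  show ?case
  proof (cases a)
    case None
    then obtain X Xs where "Xs1 = X # Xs"
      using Cons.prems by (cases Xs1) auto
    then show ?thesis
      using Cons.IH[of Xs "Ys @ [X]"] Cons.prems None by simp
  next
    case (Some _)
    have u [simp]: "fits u Xs1"
      using Cons.prems(1) Some by simp
    note [simp] = Cons.prems(2-5)
    let ?w1 = "ofactors w Xs2"
    let ?R = "units u Xs1 @ ids ?w1"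
    let ?D = "factors0 A u Xs1 @ ?w1"
    let ?f = "ofactors (unary u @ w) (Xs1 @ Xs2)"
    let ?g = "ograft_all (Ys @ [A]) (unary u @ w) (Xs1 @ Xs2)"
    have f: "?f = factors0 (otens [A]) u Xs1 @ ?w1"
      by (simp add: factors1_unary)
    have split: "otensA (ids Ys @ [Ide C (otens [A])] @ ?R)
          \<cdot> otensA (ids Ys @ [ounit A] @ ids ?D)
        = otensA (ids Ys @ [ounit A] @ ?R)"
      using optensA_factor_Dom[of "ids Ys" ?R "Ide C (otens [A])" "ounit A"] by simp
    have nat: "ograft Ys [A] ?f \<cdot> otensA (ids Ys @ [Ide C (otens [A])] @ ?R)
        = otensA (ids Ys @ [Ide C A] @ ?R) \<cdot> ograft Ys [A] ?D"
      using graft_nat[of "ids Ys" "[Ide C A]" ?R] optensA_Ide[of "[A]"]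
      by (simp add: f)
    have unit: "ograft Ys [A] ?D \<cdot> otensA (ids Ys @ [ounit A] @ ids ?D)
        = Ide C (otens (Ys @ [A] @ ?D))"
      by (rule graft_right_unit) simp_all
    have IH: "?g \<cdot> otensA (ids (Ys @ [A]) @ ?R)
        = ograft_all ((Ys @ [A]) @ factors0 A u Xs1) w Xs2"
      using Cons.IH[of Xs1 "Ys @ [A]"] by simp
    have "ograft_all Ys (unary (a # u) @ w) (Xs1 @ Xs2)
        \<cdot> otensA (ids Ys @ units (a # u) Xs1 @ ids ?w1)
      = ?g \<cdot> (ograft Ys [A] ?f \<cdot> (otensA (ids Ys @ [Ide C (otens [A])] @ ?R)
          \<cdot> otensA (ids Ys @ [ounit A] @ ids ?D)))"
      unfolding split by (simp add: Some f)
    also have "\<dots> = ?g \<cdot> (otensA (ids Ys @ [Ide C A] @ ?R) \<cdot> (ograft Ys [A] ?D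
          \<cdot> otensA (ids Ys @ [ounit A] @ ids ?D)))"
      using Comp_eq_extend[OF nat, of "otensA (ids Ys @ [ounit A] @ ids ?D)"]
      by (simp add: f)
    also have "\<dots> = ?g \<cdot> otensA (ids Ys @ [Ide C A] @ ?R)"
      unfolding unit by simp
    finally show ?thesis
      using IH Some by simp
  qed
qed

lemma act_units:
  assumes "fits u Xs" "set Xs \<subseteq> Obj C"
  shows "map2 (\<cdot>) (act (unary u) Xs) (units u Xs) = ids (factors0 A u Xs)"
    and "composable (act (unary u) Xs) (units u Xs)"
proof -
  have "map2 (\<cdot>) (act (unary u) Xs) (units u Xs) = ids (factors0 A u Xs) \<and>
    composable (act (unary u) Xs) (units u Xs)"
    using assms
  proof (induction u arbitrary: Xs)
    case (Cons a u)
    show ?case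
    proof (cases a)
      case None
      with Cons.prems obtain X Xs' where "Xs = X # Xs'" "fits u Xs'"
        by (cases Xs) auto
      then show ?thesis
        using Cons.IH[of Xs'] Cons.prems None by simp
    next
      case (Some _)
      then show ?thesis
        using Cons.IH[of Xs] Cons.prems by simp
    qed
  qed simp
  then show "map2 (\<cdot>) (act (unary u) Xs) (units u Xs) = ids (factors0 A u Xs)"
    "composable (act (unary u) Xs) (units u Xs)"
    by blast+
qed

text \<open>Conversely, the one-letter relation at the letter between \<open>u\<close> and \<open>v\<close> is the relation for the
  word with operations at all letters, restricted along units at the letters of \<open>u\<close> and \<open>v\<close>.\<close>
lemma balanced_of_graft_all:
  assumes coc: "cocone Xs T H" and Xs: "set Xs \<subseteq> Obj C"
    and rel: "\<And>w. w \<in> patterns (length Xs) \<Longrightarrow>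
      H (forget_arity w) \<cdot> otensA (act w Xs) = H (flatten w) \<cdot> ograft_all [] w Xs"
  shows "balanced Xs H"
  unfolding balanced_def
proof (intro allI impI)
  fix Xs1 Xs2 k and u v :: "unit option list"
  assume split: "Xs = Xs1 @ Xs2" and "u \<in> patterns (length Xs1)" "v \<in> patterns (length Xs2)"
  then have [simp]: "fits u Xs1" "fits v Xs2"
    "set Xs1 \<subseteq> Obj C" "set Xs2 \<subseteq> Obj C"
    using Xs by (auto simp: patterns_iff)
  let ?w = "unary u @ [Some k] @ unary v"
  let ?K = "replicate k A"
  let ?G = "otens ?K"
  let ?u = "factors0 A u Xs1" and ?v = "factors0 A v Xs2"
  let ?v1 = "ofactors (unary v) Xs2"
  let ?E = "otensA (units u Xs1 @ [Ide C ?G] @ units v Xs2)"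
  have v1: "?v1 = factors0 (otens [A]) v Xs2"
    "ofactors (unary u) Xs1 = factors0 (otens [A]) u Xs1"
    by (simp_all add: factors1_unary)
  have [simp]: "H (u @ Some () # v) \<in> Arr C" "Dom C (H (u @ Some () # v)) = otens (?u @ A # ?v)"
    "H (u @ replicate k (Some ()) @ v) \<in> Arr C"
    "Dom C (H (u @ replicate k (Some ()) @ v)) = otens (?u @ ?K @ ?v)"
    using cocone_arr[OF coc, of "u @ Some () # v"] cocone_arr[OF coc, of "u @ replicate k (Some ()) @ v"]
    by (simp_all add: split)
  have act: "act ?w Xs = act (unary u) Xs1 @ [\<alpha> k] @ act (unary v) Xs2"
    by (simp add: split)
  have L: "otensA (act ?w Xs) \<cdot> ?E = otensA (ids ?u @ [\<alpha> k] @ ids ?v)"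
    unfolding act
    by (subst optensA_Comp) (simp_all add: act_units list_all2_appendI)
  have E: "?E = otensA (units u Xs1 @ ids (?G # ?v1))
      \<cdot> otensA (ids ?u @ [Ide C ?G] @ units v Xs2)"
    using optensA_split[of "units u Xs1" "[Ide C ?G] @ units v Xs2"] by (simp add: v1)
  have R1: "ograft_all [] ?w Xs \<cdot> otensA (units u Xs1 @ ids (?G # ?v1))
      = ograft_all (?u @ ?K) (unary v) Xs2 \<cdot> ograft ?u ?K ?v1"
    using graft_all_unary[of u Xs1 "Some k # unary v" Xs2 "[]"] by (simp add: split)
  have nat: "ograft ?u ?K ?v1 \<cdot> otensA (ids ?u @ [Ide C ?G] @ units v Xs2)
      = otensA (ids ?u @ ids ?K @ units v Xs2) \<cdot> ograft ?u ?K ?v"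
    using graft_nat[of "ids ?u" "ids ?K" "units v Xs2"] by (simp add: v1)
  have R2: "ograft_all (?u @ ?K) (unary v) Xs2 \<cdot> otensA (ids ?u @ ids ?K @ units v Xs2)
      = Ide C (otens (?u @ ?K @ ?v))"
    using graft_all_unary[of v Xs2 "[]" "[]" "?u @ ?K"] by simp
  have "ograft_all [] ?w Xs \<cdot> ?E = ograft_all (?u @ ?K) (unary v) Xs2
      \<cdot> (ograft ?u ?K ?v1 \<cdot> otensA (ids ?u @ [Ide C ?G] @ units v Xs2))"
    unfolding E
    using Comp_eq_extend[OF R1, of "otensA (ids ?u @ [Ide C ?G] @ units v Xs2)"]
    by (simp add: split v1)
  also have "\<dots> = ograft ?u ?K ?v"
    unfolding nat using Comp_eq_extend[OF R2, of "ograft ?u ?K ?v"] by (simp add: v1)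
  finally have R: "ograft_all [] ?w Xs \<cdot> ?E = ograft ?u ?K ?v" .
  have "?w \<in> patterns (length Xs)"
    by (simp add: patterns_iff split)
  from rel[OF this] have rel_w: "H (u @ [Some ()] @ v) \<cdot> otensA (act ?w Xs)
      = H (u @ replicate k (Some ()) @ v) \<cdot> ograft_all [] ?w Xs"
    by simp
  have [simp]: "set (act ?w Xs) \<subseteq> Arr C" "doms (act ?w Xs) = ofactors ?w Xs"
    "cods (act ?w Xs) = ?u @ [A] @ ?v"
    using Xs by (simp_all add: split)
  have "H (u @ [Some ()] @ v) \<cdot> (otensA (act ?w Xs) \<cdot> ?E)
      = (H (u @ replicate k (Some ()) @ v) \<cdot> ograft_all [] ?w Xs) \<cdot> ?E"
    by (rule Comp_eq_extend[OF rel_w]) (simp_all add: split v1)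
  also have "\<dots> = H (u @ replicate k (Some ()) @ v) \<cdot> (ograft_all [] ?w Xs \<cdot> ?E)"
    by (rule assoc_simp) (simp_all add: split v1)
  finally show "H (u @ [Some ()] @ v) \<cdot> otensA (ids ?u @ [\<alpha> k] @ ids ?v)
      = H (u @ replicate k (Some ()) @ v) \<cdot> ograft ?u ?K ?v"
    unfolding L R .
qed

theorem balanced_iff:
  assumes coc: "cocone Xs T H" and Xs: "set Xs \<subseteq> Obj C"
  shows "balanced Xs H \<longleftrightarrow> (\<forall>w\<in>patterns (length Xs).
      H (forget_arity w) \<cdot> otensA (act w Xs) = H (flatten w) \<cdot> ograft_all [] w Xs)"
proof (intro iffI ballI)
  fix w :: "nat option list"
  assume "balanced Xs H" "w \<in> patterns (length Xs)"
  then show "H (forget_arity w) \<cdot> otensA (act w Xs) = H (flatten w) \<cdot> ograft_all [] w Xs"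
    using balanced_graft_all_from[where ?Xs1.0 = "[]" and ?Xs2.0 = Xs and p = "[]" and H = H and w = w and T = T,
        unfolded append_Nil] assms
    by (simp add: patterns_iff del: optensA_Comp)
qed (rule balanced_of_graft_all[OF assms], blast)

abbreviation env1 :: "'oc list \<Rightarrow> 'oc \<times> (nat option list \<Rightarrow> 'mc)" where
  "env1 Xs \<equiv> coprod C (patterns (length Xs)) (\<lambda>w. otens (ofactors w Xs))"

lemma env0_is_coproduct:
  assumes "set Xs \<subseteq> Obj C"
  shows "\<exists>c \<iota>. is_coproduct C (patterns (length Xs)) (\<lambda>w. otens (factors0 A w Xs)) c \<iota>"
  using assms by (intro coproduct_words) (simp add: patterns_iff)

lemma env1_is_coproduct:
  assumes "set Xs \<subseteq> Obj C"
  shows "\<exists>c \<iota>. is_coproduct C (patterns (length Xs)) (\<lambda>w. otens (ofactors w Xs)) c \<iota>"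
  using assms by (intro coproduct_arity_words) (simp add: patterns_iff)

lemma env0_arr [simp]:
  assumes "set Xs \<subseteq> Obj C"
  shows "fst (env0A Xs) \<in> Obj C"
    and "fits w Xs \<Longrightarrow> snd (env0A Xs) w \<in> Arr C"
    and "fits w Xs \<Longrightarrow> Dom C (snd (env0A Xs) w) = otens (factors0 A w Xs)"
    and "fits w Xs \<Longrightarrow> Cod C (snd (env0A Xs) w) = fst (env0A Xs)"
  using coproduct_arr[OF coprod_is_coproduct[OF env0_is_coproduct[OF assms]]]
  unfolding env0_def hom_def by (simp_all add: patterns_iff)

lemma env1_arr [simp]:
  assumes "set Xs \<subseteq> Obj C"
  shows "fst (env1 Xs) \<in> Obj C"
    and "fits w Xs \<Longrightarrow> snd (env1 Xs) w \<in> Arr C"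
    and "fits w Xs \<Longrightarrow> Dom C (snd (env1 Xs) w) = otens (ofactors w Xs)"
    and "fits w Xs \<Longrightarrow> Cod C (snd (env1 Xs) w) = fst (env1 Xs)"
  using coproduct_arr[OF coprod_is_coproduct[OF env1_is_coproduct[OF assms]]]
  unfolding hom_def by (simp_all add: patterns_iff)

lemma env_alg:
  assumes Xs: "set Xs \<subseteq> Obj C"
  shows "ealg Xs \<in> hom C (fst (env1 Xs)) (fst (env0A Xs))"
    and "w \<in> patterns (length Xs) \<Longrightarrow> ealg Xs \<cdot> snd (env1 Xs) w
      = snd (env0A Xs) (forget_arity w) \<cdot> otensA (act w Xs)"
proof -
  have h: "snd (env0A Xs) (forget_arity w) \<cdot> otensA (act w Xs) \<in> hom C (otens (ofactors w Xs)) (fst (env0A Xs))"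
    if "w \<in> patterns (length Xs)" for w
    using that Xs by (simp add: patterns_iff hom_def)
  note copair = copair[OF env1_is_coproduct[OF Xs] env0_arr(1)[OF Xs] h]
  show "ealg Xs \<in> hom C (fst (env1 Xs)) (fst (env0A Xs))"
    using copair(1) by (simp add: env_alg_def act_def)
  show "w \<in> patterns (length Xs) \<Longrightarrow> ealg Xs \<cdot> snd (env1 Xs) w
      = snd (env0A Xs) (forget_arity w) \<cdot> otensA (act w Xs)"
    using copair(2) by (simp add: env_alg_def act_def)
qed

lemma env_op:
  assumes Xs: "set Xs \<subseteq> Obj C"
  shows "eop Xs \<in> hom C (fst (env1 Xs)) (fst (env0A Xs))"
    and "w \<in> patterns (length Xs) \<Longrightarrow> eop Xs \<cdot> snd (env1 Xs) w
      = snd (env0A Xs) (flatten w) \<cdot> ograft_all [] w Xs"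
proof -
  have h: "snd (env0A Xs) (flatten w) \<cdot> ograft_all [] w Xs \<in> hom C (otens (ofactors w Xs)) (fst (env0A Xs))"
    if "w \<in> patterns (length Xs)" for w
    using that Xs by (simp add: patterns_iff hom_def)
  note copair = copair[OF env1_is_coproduct[OF Xs] env0_arr(1)[OF Xs] h]
  show "eop Xs \<in> hom C (fst (env1 Xs)) (fst (env0A Xs))"
    using copair(1) by (simp add: env_op_def)
  show "w \<in> patterns (length Xs) \<Longrightarrow> eop Xs \<cdot> snd (env1 Xs) w
      = snd (env0A Xs) (flatten w) \<cdot> ograft_all [] w Xs"
    using copair(2) by (simp add: env_op_def)
qed

lemma coequalizes_iff_balanced:
  assumes Xs: "set Xs \<subseteq> Obj C" and h: "h \<in> hom C (fst (env0A Xs)) T"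
  shows "h \<cdot> ealg Xs = h \<cdot> eop Xs
    \<longleftrightarrow> balanced Xs (\<lambda>w. h \<cdot> snd (env0A Xs) w)"
proof -
  note [simp] = homD[OF h] homD[OF env_alg(1)[OF Xs]] homD[OF env_op(1)[OF Xs]] Xs
  have coc: "cocone Xs T (\<lambda>w. h \<cdot> snd (env0A Xs) w)"
    by (simp add: cocone_def patterns_iff hom_def)
  have a: "(h \<cdot> ealg Xs) \<cdot> snd (env1 Xs) w
      = (h \<cdot> snd (env0A Xs) (forget_arity w)) \<cdot> otensA (act w Xs)"
    and o: "(h \<cdot> eop Xs) \<cdot> snd (env1 Xs) w
      = (h \<cdot> snd (env0A Xs) (flatten w)) \<cdot> ograft_all [] w Xs"
    if "w \<in> patterns (length Xs)" for w
    using env_alg(2)[OF Xs that] env_op(2)[OF Xs that] that by (simp_all add: patterns_iff)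
  show ?thesis
    unfolding balanced_iff[OF coc Xs]
  proof
    assume eq: "h \<cdot> ealg Xs = h \<cdot> eop Xs"
    show "\<forall>w\<in>patterns (length Xs). (h \<cdot> snd (env0A Xs) (forget_arity w)) \<cdot> otensA (act w Xs)
        = (h \<cdot> snd (env0A Xs) (flatten w)) \<cdot> ograft_all [] w Xs"
      by (intro ballI) (simp only: a[symmetric] o[symmetric] eq)
  next
    assume eq: "\<forall>w\<in>patterns (length Xs). (h \<cdot> snd (env0A Xs) (forget_arity w)) \<cdot> otensA (act w Xs)
        = (h \<cdot> snd (env0A Xs) (flatten w)) \<cdot> ograft_all [] w Xs"
    show "h \<cdot> ealg Xs = h \<cdot> eop Xs"
    proof (rule coprod_ext[OF env1_is_coproduct[OF Xs]])
      show "(h \<cdot> ealg Xs) \<cdot> snd (env1 Xs) w = (h \<cdot> eop Xs) \<cdot> snd (env1 Xs) w"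
        if "w \<in> patterns (length Xs)" for w
        using bspec[OF eq that] by (simp only: a[OF that] o[OF that])
    qed (simp_all add: hom_def)
  qed
qed

text \<open>In arity \<open>0\<close> the words are the powers of \<open>A\<close>, and the structure maps \<open>\<alpha>\<close> form a cocone by
  associativity of the action. Any other cocone \<open>h\<close> factors through its value on the word with one
  letter, composed with the operad unit: this is the left unit law of grafting.\<close>
lemma arity_0_coequalizer:
  "\<exists>q. is_coequalizer C (ealg []) (eop []) q \<and> Cod C q = A \<and>
     (\<forall>w\<in>patterns 0. q \<cdot> snd (env0A []) w = \<alpha> (length w))"
proof -
  let ?q = "copair C (patterns 0) (\<lambda>w :: unit option list. otens (factors0 A w [])) A (\<lambda>w. \<alpha> (length w))"
  let ?c0 = "fst (env0A [])" and ?in0 = "snd (env0A [])"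
  have Nil: "set [] \<subseteq> Obj C" by simp
  have w: "factors0 A w [] = replicate (length w) A" if "w \<in> patterns 0" for w
  proof -
    from that obtain k where "w = replicate k (Some ())"
      by (rule patterns_0_E)
    then show ?thesis by simp
  qed
  have h: "\<alpha> (length w) \<in> hom C (otens (factors0 A w [])) A" if "w \<in> patterns 0" for w
    using w that by (simp add: hom_def)
  have cop: "\<exists>c \<iota>. is_coproduct C (patterns 0) (\<lambda>w. otens (factors0 A w [])) c \<iota>"
    using env0_is_coproduct[OF Nil] by simp
  have q: "?q \<in> hom C ?c0 A"
    using copair(1)[OF cop A_Obj h] by (simp add: env0_def)
  have q_in: "?q \<cdot> ?in0 w = \<alpha> (length w)" if "w \<in> patterns 0" for w
    using copair(2)[OF cop A_Obj h that] by (simp add: env0_def)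
  note [simp] = homD[OF q] homD[OF env_alg(1)[OF Nil]] homD[OF env_op(1)[OF Nil]]
  have bal: "balanced [] (\<lambda>w. ?q \<cdot> ?in0 w)"
    unfolding balanced_def
  proof (intro allI impI)
    fix Xs1 Xs2 :: "'oc list" and u v :: "unit option list" and k
    assume "[] = Xs1 @ Xs2" "u \<in> patterns (length Xs1)" "v \<in> patterns (length Xs2)"
    then have e: "Xs1 = []" "Xs2 = []" and "u \<in> patterns 0" "v \<in> patterns 0" by auto
    then obtain m n where uv: "u = replicate m (Some ())" "v = replicate n (Some ())"
      by (elim patterns_0_E)
    have "u @ [Some ()] @ v \<in> patterns 0" "u @ replicate k (Some ()) @ v \<in> patterns 0"
      by (simp_all add: uv patterns_iff)
    from q_in[OF this(1)] q_in[OF this(2)]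
    show "(?q \<cdot> ?in0 (u @ [Some ()] @ v))
        \<cdot> otensA (ids (factors0 A u Xs1) @ [\<alpha> k] @ ids (factors0 A v Xs2))
      = (?q \<cdot> ?in0 (u @ replicate k (Some ()) @ v))
        \<cdot> ograft (factors0 A u Xs1) (replicate k A) (factors0 A v Xs2)"
      using \<alpha>_graft[of m k n] by (simp add: uv e add_ac del: factors0_append)
  qed
  have "is_coequalizer C (ealg []) (eop []) ?q"
    unfolding is_coequalizer_def
  proof (intro conjI ballI impI)
    show "?q \<cdot> ealg [] = ?q \<cdot> eop []"
      using coequalizes_iff_balanced[OF Nil q] bal by simp
    fix h assume harr: "h \<in> Arr C"
      and hh: "Dom C h = Cod C (ealg []) \<and> h \<cdot> ealg [] = h \<cdot> eop []"
    then have hd [simp]: "Dom C h = ?c0" and h_arr [simp]: "h \<in> Arr C" by simp_all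
    have hbal: "balanced [] (\<lambda>w. h \<cdot> ?in0 w)"
      using coequalizes_iff_balanced[OF Nil, of h "Cod C h"] hh by (simp add: hom_def)
    \<comment> \<open>The operad unit splits the structure maps of \<open>A\<close>.\<close>
    define k where "k = (h \<cdot> ?in0 [Some ()]) \<cdot> ounit A"
    have [simp]: "?in0 [Some ()] \<in> Arr C" "Dom C (?in0 [Some ()]) = otens [A]"
      "Cod C (?in0 [Some ()]) = ?c0"
      using env0_arr(2-4)[OF Nil, of "[Some ()]"] by simp_all
    have k [simp]: "k \<in> Arr C" "Dom C k = A" "Cod C k = Cod C h"
      by (simp_all add: k_def)
    have k_q: "k \<cdot> \<alpha> n = h \<cdot> ?in0 (replicate n (Some ()))" for n
    proof -
      have [simp]: "?in0 (replicate n (Some ())) \<in> Arr C"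
        "Dom C (?in0 (replicate n (Some ()))) = otens (replicate n A)"
        "Cod C (?in0 (replicate n (Some ()))) = ?c0"
        using env0_arr(2-4)[OF Nil, of "replicate n (Some ())"] by simp_all
      have rel: "(h \<cdot> ?in0 [Some ()]) \<cdot> otensA [\<alpha> n]
          = (h \<cdot> ?in0 (replicate n (Some ()))) \<cdot> ograft [] (replicate n A) []"
        using balancedD[of "[]" "[]" "\<lambda>w. h \<cdot> ?in0 w" "[]" "[]" n] hbal by (simp add: patterns_iff)
      have "k \<cdot> \<alpha> n = (h \<cdot> ?in0 [Some ()]) \<cdot> (ounit A \<cdot> \<alpha> n)"
        by (simp add: k_def)
      also have "\<dots> = (h \<cdot> ?in0 [Some ()]) \<cdot> (otensA [\<alpha> n] \<cdot> ounit (otens (replicate n A)))"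
        using opunit_nat[of "\<alpha> n"] by simp
      also have "\<dots> = ((h \<cdot> ?in0 (replicate n (Some ()))) \<cdot> ograft [] (replicate n A) [])
          \<cdot> ounit (otens (replicate n A))"
        by (rule Comp_eq_extend[OF rel]) simp_all
      also have "\<dots> = (h \<cdot> ?in0 (replicate n (Some ()))) \<cdot> (ograft [] (replicate n A) []
          \<cdot> ounit (otens (replicate n A)))"
        by (rule assoc_simp) simp_all
      also have "\<dots> = h \<cdot> ?in0 (replicate n (Some ()))"
        by (simp add: graft_left_unit)
      finally show ?thesis .
    qed
    show "\<exists>!k. k \<in> hom C (Cod C ?q) (Cod C h) \<and> k \<cdot> ?q = h"
    proof (rule ex1I[of _ k])
      have "k \<cdot> ?q = h"
      proof (rule coprod_ext[OF cop])
        fix w :: "unit option list" assume wp: "w \<in> patterns 0"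
        then obtain n where wn: "w = replicate n (Some ())"
          by (auto elim: patterns_0_E)
        have [simp]: "?in0 w \<in> Arr C" "Cod C (?in0 w) = ?c0"
          using env0_arr(2-4)[OF Nil, of w] wp by (simp_all add: patterns_iff)
        have "(k \<cdot> ?q) \<cdot> ?in0 w = k \<cdot> (?q \<cdot> ?in0 w)"
          by simp
        then have "(k \<cdot> ?q) \<cdot> ?in0 w = h \<cdot> ?in0 w"
          unfolding q_in[OF wp] using k_q[of n] wn by simp
        then show "(k \<cdot> ?q) \<cdot> snd (coprod C (patterns 0) (\<lambda>w. otens (factors0 A w []))) w
            = h \<cdot> snd (coprod C (patterns 0) (\<lambda>w. otens (factors0 A w []))) w"
          by (simp add: env0_def)
      qed (use homD[OF q] in \<open>simp_all add: hom_def env0_def\<close>)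
      then show "k \<in> hom C (Cod C ?q) (Cod C h) \<and> k \<cdot> ?q = h"
        by (simp add: hom_def)
      fix k' assume k': "k' \<in> hom C (Cod C ?q) (Cod C h) \<and> k' \<cdot> ?q = h"
      then have [simp]: "k' \<in> Arr C" "Dom C k' = A" "Cod C k' = Cod C h"
        by (auto simp: hom_def)
      have "k = ((k' \<cdot> ?q) \<cdot> ?in0 [Some ()]) \<cdot> ounit A"
        using k' by (simp add: k_def)
      also have "\<dots> = k' \<cdot> ((?q \<cdot> ?in0 [Some ()]) \<cdot> ounit A)"
        by simp
      also have "?q \<cdot> ?in0 [Some ()] = \<alpha> (Suc 0)"
        using q_in[of "[Some ()]"] by (simp add: patterns_iff)
      finally show "k' = k" by simp
    qed
  qed (simp_all add: hom_def)
  moreover have "\<forall>w\<in>patterns 0. ?q \<cdot> ?in0 w = \<alpha> (length w)"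
    using q_in by simp
  ultimately show ?thesis
    using homD(3)[OF q] by blast
qed

lemma env_coeq:
  assumes Xs: "set Xs \<subseteq> Obj C"
  shows "is_coequalizer C (ealg Xs) (eop Xs) (ecoeq Xs)"
    and "Xs = [] \<Longrightarrow> Cod C (ecoeq Xs) = A"
    and "Xs = [] \<Longrightarrow> w \<in> patterns 0 \<Longrightarrow> ecoeq Xs \<cdot> snd (env0A []) w = \<alpha> (length w)"
proof -
  have "\<exists>q. is_coequalizer C (ealg Xs) (eop Xs) q \<and>
      (Xs = [] \<longrightarrow> Cod C q = fst Aa \<and>
        (\<forall>w\<in>patterns 0. q \<cdot> snd (env0 C z P (fst Aa) []) w = snd Aa (length w)))"
  proof (cases "Xs = []")
    case True
    then show ?thesis using arity_0_coequalizer by simp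
  next
    case False
    have "\<exists>q. is_coequalizer C (ealg Xs) (eop Xs) q"
      using env_alg(1)[OF Xs] env_op(1)[OF Xs] by (intro coequalizer) (simp_all add: hom_def)
    with False show ?thesis by simp
  qed
  then have *: "is_coequalizer C (ealg Xs) (eop Xs) (ecoeq Xs) \<and>
      (Xs = [] \<longrightarrow> Cod C (ecoeq Xs) = fst Aa \<and>
        (\<forall>w\<in>patterns 0. ecoeq Xs \<cdot> snd (env0 C z P (fst Aa) []) w = snd Aa (length w)))"
    unfolding env_coeq_def by (rule someI_ex)
  show "is_coequalizer C (ealg Xs) (eop Xs) (ecoeq Xs)"
    and "Xs = [] \<Longrightarrow> Cod C (ecoeq Xs) = A"
    and "Xs = [] \<Longrightarrow> w \<in> patterns 0 \<Longrightarrow> ecoeq Xs \<cdot> snd (env0A []) w = \<alpha> (length w)"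
    using * by simp_all
qed

lemma env_coeq_arr:
  assumes Xs: "set Xs \<subseteq> Obj C"
  shows "ecoeq Xs \<in> hom C (fst (env0A Xs)) (eob Xs)"
  using coequalizerD(1,2)[OF env_coeq(1)[OF Xs]] homD[OF env_alg(1)[OF Xs]]
  by (simp add: hom_def env_ob_def)

lemma env_ob_Obj [simp]: "set Xs \<subseteq> Obj C \<Longrightarrow> eob Xs \<in> Obj C"
  using env_coeq_arr Obj_of_hom(2) by blast

lemma env_ob_Nil [simp]: "eob [] = A"
  using env_coeq(2)[of "[]"] by (simp add: env_ob_def)

lemma env_in_Nil: "w \<in> patterns 0 \<Longrightarrow> ein w [] = \<alpha> (length w)"
  using env_coeq(3)[of "[]" w] by (simp add: env_in_def)

lemma env_in_arr [simp]:
  assumes Xs: "set Xs \<subseteq> Obj C" "fits w Xs"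
  shows "ein w Xs \<in> Arr C" "Dom C (ein w Xs) = otens (factors0 A w Xs)"
    "Cod C (ein w Xs) = eob Xs"
  using env_coeq_arr[OF Xs(1)] env0_arr[OF Xs(1)] Xs(2) by (simp_all add: env_in_def hom_def)

lemma env_in_balanced:
  assumes Xs: "set Xs \<subseteq> Obj C"
  shows "balanced Xs (\<lambda>w. ein w Xs)"
proof -
  have "ecoeq Xs \<cdot> ealg Xs = ecoeq Xs \<cdot> eop Xs"
    using env_coeq(1)[OF Xs] by (rule coequalizerD(3))
  then show ?thesis
    using coequalizes_iff_balanced[OF Xs env_coeq_arr[OF Xs]] by (simp add: env_in_def)
qed

lemma env_ext:
  assumes Xs: "set Xs \<subseteq> Obj C"
    and a: "a \<in> hom C (eob Xs) T" and b: "b \<in> hom C (eob Xs) T"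
    and eq: "\<And>w. w \<in> patterns (length Xs) \<Longrightarrow> a \<cdot> ein w Xs = b \<cdot> ein w Xs"
  shows "a = b"
proof -
  let ?q = "ecoeq Xs"
  note [simp] = Xs homD[OF a] homD[OF b] homD[OF env_coeq_arr[OF Xs]] homD[OF env_alg(1)[OF Xs]]
    homD[OF env_op(1)[OF Xs]]
  have "a \<cdot> ?q = b \<cdot> ?q"
  proof (rule coprod_ext[OF env0_is_coproduct[OF Xs], folded env0_def])
    show "(a \<cdot> ?q) \<cdot> snd (env0A Xs) w = (b \<cdot> ?q) \<cdot> snd (env0A Xs) w"
      if "w \<in> patterns (length Xs)" for w
      using eq[OF that] that by (simp add: env_in_def patterns_iff)
  qed (simp_all add: hom_def)
  have q_eq: "?q \<cdot> ealg Xs = ?q \<cdot> eop Xs"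
    using env_coeq(1)[OF Xs] by (rule coequalizerD(3))
  then have "(b \<cdot> ?q) \<cdot> ealg Xs = (b \<cdot> ?q) \<cdot> eop Xs"
    by simp
  then have "\<exists>!k. k \<in> hom C (Cod C ?q) (Cod C (b \<cdot> ?q)) \<and> k \<cdot> ?q = b \<cdot> ?q"
    by (rule coequalizer_universal[OF env_coeq(1)[OF Xs], rotated 2]) simp_all
  then show "a = b"
    by (rule ex1_unique) (use \<open>a \<cdot> ?q = b \<cdot> ?q\<close> in \<open>simp_all add: hom_def\<close>)
qed

text \<open>Existence in the universal property of \<open>P\<^sub>A(n)(X\<^sub>1, \<dots>, X\<^sub>n)\<close>; \<open>env_ext\<close> is uniqueness.\<close>
theorem env_universal:
  assumes Xs: "set Xs \<subseteq> Obj C" and T: "T \<in> Obj C" and coc: "cocone Xs T H" and bal: "balanced Xs H"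
  obtains k where "k \<in> hom C (eob Xs) T"
    "\<And>w. w \<in> patterns (length Xs) \<Longrightarrow> k \<cdot> ein w Xs = H w"
proof -
  let ?q = "ecoeq Xs"
  let ?h = "copair C (patterns (length Xs)) (\<lambda>w. otens (factors0 A w Xs)) T H"
  have H: "\<And>w. w \<in> patterns (length Xs) \<Longrightarrow> H w \<in> hom C (otens (factors0 A w Xs)) T"
    using coc by (simp add: cocone_def)
  have h: "?h \<in> hom C (fst (env0A Xs)) T"
    using copair(1)[OF env0_is_coproduct[OF Xs] T H] by (simp add: env0_def)
  have h_in: "?h \<cdot> snd (env0A Xs) w = H w" if "w \<in> patterns (length Xs)" for w
    using copair(2)[OF env0_is_coproduct[OF Xs] T H that] by (simp add: env0_def)
  note [simp] = Xs homD[OF h] homD[OF env_coeq_arr[OF Xs]] homD[OF env_alg(1)[OF Xs]]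
    homD[OF env_op(1)[OF Xs]]
  have "balanced Xs (\<lambda>w. ?h \<cdot> snd (env0A Xs) w)"
    unfolding balanced_def
  proof (intro allI impI)
    fix Xs1 Xs2 :: "'oc list" and u v :: "unit option list" and k
    assume X: "Xs = Xs1 @ Xs2" "u \<in> patterns (length Xs1)" "v \<in> patterns (length Xs2)"
    then have "u @ [Some ()] @ v \<in> patterns (length Xs)" "u @ replicate k (Some ()) @ v \<in> patterns (length Xs)"
      by (simp_all add: patterns_iff)
    then show "?h \<cdot> snd (env0A Xs) (u @ [Some ()] @ v)
        \<cdot> otensA (ids (factors0 A u Xs1) @ [\<alpha> k] @ ids (factors0 A v Xs2))
      = ?h \<cdot> snd (env0A Xs) (u @ replicate k (Some ()) @ v)
        \<cdot> ograft (factors0 A u Xs1) (replicate k A) (factors0 A v Xs2)"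
      using balancedD[OF bal[unfolded X(1)] X(2,3)] h_in by (simp only:)
  qed
  then have heq: "?h \<cdot> ealg Xs = ?h \<cdot> eop Xs"
    using coequalizes_iff_balanced[OF Xs h] by simp
  have "\<exists>!k. k \<in> hom C (Cod C ?q) (Cod C ?h) \<and> k \<cdot> ?q = ?h"
    by (rule coequalizer_universal[OF env_coeq(1)[OF Xs] _ _ heq]) simp_all
  from ex1_implies_ex[OF this] obtain k where "k \<in> hom C (Cod C ?q) (Cod C ?h) \<and> k \<cdot> ?q = ?h"
    by (rule exE)
  then have k: "k \<in> hom C (eob Xs) T" "k \<cdot> ?q = ?h"
    by simp_all
  note [simp] = homD[OF k(1)]
  have "k \<cdot> ein w Xs = H w" if "w \<in> patterns (length Xs)" for w
  proof -
    have "k \<cdot> ein w Xs = (k \<cdot> ?q) \<cdot> snd (env0A Xs) w"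
      using that by (simp add: env_in_def patterns_iff)
    then show ?thesis
      using h_in[OF that] k(2) by simp
  qed
  then show thesis by (rule that[OF k(1)])
qed

end

section \<open>The enveloping functors and nullary composition\<close>

text \<open>Distinguished letters are counted from \<open>0\<close>; the \<open>n\<close>-th becomes an ordinary letter \<open>A\<close>.\<close>
fun plug :: "nat \<Rightarrow> unit option list \<Rightarrow> unit option list" where
  "plug n [] = []"
| "plug 0 (None # w) = Some () # w"
| "plug (Suc n) (None # w) = None # plug n w"
| "plug n (Some a # w) = Some a # plug n w"

lemma plug_append [simp]: "count_list u None = n \<Longrightarrow> plug n (u @ None # v) = u @ Some () # v"
proof (induction u arbitrary: n)
  case (Cons a u)
  then show ?case by (cases a) auto
qed simp

context operad_algebra
begin

text \<open>Arrows at the distinguished letters commute with the structure maps at the other letters and, by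
  naturality, with grafting. Hence they preserve the one-letter relations.\<close>
lemma env_arr_exists:
  assumes fs: "set fs \<subseteq> Arr C"
  defines "Xs \<equiv> doms fs" and "Ys \<equiv> cods fs"
  obtains h where "h \<in> hom C (eob Xs) (eob Ys)"
    "\<And>w. w \<in> patterns (length Xs) \<Longrightarrow> h \<cdot> ein w Xs
       = ein w Ys \<cdot> otensA (factors0 (Ide C A) w fs)"
proof -
  let ?H = "\<lambda>w. ein w Ys \<cdot> otensA (factors0 (Ide C A) w fs)"
  have Xs: "set Xs \<subseteq> Obj C" and Ys: "set Ys \<subseteq> Obj C" and len [simp]: "length Xs = length fs" "length Ys = length fs"
    using fs by (simp_all add: Xs_def Ys_def)
  have coc: "cocone Xs (eob Ys) ?H"
    using fs Ys by (simp add: cocone_def patterns_iff hom_def Xs_def Ys_def)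
  have bal: "balanced Xs ?H"
    unfolding balanced_def
  proof (intro allI impI)
    fix Xs1 Xs2 :: "'oc list" and u v :: "unit option list" and k
    assume X: "Xs = Xs1 @ Xs2" and u: "u \<in> patterns (length Xs1)" and v: "v \<in> patterns (length Xs2)"
    define fs1 where "fs1 = take (length Xs1) fs"
    define fs2 where "fs2 = drop (length Xs1) fs"
    have fs12: "fs = fs1 @ fs2"
      by (simp add: fs1_def fs2_def)
    have [simp]: "set fs1 \<subseteq> Arr C" "set fs2 \<subseteq> Arr C"
      using fs fs12 by auto
    have "length Xs1 \<le> length fs"
      using arg_cong[OF X, of length] by simp
    then have len1: "length fs1 = length Xs1"
      by (simp add: fs1_def)
    then have Xs12: "Xs1 = doms fs1" "Xs2 = doms fs2"
      using X unfolding Xs_def fs12 by (auto simp: append_eq_append_conv)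
    define Ys1 where "Ys1 = cods fs1"
    define Ys2 where "Ys2 = cods fs2"
    have Ys12: "Ys = Ys1 @ Ys2"
      by (simp add: Ys_def Ys1_def Ys2_def fs12)
    have [simp]: "doms fs1 = Xs1" "doms fs2 = Xs2" "cods fs1 = Ys1" "cods fs2 = Ys2"
      "length fs1 = length Xs1" "length fs2 = length Xs2" "length Ys1 = length Xs1" "length Ys2 = length Xs2"
      using Xs12 by (simp_all add: Ys1_def Ys2_def)
    have [simp]: "set Xs1 \<subseteq> Obj C" "set Xs2 \<subseteq> Obj C" "set Ys1 \<subseteq> Obj C" "set Ys2 \<subseteq> Obj C"
      using Xs Ys X Ys12 by auto
    have [simp]: "fits u Xs1" "fits v Xs2"
      using u v by (simp_all add: patterns_iff)
    let ?fu = "factors0 (Ide C A) u fs1" and ?fv = "factors0 (Ide C A) v fs2"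
    let ?K = "replicate k A" and ?S = "replicate k (Some ())"
    let ?a = "otensA (ids (factors0 A u Xs1) @ [\<alpha> k] @ ids (factors0 A v Xs2))"
    let ?a' = "otensA (ids (factors0 A u Ys1) @ [\<alpha> k] @ ids (factors0 A v Ys2))"
    let ?f = "otensA (?fu @ [Ide C (otens ?K)] @ ?fv)"
    have ex: "otensA (?fu @ [Ide C A] @ ?fv) \<cdot> ?a = ?a' \<cdot> ?f"
      using optensA_exchange[of ?fu ?fv "\<alpha> k"] by simp
    have rel: "ein (u @ [Some ()] @ v) (Ys1 @ Ys2) \<cdot> ?a'
        = ein (u @ ?S @ v) (Ys1 @ Ys2)
          \<cdot> ograft (factors0 A u Ys1) ?K (factors0 A v Ys2)"
      using balancedD[OF env_in_balanced[OF Ys, unfolded Ys12], of u v k] by (simp add: patterns_iff)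
    have nat: "ograft (factors0 A u Ys1) ?K (factors0 A v Ys2) \<cdot> ?f
        = otensA (?fu @ ids ?K @ ?fv) \<cdot> ograft (factors0 A u Xs1) ?K (factors0 A v Xs2)"
      using graft_nat[of ?fu "ids ?K" ?fv] by simp
    have "?H (u @ [Some ()] @ v) \<cdot> ?a
        = ein (u @ [Some ()] @ v) (Ys1 @ Ys2) \<cdot> (otensA (?fu @ [Ide C A] @ ?fv) \<cdot> ?a)"
      by (simp add: Ys12 fs12)
    also have "\<dots> = ein (u @ [Some ()] @ v) (Ys1 @ Ys2) \<cdot> (?a' \<cdot> ?f)"
      unfolding ex ..
    also have "\<dots> = ein (u @ ?S @ v) (Ys1 @ Ys2)
          \<cdot> (ograft (factors0 A u Ys1) ?K (factors0 A v Ys2) \<cdot> ?f)"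
      using Comp_eq_extend[OF rel, of ?f] by simp
    also have "\<dots> = ?H (u @ ?S @ v) \<cdot> ograft (factors0 A u Xs1) ?K (factors0 A v Xs2)"
      unfolding nat by (simp add: Ys12 fs12)
    finally show "?H (u @ [Some ()] @ v) \<cdot> ?a
        = ?H (u @ ?S @ v) \<cdot> ograft (factors0 A u Xs1) ?K (factors0 A v Xs2)" .
  qed
  show thesis
    by (rule env_universal[OF Xs env_ob_Obj[OF Ys] coc bal]) (rule that)
qed

lemma env_arr:
  assumes fs: "set fs \<subseteq> Arr C"
  shows "earr fs \<in> hom C (eob (doms fs)) (eob (cods fs))"
    and "w \<in> patterns (length fs) \<Longrightarrow> earr fs \<cdot> ein w (doms fs)
       = ein w (cods fs) \<cdot> otensA (factors0 (Ide C A) w fs)"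
proof -
  let ?Xs = "doms fs" and ?Ys = "cods fs"
  let ?Q = "\<lambda>h. h \<in> hom C (eob ?Xs) (eob ?Ys) \<and>
    (\<forall>w\<in>patterns (length fs). h \<cdot> ein w ?Xs
       = ein w ?Ys \<cdot> otensA (factors0 (Ide C A) w fs))"
  obtain h where h: "?Q h"
    using env_arr_exists[OF fs] by (metis length_map)
  have the: "?Q (THE h. ?Q h)"
  proof (rule theI[of ?Q, OF h])
    fix k assume k: "?Q k"
    show "k = h"
    proof (rule env_ext)
      show "k \<cdot> ein w ?Xs = h \<cdot> ein w ?Xs" if "w \<in> patterns (length ?Xs)" for w
        using k h that by simp
    qed (use k h fs in auto)
  qed
  have eq: "earr fs = (THE h. ?Q h)"
    by (simp add: env_arr_def Let_def factors0_def)
  have "?Q (earr fs)"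
    unfolding eq by (rule the)
  then show "earr fs \<in> hom C (eob (doms fs)) (eob (cods fs))"
    and "w \<in> patterns (length fs) \<Longrightarrow> earr fs \<cdot> ein w (doms fs)
       = ein w (cods fs) \<cdot> otensA (factors0 (Ide C A) w fs)"
    by blast+
qed

lemma env_arr_arr [simp]:
  assumes "set fs \<subseteq> Arr C"
  shows "earr fs \<in> Arr C" "Dom C (earr fs) = eob (doms fs)"
    "Cod C (earr fs) = eob (cods fs)"
  using homD[OF env_arr(1)[OF assms]] by blast+

lemma env_arr_Ide [simp]:
  assumes Xs: "set Xs \<subseteq> Obj C"
  shows "earr (ids Xs) = Ide C (eob Xs)"
proof (rule env_ext[OF Xs])
  fix w :: "unit option list"
  assume "w \<in> patterns (length Xs)"
  then show "earr (ids Xs) \<cdot> ein w Xs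
      = Ide C (eob Xs) \<cdot> ein w Xs"
    using env_arr(2)[of "ids Xs" w] Xs by (simp add: patterns_iff)
qed (use Xs in \<open>simp_all add: hom_def\<close>)

lemma factors0_composable:
  assumes "composable gs fs"
    and "fits w fs"
  shows "composable
      (factors0 (Ide C A) w gs) (factors0 (Ide C A) w fs)"
    and "map2 (\<cdot>) (factors0 (Ide C A) w gs) (factors0 (Ide C A) w fs) = factors0 (Ide C A) w (map2 (\<cdot>) gs fs)"
proof -
  have "composable
      (factors0 (Ide C A) w gs) (factors0 (Ide C A) w fs) \<and>
    map2 (\<cdot>) (factors0 (Ide C A) w gs) (factors0 (Ide C A) w fs) = factors0 (Ide C A) w (map2 (\<cdot>) gs fs)"
    using assms
  proof (induction w arbitrary: gs fs)
    case (Cons a w)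
    show ?case
    proof (cases a)
      case None
      with Cons.prems(2) obtain f fs' where fs: "fs = f # fs'" "fits w fs'"
        by (cases fs) auto
      with Cons.prems(1) obtain g gs' where gs: "gs = g # gs'"
        by (cases gs) auto
      show ?thesis
        using Cons.IH[of gs' fs'] Cons.prems None fs gs by simp
    next
      case (Some b)
      then show ?thesis
        using Cons.IH[of gs fs] Cons.prems by simp
    qed
  qed simp
  then show "composable
      (factors0 (Ide C A) w gs) (factors0 (Ide C A) w fs)"
    and "map2 (\<cdot>) (factors0 (Ide C A) w gs) (factors0 (Ide C A) w fs) = factors0 (Ide C A) w (map2 (\<cdot>) gs fs)"
    by blast+
qed

lemma env_arr_Comp:
  assumes comp: "composable gs fs"
  shows "earr gs \<cdot> earr fs = earr (map2 (\<cdot>) gs fs)"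
proof -
  have gf: "set gs \<subseteq> Arr C" "set fs \<subseteq> Arr C" "set (map2 (\<cdot>) gs fs) \<subseteq> Arr C"
    "doms gs = cods fs" "doms (map2 (\<cdot>) gs fs) = doms fs"
    "cods (map2 (\<cdot>) gs fs) = cods gs" "length gs = length fs"
    using comp by (induction rule: list_all2_induct) auto
  note [simp] = gf(1,2,4,7)
  have c [simp]: "earr (map2 (\<cdot>) gs fs) \<in> Arr C"
    "Dom C (earr (map2 (\<cdot>) gs fs)) = eob (doms fs)"
    "Cod C (earr (map2 (\<cdot>) gs fs)) = eob (cods gs)"
    using env_arr_arr[OF gf(3)] gf(5,6) by simp_all
  show ?thesis
  proof (rule env_ext[of "doms fs"])
    fix w :: "unit option list"
    assume w: "w \<in> patterns (length (doms fs))"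
    have [simp]: "fits w fs"
      using w by (simp add: patterns_iff)
    have 1: "earr fs \<cdot> ein w (doms fs)
        = ein w (cods fs) \<cdot> otensA (factors0 (Ide C A) w fs)"
      using env_arr(2)[of fs w] w by simp
    have 2: "earr gs \<cdot> ein w (cods fs)
        = ein w (cods gs) \<cdot> otensA (factors0 (Ide C A) w gs)"
      using env_arr(2)[of gs w] w by simp
    have 3: "earr (map2 (\<cdot>) gs fs) \<cdot> ein w (doms fs)
        = ein w (cods gs) \<cdot> otensA (factors0 (Ide C A) w (map2 (\<cdot>) gs fs))"
      using env_arr(2)[OF gf(3), of w] w gf(5,6) by simp
    have 4: "otensA (factors0 (Ide C A) w gs) \<cdot> otensA (factors0 (Ide C A) w fs)
        = otensA (factors0 (Ide C A) w (map2 (\<cdot>) gs fs))"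
      by (simp add: optensA_Comp factors0_composable[OF comp])
    have "(earr gs \<cdot> earr fs) \<cdot> ein w (doms fs)
        = earr gs \<cdot> (ein w (cods fs) \<cdot> otensA (factors0 (Ide C A) w fs))"
      by (simp add: 1)
    also have "\<dots> = ein w (cods gs) \<cdot> (otensA (factors0 (Ide C A) w gs)
        \<cdot> otensA (factors0 (Ide C A) w fs))"
      using Comp_eq_extend[OF 2, of "otensA (factors0 (Ide C A) w fs)"] by simp
    finally show "(earr gs \<cdot> earr fs) \<cdot> ein w (doms fs)
        = earr (map2 (\<cdot>) gs fs) \<cdot> ein w (doms fs)"
      by (simp only: 3 4)
  qed (simp_all add: hom_def)
qed

lemma env_arr_after:
  assumes "set xs \<subseteq> Arr C" "set zs \<subseteq> Arr C" "a \<in> Arr C" "b \<in> Arr C" "Dom C a = Cod C b"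
  shows "earr (ids (cods xs) @ [a] @ ids (cods zs))
      \<cdot> earr (xs @ [b] @ zs) = earr (xs @ [a \<cdot> b] @ zs)"
  using assms composable_Ide[OF assms(1)] composable_Ide[OF assms(2)]
  by (subst env_arr_Comp) (simp_all add: list_all2_appendI)

lemma env_arr_before:
  assumes "set xs \<subseteq> Arr C" "set zs \<subseteq> Arr C" "a \<in> Arr C" "b \<in> Arr C" "Dom C a = Cod C b"
  shows "earr (xs @ [a] @ zs)
      \<cdot> earr (ids (doms xs) @ [b] @ ids (doms zs))
    = earr (xs @ [a \<cdot> b] @ zs)"
  using assms composable_Ide[OF assms(1)] composable_Ide[OF assms(2)]
  by (subst env_arr_Comp) (simp_all add: list_all2_appendI)

text \<open>Forgetting that the letter \<open>A\<close> after \<open>Xs\<close> is distinguished does not change the underlying tensor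
  product, and every one-letter relation over \<open>Xs @ [A] @ Zs\<close> is one over \<open>Xs @ Zs\<close>. The letter of
  the relation stands either before or after the distinguished \<open>A\<close>, which gives two cases.\<close>
lemma env_plug_exists:
  assumes Xs: "set Xs \<subseteq> Obj C" and Zs: "set Zs \<subseteq> Obj C"
  obtains h where "h \<in> hom C (eob (Xs @ [A] @ Zs)) (eob (Xs @ Zs))"
    "\<And>u v. u \<in> patterns (length Xs) \<Longrightarrow> v \<in> patterns (length Zs) \<Longrightarrow>
       h \<cdot> ein (u @ [None] @ v) (Xs @ [A] @ Zs) = ein (u @ [Some ()] @ v) (Xs @ Zs)"
proof -
  let ?H = "\<lambda>w. ein (plug (length Xs) w) (Xs @ Zs)"
  note [simp] = Xs Zs
  have XAZ: "set (Xs @ [A] @ Zs) \<subseteq> Obj C" and XZ: "set (Xs @ Zs) \<subseteq> Obj C"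
    by simp_all
  have coc: "cocone (Xs @ [A] @ Zs) (eob (Xs @ Zs)) ?H"
    unfolding cocone_def
  proof
    fix w :: "unit option list"
    assume w: "w \<in> patterns (length (Xs @ [A] @ Zs))"
    obtain u v where "w = u @ None # v" "u \<in> patterns (length Xs)"
      "v \<in> patterns (length (Xs @ [A] @ Zs) - Suc (length Xs))"
      using w by (rule pattern_split[where i = "length Xs"]) simp
    then show "?H w \<in> hom C (otens (factors0 A w (Xs @ [A] @ Zs))) (eob (Xs @ Zs))"
      by (simp add: patterns_iff hom_def)
  qed
  have bal: "balanced (Xs @ [A] @ Zs) ?H"
    unfolding balanced_def
  proof (intro allI impI)
    fix Xs1 Xs2 :: "'oc list" and u v :: "unit option list" and k
    assume X: "Xs @ [A] @ Zs = Xs1 @ Xs2" and u: "u \<in> patterns (length Xs1)" and v: "v \<in> patterns (length Xs2)"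
    let ?S = "replicate k (Some ())"
    show "?H (u @ [Some ()] @ v) \<cdot> otensA (ids (factors0 A u Xs1) @ [\<alpha> k] @ ids (factors0 A v Xs2))
      = ?H (u @ ?S @ v) \<cdot> ograft (factors0 A u Xs1) (replicate k A) (factors0 A v Xs2)"
    proof (cases "length Xs1 \<le> length Xs")
      case True
      define Xs' where "Xs' = drop (length Xs1) Xs"
      have XX: "Xs = Xs1 @ Xs'" "Xs2 = Xs' @ [A] @ Zs"
        using arg_cong[OF X, of "take (length Xs1)"] arg_cong[OF X, of "drop (length Xs1)"] True
          append_take_drop_id[of "length Xs1" Xs]
        by (simp_all add: Xs'_def del: append_take_drop_id)
      obtain v1 v2 where vv: "v = v1 @ None # v2" "v1 \<in> patterns (length Xs')"
        "v2 \<in> patterns (length Xs2 - Suc (length Xs'))"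
        using v by (rule pattern_split[where i = "length Xs'"]) (simp add: XX)
      have [simp]: "fits u Xs1" "fits v1 Xs'" "fits v2 Zs"
        using u vv XX by (simp_all add: patterns_iff)
      have p: "plug (length Xs) ((u @ [Some ()] @ v1) @ None # v2) = (u @ [Some ()] @ v1) @ Some () # v2"
        "plug (length Xs) ((u @ ?S @ v1) @ None # v2) = (u @ ?S @ v1) @ Some () # v2"
        by (rule plug_append, simp add: XX)+
      have "balanced (Xs1 @ (Xs' @ Zs)) (\<lambda>w. ein w (Xs1 @ (Xs' @ Zs)))"
        using env_in_balanced[OF XZ] by (simp add: XX)
      from balancedD[OF this, of u "v1 @ [Some ()] @ v2" k] show ?thesis
        using p by (simp add: vv XX patterns_iff)
    next
      case False
      define Zs' where "Zs' = drop (Suc (length Xs)) Xs1"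
      have XX: "Xs1 = Xs @ [A] @ Zs'" "Zs = Zs' @ Xs2"
        using arg_cong[OF X, of "take (length Xs)"] arg_cong[OF X, of "drop (length Xs)"] False
          append_take_drop_id[of "length Xs" Xs1] Cons_nth_drop_Suc[of "length Xs" Xs1]
        by (simp_all add: Zs'_def del: append_take_drop_id Cons_nth_drop_Suc)
          (metis append_Cons list.inject)+
      obtain u1 u2 where uu: "u = u1 @ None # u2" "u1 \<in> patterns (length Xs)"
        "u2 \<in> patterns (length Xs1 - Suc (length Xs))"
        using u by (rule pattern_split[where i = "length Xs"]) (simp add: XX)
      have [simp]: "fits v Xs2" "fits u1 Xs" "fits u2 Zs'"
        using v uu XX by (simp_all add: patterns_iff)
      have "balanced ((Xs @ Zs') @ Xs2) (\<lambda>w. ein w ((Xs @ Zs') @ Xs2))"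
        using env_in_balanced[OF XZ] by (simp add: XX)
      from balancedD[OF this, of "u1 @ [Some ()] @ u2" v k] show ?thesis
        by (simp add: uu XX patterns_iff)
    qed
  qed
  obtain h where h: "h \<in> hom C (eob (Xs @ [A] @ Zs)) (eob (Xs @ Zs))"
    "\<And>w. w \<in> patterns (length (Xs @ [A] @ Zs)) \<Longrightarrow> h \<cdot> ein w (Xs @ [A] @ Zs) = ?H w"
    by (rule env_universal[OF XAZ env_ob_Obj[OF XZ] coc bal], rule that)
  show thesis
  proof (rule that[OF h(1)])
    fix u v :: "unit option list"
    assume "u \<in> patterns (length Xs)" "v \<in> patterns (length Zs)"
    then show "h \<cdot> ein (u @ [None] @ v) (Xs @ [A] @ Zs) = ein (u @ [Some ()] @ v) (Xs @ Zs)"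
      using h(2)[of "u @ [None] @ v"] by (simp add: patterns_iff)
  qed
qed

lemma env_ext_plugged:
  assumes Xs: "set Xs \<subseteq> Obj C" and Zs: "set Zs \<subseteq> Obj C" and B: "B \<in> Obj C"
    and a: "a \<in> hom C (eob (Xs @ [B] @ Zs)) T" and b: "b \<in> hom C (eob (Xs @ [B] @ Zs)) T"
    and eq: "\<And>u v. u \<in> patterns (length Xs) \<Longrightarrow> v \<in> patterns (length Zs) \<Longrightarrow>
      a \<cdot> ein (u @ [None] @ v) (Xs @ [B] @ Zs) = b \<cdot> ein (u @ [None] @ v) (Xs @ [B] @ Zs)"
  shows "a = b"
proof (rule env_ext[OF _ a b])
  fix w :: "unit option list"
  assume w: "w \<in> patterns (length (Xs @ [B] @ Zs))"
  obtain u v where uv: "w = u @ None # v" "u \<in> patterns (length Xs)"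
    "v \<in> patterns (length (Xs @ [B] @ Zs) - Suc (length Xs))"
    using w by (rule pattern_split[where i = "length Xs"]) simp
  then show "a \<cdot> ein w (Xs @ [B] @ Zs) = b \<cdot> ein w (Xs @ [B] @ Zs)"
    using eq[of u v] by simp
qed (use Xs Zs B in simp)

text \<open>The defining condition of a nullary composition involves all powers \<open>A\<^sup>k\<close> through the maps \<open>\<alpha> k\<close>. The
  forgetful map satisfies it because of the one-letter relations. The condition for \<open>k = 1\<close>,
  restricted along the unit of the operad, determines it.\<close>
lemma env_comp_nullary:
  assumes Xs: "set Xs \<subseteq> Obj C" and Zs: "set Zs \<subseteq> Obj C"
  shows "ecomp Xs [] Zs \<in> hom C (eob (Xs @ [A] @ Zs)) (eob (Xs @ Zs))"
    and "\<lbrakk>u \<in> patterns (length Xs); v \<in> patterns (length Zs)\<rbrakk> \<Longrightarrow>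
       ecomp Xs [] Zs \<cdot> ein (u @ [None] @ v) (Xs @ [A] @ Zs)
       = ein (u @ [Some ()] @ v) (Xs @ Zs)"
proof -
  note [simp] = Xs Zs
  have XZ: "set (Xs @ Zs) \<subseteq> Obj C" by simp
  let ?Q = "\<lambda>h. h \<in> hom C (eob (Xs @ [A] @ Zs)) (eob (Xs @ Zs)) \<and>
    (\<forall>u\<in>patterns (length Xs). \<forall>w\<in>patterns 0. \<forall>v\<in>patterns (length Zs).
       h \<cdot> ein (u @ [None] @ v) (Xs @ [A] @ Zs)
         \<cdot> otensA (ids (factors0 A u Xs) @ [ein w []] @ ids (factors0 A v Zs))
       = ein (u @ w @ v) (Xs @ Zs) \<cdot> ograft (factors0 A u Xs) (factors0 A w []) (factors0 A v Zs))"
  have eq: "ecomp Xs [] Zs = (THE h. ?Q h)"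
    by (simp add: env_comp_def Let_def)
  obtain h where h: "h \<in> hom C (eob (Xs @ [A] @ Zs)) (eob (Xs @ Zs))"
    and h_in: "\<And>u v. u \<in> patterns (length Xs) \<Longrightarrow> v \<in> patterns (length Zs) \<Longrightarrow>
       h \<cdot> ein (u @ [None] @ v) (Xs @ [A] @ Zs) = ein (u @ [Some ()] @ v) (Xs @ Zs)"
    by (rule env_plug_exists[OF Xs Zs], rule that)
  have "?Q h"
  proof (intro conjI ballI)
    fix u v w :: "unit option list"
    assume u: "u \<in> patterns (length Xs)" and w: "w \<in> patterns 0" and v: "v \<in> patterns (length Zs)"
    obtain k where k: "w = replicate k (Some ())"
      using w by (rule patterns_0_E)
    show "h \<cdot> ein (u @ [None] @ v) (Xs @ [A] @ Zs)
         \<cdot> otensA (ids (factors0 A u Xs) @ [ein w []] @ ids (factors0 A v Zs))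
       = ein (u @ w @ v) (Xs @ Zs) \<cdot> ograft (factors0 A u Xs) (factors0 A w []) (factors0 A v Zs)"
      using balancedD[OF env_in_balanced[OF XZ] u v, of k]
      unfolding h_in[OF u v] env_in_Nil[OF w] by (simp add: k)
  qed (rule h)
  moreover have "h' = h" if h': "?Q h'" for h'
  proof (rule env_ext_plugged[OF Xs Zs A_Obj _ h])
    fix u v :: "unit option list"
    assume u: "u \<in> patterns (length Xs)" and v: "v \<in> patterns (length Zs)"
    then have [simp]: "fits u Xs" "fits v Zs"
      by (simp_all add: patterns_iff)
    note [simp] = homD[OF conjunct1[OF h']]
    let ?u = "factors0 A u Xs" and ?v = "factors0 A v Zs"
    let ?e = "otensA (ids ?u @ [ounit A] @ ids ?v)"
    let ?i = "ein (u @ [None] @ v) (Xs @ [A] @ Zs)"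
    have w: "[Some ()] \<in> patterns 0"
      by (simp add: patterns_iff)
    have rel: "(h' \<cdot> ?i) \<cdot> otensA (ids ?u @ [\<alpha> (Suc 0)] @ ids ?v)
        = ein (u @ [Some ()] @ v) (Xs @ Zs) \<cdot> ograft ?u [A] ?v"
      using bspec[OF bspec[OF bspec[OF conjunct2[OF h'] u] w] v] unfolding env_in_Nil[OF w] by simp
    have "h' \<cdot> ?i = (h' \<cdot> ?i) \<cdot> (otensA (ids ?u @ [\<alpha> (Suc 0)] @ ids ?v) \<cdot> ?e)"
      using optensA_factor_Cod[of "ids ?u" "ids ?v" "\<alpha> (Suc 0)" "ounit A"]
        optensA_Ide[of "?u @ [A] @ ?v"] by simp
    also have "\<dots> = (ein (u @ [Some ()] @ v) (Xs @ Zs) \<cdot> ograft ?u [A] ?v) \<cdot> ?e"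
      by (rule Comp_eq_extend[OF rel]) simp_all
    also have "\<dots> = ein (u @ [Some ()] @ v) (Xs @ Zs) \<cdot> (ograft ?u [A] ?v \<cdot> ?e)"
      by (rule assoc_simp) simp_all
    also have "\<dots> = ein (u @ [Some ()] @ v) (Xs @ Zs)"
      by (subst graft_right_unit) simp_all
    finally show "h' \<cdot> ?i = h \<cdot> ?i"
      by (simp only: h_in[OF u v])
  qed (rule conjunct1[OF h'])
  ultimately have "ecomp Xs [] Zs = h"
    unfolding eq by (rule the_equality)
  then show "ecomp Xs [] Zs \<in> hom C (eob (Xs @ [A] @ Zs)) (eob (Xs @ Zs))"
    and "\<lbrakk>u \<in> patterns (length Xs); v \<in> patterns (length Zs)\<rbrakk> \<Longrightarrow>
       ecomp Xs [] Zs \<cdot> ein (u @ [None] @ v) (Xs @ [A] @ Zs)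
       = ein (u @ [Some ()] @ v) (Xs @ Zs)"
    using h h_in by simp_all
qed

end

section \<open>Latching objects of punctured cubes\<close>

text \<open>The maximal vertices of the punctured cube; coordinates are counted from \<open>0\<close>.\<close>
definition face :: "nat \<Rightarrow> nat \<Rightarrow> bool list" where
  "face t i = (replicate t True)[i := False]"

lemma length_face [simp]: "length (face t i) = t"
  by (simp add: face_def)

lemma face_nth: "k < t \<Longrightarrow> face t i ! k \<longleftrightarrow> k \<noteq> i"
  by (cases "i = k") (simp_all add: face_def)

lemma face_eq: "face (Suc (i + k)) i = replicate i True @ [False] @ replicate k True"
  by (rule nth_equalityI) (auto simp: face_nth nth_append nth_Cons')

lemma face_neq_top: "i < t \<Longrightarrow> face t i \<noteq> replicate t True"
  by (metis face_nth nth_replicate)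

lemma le_face: "length x = t \<Longrightarrow> \<not> x ! i \<Longrightarrow> list_all2 (\<le>) x (face t i)"
  by (auto simp: list_all2_conv_all_nth face_nth)

lemma le_top: "length x = t \<Longrightarrow> list_all2 (\<le>) x (replicate t True)"
  by (auto simp: list_all2_conv_all_nth)

lemma not_top: "length x = t \<Longrightarrow> x \<noteq> replicate t True \<Longrightarrow> \<exists>i<t. \<not> x ! i"
  by (metis length_replicate nth_equalityI nth_replicate)

lemma list_all2_le_trans: "list_all2 (\<le>) x y \<Longrightarrow> list_all2 (\<le>) y w \<Longrightarrow> list_all2 (\<le>) (x :: bool list) w"
  by (rule list_all2_trans[of "(\<le>)" "(\<le>)" "(\<le>)"]) auto

abbreviation punctured_cube :: "nat \<Rightarrow> (bool list, bool list \<times> bool list) category" where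
  "punctured_cube t \<equiv> full_subcat (cube t) (- {replicate t True})"

lemma punctured_cube_Obj: "x \<in> Obj (punctured_cube t) \<longleftrightarrow> length x = t \<and> x \<noteq> replicate t True"
  by (auto simp: full_subcat_def cube_def)

lemma punctured_cube_category: "category (punctured_cube t)"
proof (unfold_locales, goal_cases)
  case (4 f X Y g Z)
  then show ?case
    using list_all2_le_trans[of X Y Z]
    by (cases f; cases g) (simp add: full_subcat_def cube_def hom_def)
qed (auto simp: full_subcat_def cube_def hom_def list_all2_refl dest: list_all2_lengthD)

locale attaching = operad_algebra C V z P A \<alpha>
  for C :: "('oc, 'mc) monoidal" (structure) and V :: "('ov, 'mv) braided"
    and z :: "('ov, 'mv, 'oc, 'mc) central" and P :: "('ov, 'mv) operad"
    and A :: 'oc and \<alpha> :: "nat \<Rightarrow> 'mc" +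
  fixes Y Z :: 'oc and f gbar :: 'mc
  assumes f: "f \<in> hom C Y Z" and gbar: "gbar \<in> hom C Y A"
    and pushout: "\<And>a b. \<lbrakk>a \<in> Arr C; b \<in> Arr C; Dom C a = Dom C b\<rbrakk> \<Longrightarrow> \<exists>b' a'. is_pushout C a b b' a'"
    and cube_colimit: "\<And>(J :: (bool list, bool list \<times> bool list) category)
      (G :: (bool list, bool list \<times> bool list, 'oc, 'mc) func).
      \<lbrakk>category J; is_functor J C G\<rbrakk> \<Longrightarrow> \<exists>c \<iota>. is_colimit J C G c \<iota>"
begin

lemma f_arr [simp]: "f \<in> Arr C" "Dom C f = Y" "Cod C f = Z"
  using homD[OF f] by auto

lemma gbar_arr [simp]: "gbar \<in> Arr C" "Dom C gbar = Y" "Cod C gbar = A"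
  using homD[OF gbar] by auto

lemma YZ_Obj [simp]: "Y \<in> Obj C" "Z \<in> Obj C"
  using Obj_of_hom[OF f] by auto

definition Fcube :: "nat \<Rightarrow> (bool list, bool list \<times> bool list, 'oc, 'mc) func" where
  "Fcube t = cube_functor C (eob) (earr) (replicate t f)"

abbreviation vertex :: "bool list \<Rightarrow> 'oc" where
  "vertex x \<equiv> eob (map (edgeO C f) x)"

definition edge :: "bool list \<Rightarrow> bool list \<Rightarrow> 'mc" where
  "edge x y = earr (map (edgeA C f) (zip x y))"

lemma Fcube_FOb: "length x = t \<Longrightarrow> FOb (Fcube t) x = vertex x"
  by (simp add: Fcube_def cube_functor_def zip_replicate1 comp_def)

lemma Fcube_FArr: "length x = t \<Longrightarrow> length y = t \<Longrightarrow> FArr (Fcube t) (x, y) = edge x y"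
  by (simp add: Fcube_def cube_functor_def edge_def zip_replicate1 comp_def)

lemma edgeO_simps [simp]: "edgeO C f True = Z" "edgeO C f False = Y" "edgeO C f b \<in> Obj C"
  by (auto simp: edgeO_def)

lemma edgeA_simps [simp]:
  "edgeA C f (True, True) = Ide C Z" "edgeA C f (False, True) = f" "edgeA C f (False, False) = Ide C Y"
  by (auto simp: edgeA_def)

lemma edgeA_arr:
  "a \<le> b \<Longrightarrow> edgeA C f (a, b) \<in> Arr C" "a \<le> b \<Longrightarrow> Dom C (edgeA C f (a, b)) = edgeO C f a"
  "a \<le> b \<Longrightarrow> Cod C (edgeA C f (a, b)) = edgeO C f b"
  by (cases a; cases b; simp)+

lemma edges_arr:
  assumes "list_all2 (\<le>) x y"
  shows "set (map (edgeA C f) (zip x y)) \<subseteq> Arr C"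
    "doms (map (edgeA C f) (zip x y)) = map (edgeO C f) x"
    "cods (map (edgeA C f) (zip x y)) = map (edgeO C f) y"
proof -
  have "set (map (edgeA C f) (zip x y)) \<subseteq> Arr C \<and>
    doms (map (edgeA C f) (zip x y)) = map (edgeO C f) x \<and>
    cods (map (edgeA C f) (zip x y)) = map (edgeO C f) y"
    using assms by (induction rule: list_all2_induct) (simp_all add: edgeA_arr)
  then show "set (map (edgeA C f) (zip x y)) \<subseteq> Arr C"
    "doms (map (edgeA C f) (zip x y)) = map (edgeO C f) x"
    "cods (map (edgeA C f) (zip x y)) = map (edgeO C f) y"
    by blast+
qed

lemma edge_arr [simp]:
  assumes "list_all2 (\<le>) x y"
  shows "edge x y \<in> Arr C" "Dom C (edge x y) = vertex x" "Cod C (edge x y) = vertex y"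
  using env_arr_arr[OF edges_arr(1)[OF assms]] edges_arr(2,3)[OF assms] by (simp_all add: edge_def)

lemma vertex_Obj [simp]: "vertex x \<in> Obj C"
  by (rule env_ob_Obj) auto

lemma edge_Ide: "edge x x = Ide C (vertex x)"
proof -
  have "map (edgeA C f) (zip x x) = ids (map (edgeO C f) x)"
    by (induction x) (auto simp: edgeA_def)
  moreover have "set (map (edgeO C f) x) \<subseteq> Obj C" by auto
  ultimately show ?thesis
    by (simp only: edge_def env_arr_Ide)
qed

lemma edge_Comp:
  assumes "list_all2 (\<le>) x y" "list_all2 (\<le>) y w"
  shows "edge y w \<cdot> edge x y = edge x w"
proof -
  have "composable
      (map (edgeA C f) (zip y w)) (map (edgeA C f) (zip x y)) \<and>
    map2 (\<cdot>) (map (edgeA C f) (zip y w)) (map (edgeA C f) (zip x y)) = map (edgeA C f) (zip x w)"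
    using assms
  proof (induction arbitrary: w rule: list_all2_induct)
    case Nil
    then show ?case by simp
  next
    case (Cons a x b y)
    from Cons.prems obtain c w' where w: "w = c # w'" "b \<le> c" "list_all2 (\<le>) y w'"
      unfolding list_all2_Cons1 by blast
    have "edgeA C f (b, c) \<cdot> edgeA C f (a, b) = edgeA C f (a, c)"
      using \<open>a \<le> b\<close> \<open>b \<le> c\<close> by (cases a; cases b; cases c; simp)
    then show ?case
      using Cons.IH[OF w(3)] w \<open>a \<le> b\<close> by (simp add: edgeA_arr)
  qed
  note * = this
  show ?thesis
    unfolding edge_def env_arr_Comp[OF conjunct1[OF *]] conjunct2[OF *] ..
qed

lemma Fcube_functor: "is_functor (punctured_cube t) C (Fcube t)"
  unfolding is_functor_def
proof (intro conjI ballI impI)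
  fix x assume "x \<in> Obj (punctured_cube t)"
  then have [simp]: "length x = t" by (simp add: full_subcat_def cube_def)
  show "FOb (Fcube t) x \<in> Obj C"
    by (simp add: Fcube_FOb)
  show "FArr (Fcube t) (Ide (punctured_cube t) x) = Ide C (FOb (Fcube t) x)"
    by (simp add: Fcube_FOb Fcube_FArr edge_Ide full_subcat_def cube_def)
next
  fix u assume "u \<in> Arr (punctured_cube t)"
  then obtain x y where u: "u = (x, y)" "length x = t" "list_all2 (\<le>) x y"
    by (auto simp: full_subcat_def cube_def)
  then show "FArr (Fcube t) u \<in> hom C (FOb (Fcube t) (Dom (punctured_cube t) u)) (FOb (Fcube t) (Cod (punctured_cube t) u))"
    using list_all2_lengthD[OF u(3)] by (simp add: Fcube_FOb Fcube_FArr hom_def full_subcat_def cube_def)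
  fix v assume "v \<in> Arr (punctured_cube t)" "Cod (punctured_cube t) u = Dom (punctured_cube t) v"
  then obtain w where v: "v = (y, w)" "list_all2 (\<le>) y w"
    using u(1) by (auto simp: full_subcat_def cube_def)
  then show "FArr (Fcube t) (v \<cdot>\<^bsub>punctured_cube t\<^esub> u) = FArr (Fcube t) v \<cdot> FArr (Fcube t) u"
    using u list_all2_lengthD[OF u(3)] list_all2_lengthD[OF v(2)]
    by (simp add: Fcube_FArr edge_Comp full_subcat_def cube_def)
qed

abbreviation latch :: "nat \<Rightarrow> 'oc" where
  "latch t \<equiv> fst (latching C t (Fcube t))"

abbreviation latch_in :: "nat \<Rightarrow> bool list \<Rightarrow> 'mc" where
  "latch_in t \<equiv> snd (latching C t (Fcube t))"

lemma latching_colimit: "is_colimit (punctured_cube t) C (Fcube t) (latch t) (latch_in t)"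
proof -
  obtain c \<iota> where "is_colimit (punctured_cube t) C (Fcube t) c \<iota>"
    using cube_colimit[OF punctured_cube_category Fcube_functor[of t]] by (elim exE)
  then have "\<exists>p. is_colimit (punctured_cube t) C (Fcube t) (fst p) (snd p)"
    by (intro exI[of _ "(c, \<iota>)"]) (simp only: fst_conv snd_conv)
  from someI_ex[OF this] show ?thesis
    unfolding latching_def colim_def .
qed

lemma latch_in_arr [simp]:
  assumes "length x = t" "x \<noteq> replicate t True"
  shows "latch_in t x \<in> Arr C" "Dom C (latch_in t x) = vertex x" "Cod C (latch_in t x) = latch t"
proof -
  have "\<forall>x\<in>Obj (punctured_cube t). latch_in t x \<in> hom C (FOb (Fcube t) x) (latch t)"
    using latching_colimit[of t] unfolding is_colimit_def by (elim conjE)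
  then have "latch_in t x \<in> hom C (FOb (Fcube t) x) (latch t)"
    by (rule bspec) (simp add: punctured_cube_Obj assms)
  then show "latch_in t x \<in> Arr C" "Dom C (latch_in t x) = vertex x" "Cod C (latch_in t x) = latch t"
    by (simp_all add: hom_def Fcube_FOb assms(1))
qed

lemma latch_in_edge:
  assumes "list_all2 (\<le>) x y" "length y = t" "x \<noteq> replicate t True" "y \<noteq> replicate t True"
  shows "latch_in t y \<cdot> edge x y = latch_in t x"
proof -
  have "\<forall>u\<in>Arr (punctured_cube t). latch_in t (Cod (punctured_cube t) u) \<cdot> FArr (Fcube t) u
      = latch_in t (Dom (punctured_cube t) u)"
    using latching_colimit[of t] unfolding is_colimit_def by (elim conjE)
  moreover have "(x, y) \<in> Arr (punctured_cube t)"
    using assms list_all2_lengthD[OF assms(1)] by (simp add: full_subcat_def cube_def)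
  ultimately have "latch_in t (Cod (punctured_cube t) (x, y)) \<cdot> FArr (Fcube t) (x, y)
      = latch_in t (Dom (punctured_cube t) (x, y))"
    by (rule bspec)
  then show ?thesis
    using assms list_all2_lengthD[OF assms(1)] by (simp add: Fcube_FArr full_subcat_def cube_def)
qed

lemma latch_universal:
  assumes T: "T \<in> Obj C"
    and h: "\<And>x. \<lbrakk>length x = t; x \<noteq> replicate t True\<rbrakk> \<Longrightarrow> h x \<in> hom C (vertex x) T"
    and h_edge: "\<And>x y. \<lbrakk>list_all2 (\<le>) x y; length y = t; x \<noteq> replicate t True; y \<noteq> replicate t True\<rbrakk>
      \<Longrightarrow> h y \<cdot> edge x y = h x"
  shows "\<exists>!k. k \<in> hom C (latch t) T \<and> (\<forall>x\<in>Obj (cube t) - {replicate t True}. k \<cdot> latch_in t x = h x)"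
proof -
  have "\<exists>!k. k \<in> hom C (latch t) T \<and> (\<forall>x\<in>Obj (punctured_cube t). k \<cdot> latch_in t x = h x)"
  proof (rule colimit_universal[OF latching_colimit T])
    show "\<forall>x\<in>Obj (punctured_cube t). h x \<in> hom C (FOb (Fcube t) x) T"
      using h by (auto simp: full_subcat_def cube_def Fcube_FOb)
    show "\<forall>u\<in>Arr (punctured_cube t). h (Cod (punctured_cube t) u) \<cdot> FArr (Fcube t) u = h (Dom (punctured_cube t) u)"
    proof
      fix u assume "u \<in> Arr (punctured_cube t)"
      then obtain x y where "u = (x, y)" "length x = t" "list_all2 (\<le>) x y"
        "x \<noteq> replicate t True" "y \<noteq> replicate t True"
        by (auto simp: full_subcat_def cube_def)
      then show "h (Cod (punctured_cube t) u) \<cdot> FArr (Fcube t) u = h (Dom (punctured_cube t) u)"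
        using h_edge[of x y] list_all2_lengthD[of "(\<le>)" x y] by (simp add: Fcube_FArr full_subcat_def cube_def)
    qed
  qed
  then show ?thesis
    by (simp add: full_subcat_def Diff_eq)
qed

lemma latch_ext:
  assumes a: "a \<in> hom C (latch t) T" and b: "b \<in> hom C (latch t) T"
    and eq: "\<And>i. i < t \<Longrightarrow> a \<cdot> latch_in t (face t i) = b \<cdot> latch_in t (face t i)"
  shows "a = b"
proof -
  note [simp] = homD[OF a] homD[OF b]
  have T: "T \<in> Obj C"
    using Obj_of_hom(2)[OF a] .
  have all: "a \<cdot> latch_in t x = b \<cdot> latch_in t x" if x: "length x = t" "x \<noteq> replicate t True" for x
  proof -
    obtain i where i: "i < t" "\<not> x ! i"
      using not_top[OF x] by blast
    note le = le_face[OF x(1) i(2)] and ne = face_neq_top[OF i(1)]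
    have "(a \<cdot> latch_in t (face t i)) \<cdot> edge x (face t i) = (b \<cdot> latch_in t (face t i)) \<cdot> edge x (face t i)"
      by (simp only: eq[OF i(1)])
    then show ?thesis
      using latch_in_edge[OF le _ x(2) ne] le ne by simp
  qed
  have "\<exists>!k. k \<in> hom C (latch t) T \<and>
      (\<forall>x\<in>Obj (cube t) - {replicate t True}. k \<cdot> latch_in t x = b \<cdot> latch_in t x)"
  proof (rule latch_universal[OF T])
    fix x y :: "bool list"
    assume "list_all2 (\<le>) x y" "length y = t" "x \<noteq> replicate t True" "y \<noteq> replicate t True"
    then show "(b \<cdot> latch_in t y) \<cdot> edge x y = b \<cdot> latch_in t x"
      using latch_in_edge[of x y t] by simp
  qed (simp add: hom_def)
  then show ?thesis
    by (rule ex1_unique) (use a b all in \<open>auto simp: cube_def\<close>)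
qed

text \<open>Every vertex of the punctured cube lies below some \<open>face t i\<close>, and a vertex below two of them lies
  below their meet. So values on the maximal vertices that agree on the meets define a cocone.\<close>
lemma latch_extend:
  assumes T: "T \<in> Obj C"
    and m: "\<And>i. i < t \<Longrightarrow> m i \<in> hom C (vertex (face t i)) T"
    and compatible: "\<And>i j. \<lbrakk>i < j; j < t\<rbrakk> \<Longrightarrow>
      m i \<cdot> edge ((face t i)[j := False]) (face t i) = m j \<cdot> edge ((face t i)[j := False]) (face t j)"
  obtains k where "k \<in> hom C (latch t) T" "\<And>i. i < t \<Longrightarrow> k \<cdot> latch_in t (face t i) = m i"
proof -
  have m_arr [simp]: "m i \<in> Arr C" "Dom C (m i) = vertex (face t i)" "Cod C (m i) = T" if "i < t" for i
    using homD[OF m[OF that]] by auto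
  have lt: "m i \<cdot> edge x (face t i) = m j \<cdot> edge x (face t j)"
    if x: "length x = t" and ij: "\<not> x ! i" "\<not> x ! j" "i < j" "j < t" for x i j
  proof -
    let ?y = "(face t i)[j := False]"
    have y: "list_all2 (\<le>) x ?y" "list_all2 (\<le>) ?y (face t i)" "list_all2 (\<le>) ?y (face t j)"
      using x ij by (auto simp: list_all2_conv_all_nth nth_list_update face_nth)
    note [simp] = edge_arr[OF y(1)] edge_arr[OF y(2)] edge_arr[OF y(3)]
    have "m i \<cdot> edge x (face t i) = (m i \<cdot> edge ?y (face t i)) \<cdot> edge x ?y"
      using ij by (simp add: edge_Comp[OF y(1,2)])
    also have "\<dots> = (m j \<cdot> edge ?y (face t j)) \<cdot> edge x ?y"
      by (simp only: compatible[OF ij(3,4)])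
    also have "\<dots> = m j \<cdot> edge x (face t j)"
      using ij by (simp add: edge_Comp[OF y(1,3)])
    finally show ?thesis .
  qed
  have indep: "m i \<cdot> edge x (face t i) = m j \<cdot> edge x (face t j)"
    if "length x = t" "\<not> x ! i" "\<not> x ! j" "i < t" "j < t" for x i j
  proof (cases i j rule: linorder_cases)
    case less
    then show ?thesis by (intro lt that)
  next
    case equal
    then show ?thesis by simp
  next
    case greater
    then show ?thesis by (intro lt[symmetric] that)
  qed
  define zero where "zero x = (SOME i. i < t \<and> \<not> x ! i)" for x :: "bool list"
  have zero: "zero x < t" "\<not> x ! zero x" if "length x = t" "x \<noteq> replicate t True" for x
    using someI_ex[OF not_top[OF that]] by (simp_all add: zero_def)
  let ?h = "\<lambda>x. m (zero x) \<cdot> edge x (face t (zero x))"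
  have "\<exists>!k. k \<in> hom C (latch t) T \<and> (\<forall>x\<in>Obj (cube t) - {replicate t True}. k \<cdot> latch_in t x = ?h x)"
  proof (rule latch_universal[OF T])
    fix x assume "length x = t" "x \<noteq> replicate t True"
    then show "?h x \<in> hom C (vertex x) T"
      using zero[of x] le_face[of x t "zero x"] by (simp add: hom_def)
  next
    fix x y :: "bool list"
    assume xy: "list_all2 (\<le>) x y" and y: "length y = t" "y \<noteq> replicate t True" and x: "x \<noteq> replicate t True"
    have lx: "length x = t"
      using list_all2_lengthD[OF xy] y by simp
    note zy = zero[OF y] and zx = zero[OF lx x]
    have "\<not> x ! zero y"
      using xy zy y by (auto simp: list_all2_conv_all_nth)
    then have "m (zero y) \<cdot> edge x (face t (zero y)) = ?h x"
      using indep[OF lx _ zx(2) zy(1) zx(1)] by simp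
    then show "?h y \<cdot> edge x y = ?h x"
      using xy zy le_face[OF y(1) zy(2)] by (simp add: edge_Comp)
  qed
  from ex1_implies_ex[OF this] obtain k
    where k: "k \<in> hom C (latch t) T" "\<forall>x\<in>Obj (cube t) - {replicate t True}. k \<cdot> latch_in t x = ?h x"
    by (elim exE conjE)
  show thesis
  proof (rule that[OF k(1)])
    fix i assume i: "i < t"
    have fi: "face t i \<in> Obj (cube t) - {replicate t True}"
      using face_neq_top[OF i] by (simp add: cube_def)
    have z: "zero (face t i) = i"
      using zero[of "face t i"] face_neq_top[OF i] by (auto simp: face_nth)
    show "k \<cdot> latch_in t (face t i) = m i"
      using bspec[OF k(2) fi] i unfolding z by (simp add: edge_Ide)
  qed
qed

lemma latching_map:
  shows "latching_map C t (Fcube t) \<in> hom C (latch t) (vertex (replicate t True))"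
    and "i < t \<Longrightarrow> latching_map C t (Fcube t) \<cdot> latch_in t (face t i) = edge (face t i) (replicate t True)"
proof -
  let ?top = "replicate t True"
  have unique: "\<exists>!k. k \<in> hom C (latch t) (vertex ?top) \<and>
      (\<forall>x\<in>Obj (cube t) - {?top}. k \<cdot> latch_in t x = FArr (Fcube t) (x, ?top))"
  proof (rule latch_universal[OF vertex_Obj])
    fix x :: "bool list" assume "length x = t"
    then show "FArr (Fcube t) (x, ?top) \<in> hom C (vertex x) (vertex ?top)"
      using le_top[of x t] by (simp add: Fcube_FArr hom_def)
  next
    fix x y :: "bool list" assume "list_all2 (\<le>) x y" "length y = t"
    then show "FArr (Fcube t) (y, ?top) \<cdot> edge x y = FArr (Fcube t) (x, ?top)"
      using le_top[of y t] list_all2_lengthD[of "(\<le>)" x y] by (simp add: Fcube_FArr edge_Comp)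
  qed
  have eq: "latching_map C t (Fcube t) = (THE k. k \<in> hom C (latch t) (vertex ?top) \<and>
      (\<forall>x\<in>Obj (cube t) - {?top}. k \<cdot> latch_in t x = FArr (Fcube t) (x, ?top)))"
    unfolding latching_map_def Fcube_FOb[OF length_replicate] ..
  have *: "latching_map C t (Fcube t) \<in> hom C (latch t) (vertex ?top) \<and>
      (\<forall>x\<in>Obj (cube t) - {?top}. latching_map C t (Fcube t) \<cdot> latch_in t x = FArr (Fcube t) (x, ?top))"
    unfolding eq by (rule theI'[OF unique])
  then show "latching_map C t (Fcube t) \<in> hom C (latch t) (vertex ?top)"
    by (rule conjunct1)
  show "latching_map C t (Fcube t) \<cdot> latch_in t (face t i) = edge (face t i) ?top" if "i < t"
    using bspec[OF conjunct2[OF *], of "face t i"] face_neq_top[OF that] by (simp add: cube_def Fcube_FArr)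
qed

end

section \<open>The attaching maps\<close>

context operad_algebra
begin

lemma env_comp_arr [simp]:
  assumes "set Xs \<subseteq> Obj C" "set Zs \<subseteq> Obj C"
  shows "ecomp Xs [] Zs \<in> Arr C"
    "Dom C (ecomp Xs [] Zs) = eob (Xs @ [A] @ Zs)"
    "Cod C (ecomp Xs [] Zs) = eob (Xs @ Zs)"
  using homD[OF env_comp_nullary(1)[OF assms]] by blast+

lemma env_comp_nat:
  assumes [simp]: "set xs \<subseteq> Arr C" "set zs \<subseteq> Arr C"
  shows "ecomp (cods xs) [] (cods zs) \<cdot> earr (xs @ [Ide C A] @ zs)
    = earr (xs @ zs) \<cdot> ecomp (doms xs) [] (doms zs)"
    (is "?c' \<cdot> ?e = ?e' \<cdot> ?c")
proof (rule env_ext_plugged[of "doms xs" "doms zs" A])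
  fix u v :: "unit option list"
  assume u: "u \<in> patterns (length (doms xs))" and v: "v \<in> patterns (length (doms zs))"
  then have [simp]: "fits u xs" "fits v zs"
    by (simp_all add: patterns_iff)
  let ?fu = "factors0 (Ide C A) u xs" and ?fv = "factors0 (Ide C A) v zs"
  let ?i = "ein (u @ [None] @ v) (doms xs @ [A] @ doms zs)"
  let ?i' = "ein (u @ [None] @ v) (cods xs @ [A] @ cods zs)"
  let ?j = "ein (u @ [Some ()] @ v) (doms xs @ doms zs)"
  let ?j' = "ein (u @ [Some ()] @ v) (cods xs @ cods zs)"
  have e: "?e \<cdot> ?i = ?i' \<cdot> otensA (?fu @ [Ide C A] @ ?fv)"
    using env_arr(2)[of "xs @ [Ide C A] @ zs" "u @ [None] @ v"] by (simp add: patterns_iff)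
  have e': "?e' \<cdot> ?j = ?j' \<cdot> otensA (?fu @ [Ide C A] @ ?fv)"
    using env_arr(2)[of "xs @ zs" "u @ [Some ()] @ v"] by (simp add: patterns_iff)
  have c: "?c \<cdot> ?i = ?j" and c': "?c' \<cdot> ?i' = ?j'"
    by (rule env_comp_nullary(2); simp add: patterns_iff)+
  have "(?c' \<cdot> ?e) \<cdot> ?i = ?c' \<cdot> (?i' \<cdot> otensA (?fu @ [Ide C A] @ ?fv))"
    unfolding e[symmetric] by (rule assoc_simp) simp_all
  also have "\<dots> = ?e' \<cdot> ?j"
    unfolding e' by (rule Comp_eq_extend[OF c']) simp_all
  also have "\<dots> = (?e' \<cdot> ?c) \<cdot> ?i"
    unfolding c[symmetric] by (rule assoc_simp[symmetric]) simp_all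
  finally show "(?c' \<cdot> ?e) \<cdot> ?i = (?e' \<cdot> ?c) \<cdot> ?i" .
qed (simp_all add: hom_def)

text \<open>On a summand both composites are the identity onto the word in which the two distinguished letters
  \<open>A\<close> have become ordinary.\<close>
lemma env_comp_commute:
  assumes [simp]: "set Xs \<subseteq> Obj C" "set Ws \<subseteq> Obj C" "set Zs \<subseteq> Obj C"
  shows "ecomp (Xs @ Ws) [] Zs \<cdot> ecomp Xs [] (Ws @ [A] @ Zs)
    = ecomp Xs [] (Ws @ Zs) \<cdot> ecomp (Xs @ [A] @ Ws) [] Zs"
    (is "?a \<cdot> ?b = ?c \<cdot> ?d")
proof (rule env_ext_plugged[of Xs "Ws @ [A] @ Zs" A])
  fix u v :: "unit option list"
  assume u: "u \<in> patterns (length Xs)" and v: "v \<in> patterns (length (Ws @ [A] @ Zs))"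
  obtain v1 v2 where v12: "v = v1 @ None # v2" "v1 \<in> patterns (length Ws)"
    "v2 \<in> patterns (length (Ws @ [A] @ Zs) - Suc (length Ws))"
    using v by (rule pattern_split[where i = "length Ws"]) simp
  have [simp]: "fits u Xs" "fits v1 Ws" "fits v2 Zs"
    using u v12 by (simp_all add: patterns_iff)
  let ?i = "ein (u @ [None] @ v) (Xs @ [A] @ Ws @ [A] @ Zs)"
  have b: "?b \<cdot> ?i = ein (u @ [Some ()] @ v1 @ [None] @ v2) (Xs @ Ws @ [A] @ Zs)"
    using env_comp_nullary(2)[of Xs "Ws @ [A] @ Zs" u v] by (simp add: patterns_iff v12)
  have a: "?a \<cdot> ein (u @ [Some ()] @ v1 @ [None] @ v2) (Xs @ Ws @ [A] @ Zs)
      = ein (u @ [Some ()] @ v1 @ [Some ()] @ v2) (Xs @ Ws @ Zs)"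
    using env_comp_nullary(2)[of "Xs @ Ws" Zs "u @ [Some ()] @ v1" v2] by (simp add: patterns_iff)
  have d: "?d \<cdot> ?i = ein (u @ [None] @ v1 @ [Some ()] @ v2) (Xs @ [A] @ Ws @ Zs)"
    using env_comp_nullary(2)[of "Xs @ [A] @ Ws" Zs "u @ [None] @ v1" v2] by (simp add: patterns_iff v12)
  have c: "?c \<cdot> ein (u @ [None] @ v1 @ [Some ()] @ v2) (Xs @ [A] @ Ws @ Zs)
      = ein (u @ [Some ()] @ v1 @ [Some ()] @ v2) (Xs @ Ws @ Zs)"
    using env_comp_nullary(2)[of Xs "Ws @ Zs" u "v1 @ [Some ()] @ v2"] by (simp add: patterns_iff)
  have "(?a \<cdot> ?b) \<cdot> ?i = ?a \<cdot> (?b \<cdot> ?i)"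
    by (rule assoc_simp) (simp_all add: v12)
  also have "\<dots> = ?c \<cdot> (?d \<cdot> ?i)"
    by (simp only: a b c d)
  also have "\<dots> = (?c \<cdot> ?d) \<cdot> ?i"
    by (rule assoc_simp[symmetric]) (simp_all add: v12)
  finally show "(?a \<cdot> ?b) \<cdot> ?i = (?c \<cdot> ?d) \<cdot> ?i" .
qed (simp_all add: hom_def)

end

context attaching
begin

text \<open>The composite of the first two arrows by which the attaching map is described.\<close>
definition attach :: "'oc list \<Rightarrow> 'oc list \<Rightarrow> 'mc" where
  "attach Xs Zs = ecomp Xs [] Zs \<cdot> earr (ids Xs @ [gbar] @ ids Zs)"

lemma attach_arr [simp]:
  assumes [simp]: "set Xs \<subseteq> Obj C" "set Zs \<subseteq> Obj C"
  shows "attach Xs Zs \<in> Arr C" "Dom C (attach Xs Zs) = eob (Xs @ [Y] @ Zs)"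
    "Cod C (attach Xs Zs) = eob (Xs @ Zs)"
  by (simp_all add: attach_def)

lemma attach_nat:
  assumes [simp]: "set xs \<subseteq> Arr C" "set zs \<subseteq> Arr C"
  shows "attach (cods xs) (cods zs) \<cdot> earr (xs @ [Ide C Y] @ zs)
    = earr (xs @ zs) \<cdot> attach (doms xs) (doms zs)"
proof -
  define X where "X = doms xs"
  define X' where "X' = cods xs"
  define W where "W = doms zs"
  define W' where "W' = cods zs"
  note names = X_def[symmetric] X'_def[symmetric] W_def[symmetric] W'_def[symmetric]
  have [simp]: "set X \<subseteq> Obj C" "set X' \<subseteq> Obj C" "set W \<subseteq> Obj C" "set W' \<subseteq> Obj C"
    by (simp_all add: X_def X'_def W_def W'_def)
  let ?c' = "ecomp X' [] W'" and ?c = "ecomp X [] W"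
  let ?g' = "earr (ids X' @ [gbar] @ ids W')"
  let ?g = "earr (ids X @ [gbar] @ ids W)"
  let ?e = "earr (xs @ [Ide C Y] @ zs)" and ?e' = "earr (xs @ [Ide C A] @ zs)"
  have g: "?g' \<cdot> ?e = ?e' \<cdot> ?g"
    using env_arr_after[OF assms, of gbar "Ide C Y"] env_arr_before[OF assms, of "Ide C A" gbar]
    by (simp add: names del: map_map)
  have c: "?c' \<cdot> ?e' = earr (xs @ zs) \<cdot> ?c"
    using env_comp_nat[OF assms] unfolding names .
  have "(?c' \<cdot> ?g') \<cdot> ?e = ?c' \<cdot> (?g' \<cdot> ?e)"
    by (rule assoc_simp) (simp_all add: names)
  also have "\<dots> = (earr (xs @ zs) \<cdot> ?c) \<cdot> ?g"
    unfolding g by (rule Comp_eq_extend[OF c]) (simp_all add: names)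
  also have "\<dots> = earr (xs @ zs) \<cdot> (?c \<cdot> ?g)"
    by (rule assoc_simp) (simp_all add: names)
  finally show ?thesis
    unfolding names attach_def .
qed

text \<open>By naturality both sides start with \<open>gbar\<close> at both places; what follows are two nullary
  compositions, which commute.\<close>
lemma attach_commute:
  assumes [simp]: "set Xs \<subseteq> Obj C" "set Ws \<subseteq> Obj C" "set Zs \<subseteq> Obj C"
  shows "attach (Xs @ Ws) Zs \<cdot> attach Xs (Ws @ [Y] @ Zs) = attach Xs (Ws @ Zs) \<cdot> attach (Xs @ [Y] @ Ws) Zs"
proof -
  let ?X = "ids Xs" and ?W = "ids Ws" and ?Z = "ids Zs"
  let ?e = "earr" and ?c = "\<lambda>Xs Zs. ecomp Xs [] Zs"
  let ?gg = "?e (?X @ [gbar] @ ?W @ [gbar] @ ?Z)"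
  have n1: "?e (?X @ ?W @ [gbar] @ ?Z) \<cdot> ?c Xs (Ws @ [Y] @ Zs)
      = ?c Xs (Ws @ [A] @ Zs) \<cdot> ?e (?X @ [Ide C A] @ ?W @ [gbar] @ ?Z)"
    using env_comp_nat[of ?X "?W @ [gbar] @ ?Z"] by simp
  have g1: "?e (?X @ [Ide C A] @ ?W @ [gbar] @ ?Z) \<cdot> ?e (?X @ [gbar] @ ?W @ [Ide C Y] @ ?Z) = ?gg"
    using env_arr_before[of "?X @ [Ide C A] @ ?W" ?Z gbar "Ide C Y"] env_arr_after[of ?X "?W @ [gbar] @ ?Z" "Ide C A" gbar]
      composable_Ide[of ?X] composable_Ide[of ?W] composable_Ide[of ?Z]
    by (subst env_arr_Comp) (simp_all add: list_all2_appendI)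
  have n2: "?e (?X @ [gbar] @ ?W @ ?Z) \<cdot> ?c (Xs @ [Y] @ Ws) Zs
      = ?c (Xs @ [A] @ Ws) Zs \<cdot> ?e (?X @ [gbar] @ ?W @ [Ide C A] @ ?Z)"
    using env_comp_nat[of "?X @ [gbar] @ ?W" ?Z] by simp
  have g2: "?e (?X @ [gbar] @ ?W @ [Ide C A] @ ?Z) \<cdot> ?e (?X @ [Ide C Y] @ ?W @ [gbar] @ ?Z) = ?gg"
    using composable_Ide[of ?X] composable_Ide[of ?W] composable_Ide[of ?Z]
    by (subst env_arr_Comp) (simp_all add: list_all2_appendI)
  have "attach (Xs @ Ws) Zs \<cdot> attach Xs (Ws @ [Y] @ Zs)
      = ?c (Xs @ Ws) Zs \<cdot> ((?e (?X @ ?W @ [gbar] @ ?Z) \<cdot> ?c Xs (Ws @ [Y] @ Zs))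
        \<cdot> ?e (?X @ [gbar] @ ?W @ [Ide C Y] @ ?Z))"
    by (simp add: attach_def)
  also have "\<dots> = (?c (Xs @ Ws) Zs \<cdot> ?c Xs (Ws @ [A] @ Zs))
      \<cdot> (?e (?X @ [Ide C A] @ ?W @ [gbar] @ ?Z) \<cdot> ?e (?X @ [gbar] @ ?W @ [Ide C Y] @ ?Z))"
    unfolding n1 by simp
  also have "\<dots> = (?c Xs (Ws @ Zs) \<cdot> ?c (Xs @ [A] @ Ws) Zs)
      \<cdot> (?e (?X @ [gbar] @ ?W @ [Ide C A] @ ?Z) \<cdot> ?e (?X @ [Ide C Y] @ ?W @ [gbar] @ ?Z))"
    unfolding g1 g2 env_comp_commute[OF assms] ..
  also have "\<dots> = ?c Xs (Ws @ Zs) \<cdot> ((?e (?X @ [gbar] @ ?W @ ?Z) \<cdot> ?c (Xs @ [Y] @ Ws) Zs)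
        \<cdot> ?e (?X @ [Ide C Y] @ ?W @ [gbar] @ ?Z))"
    unfolding n2 by simp
  also have "\<dots> = attach Xs (Ws @ Zs) \<cdot> attach (Xs @ [Y] @ Ws) Zs"
    by (simp add: attach_def)
  finally show ?thesis .
qed

lemma replicate_YZ [simp]: "set (replicate n Z) \<subseteq> Obj C" "set (replicate n (Ide C Z)) \<subseteq> Arr C"
  by auto

text \<open>The value that the attaching map of stage \<open>Suc n\<close> must have on the vertex \<open>face (Suc n) i\<close>. Here \<open>b\<close>
  is the map from \<open>P\<^sub>A(n)(Z, \<dots>, Z)\<close> to stage \<open>n\<close>; for \<open>n = 0\<close> it is the identity of \<open>A\<close>.\<close>
definition attach_at :: "nat \<Rightarrow> 'mc \<Rightarrow> nat \<Rightarrow> 'mc" where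
  "attach_at n b i = b \<cdot> attach (replicate i Z) (replicate (n - i) Z)"

definition attach_compatible :: "nat \<Rightarrow> 'mc \<Rightarrow> bool" where
  "attach_compatible n b \<longleftrightarrow> (\<forall>i j. i < j \<longrightarrow> j \<le> n \<longrightarrow>
     attach_at n b i \<cdot> edge ((face (Suc n) i)[j := False]) (face (Suc n) i)
     = attach_at n b j \<cdot> edge ((face (Suc n) i)[j := False]) (face (Suc n) j))"

lemma vertex_top: "vertex (replicate n True) = eob (replicate n Z)"
  by simp

lemma vertex_face: "i \<le> n \<Longrightarrow> vertex (face (Suc n) i) = eob (replicate i Z @ [Y] @ replicate (n - i) Z)"
  using face_eq[of i "n - i"] by simp

lemma attach_at_arr [simp]:
  assumes b: "b \<in> hom C (eob (replicate n Z)) B" and i: "i \<le> n"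
  shows "attach_at n b i \<in> Arr C" "Dom C (attach_at n b i) = vertex (face (Suc n) i)" "Cod C (attach_at n b i) = B"
proof -
  have "replicate i Z @ replicate (n - i) Z = replicate n Z"
    using i by (simp flip: replicate_add)
  then show "attach_at n b i \<in> Arr C" "Dom C (attach_at n b i) = vertex (face (Suc n) i)" "Cod C (attach_at n b i) = B"
    using homD[OF b] vertex_face[OF i] by (simp_all add: attach_at_def)
qed

lemma edge_face_top:
  "edge (face (Suc (i + k)) i) (replicate (Suc (i + k)) True)
   = earr (replicate i (Ide C Z) @ [f] @ replicate k (Ide C Z))"
proof -
  have "replicate (i + Suc k) True = replicate i True @ [True] @ replicate k True"
    by (simp only: replicate_add replicate_Suc append.simps)
  then have "replicate (Suc (i + k)) True = replicate i True @ [True] @ replicate k True"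
    by (simp only: add_Suc_right)
  then show ?thesis
    by (simp add: edge_def face_eq del: replicate_Suc)
qed

text \<open>The heart of the construction. The vertex with coordinates \<open>i < j\<close> equal to \<open>Y\<close> has \<open>k\<close> objects \<open>Z\<close>
  between them and \<open>l\<close> after them. Naturality of \<open>attach\<close> at \<open>i\<close> brings the arrow \<open>f\<close> at \<open>j\<close> next to
  \<open>b'\<close>, where the square of the previous stage turns it into an \<open>attach\<close> at \<open>j\<close>; the same holds with
  \<open>i\<close> and \<open>j\<close> exchanged.\<close>
lemma attach_compatible_Suc:
  assumes b: "b \<in> hom C (eob (replicate n Z)) B"
    and b': "b' \<in> hom C (eob (replicate (Suc n) Z)) B'" and \<phi>: "\<phi> \<in> hom C B B'"
    and square: "\<And>i. i \<le> n \<Longrightarrow> b' \<cdot> edge (face (Suc n) i) (replicate (Suc n) True) = \<phi> \<cdot> attach_at n b i"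
  shows "attach_compatible (Suc n) b'"
  unfolding attach_compatible_def
proof (intro allI impI)
  fix i j assume ij: "i < j" "j \<le> Suc n"
  define k where "k = j - Suc i"
  define l where "l = Suc n - j"
  have j: "j = Suc (i + k)" and n: "n = i + k + l"
    using ij by (simp_all add: k_def l_def)
  let ?r = "\<lambda>m. replicate m True" and ?Z = "\<lambda>m. replicate m Z" and ?I = "\<lambda>m. replicate m (Ide C Z)"
  let ?e = "earr"
  have face_i: "face (Suc (Suc n)) i = ?r i @ [False] @ ?r k @ [True] @ ?r l"
    and face_j: "face (Suc (Suc n)) j = ?r i @ [True] @ ?r k @ [False] @ ?r l"
    and face_ij: "(face (Suc (Suc n)) i)[j := False] = ?r i @ [False] @ ?r k @ [False] @ ?r l"
    by (rule nth_equalityI; auto simp: face_nth n j nth_append nth_Cons' nth_list_update)+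
  have edge_i: "edge ((face (Suc (Suc n)) i)[j := False]) (face (Suc (Suc n)) i)
      = ?e (?I i @ [Ide C Y] @ ?I k @ [f] @ ?I l)"
    and edge_j: "edge ((face (Suc (Suc n)) i)[j := False]) (face (Suc (Suc n)) j)
      = ?e (?I i @ [f] @ ?I k @ [Ide C Y] @ ?I l)"
    unfolding face_ij unfolding face_i face_j by (simp_all add: edge_def)
  note [simp] = homD(1,3)[OF b] homD(1,3)[OF b'] homD[OF \<phi>]
  have Zn: "?Z i @ ?Z k @ ?Z l = ?Z n" "?Z i @ ?Z k @ [Z] @ ?Z l = ?Z (Suc n)" "?Z i @ [Z] @ ?Z k @ ?Z l = ?Z (Suc n)"
    by (simp_all add: n replicate_add replicate_app_Cons_same)
  have at_i: "attach_at (Suc n) b' i = b' \<cdot> attach (?Z i) (?Z k @ [Z] @ ?Z l)"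
    by (simp add: attach_at_def n Suc_diff_le replicate_add replicate_app_Cons_same)
  have at_j: "attach_at (Suc n) b' j = b' \<cdot> attach (?Z i @ [Z] @ ?Z k) (?Z l)"
    by (simp add: attach_at_def n j replicate_add replicate_app_Cons_same)
  have sq_ik: "b' \<cdot> ?e (?I i @ ?I k @ [f] @ ?I l) = \<phi> \<cdot> (b \<cdot> attach (?Z i @ ?Z k) (?Z l))"
    using square[of "i + k"] edge_face_top[of "i + k" l] by (simp add: attach_at_def n replicate_add)
  have sq_i: "b' \<cdot> ?e (?I i @ [f] @ ?I k @ ?I l) = \<phi> \<cdot> (b \<cdot> attach (?Z i) (?Z k @ ?Z l))"
    using square[of i] edge_face_top[of i "k + l"] by (simp add: attach_at_def n replicate_add add.assoc)
  have nat_i: "attach (?Z i) (?Z k @ [Z] @ ?Z l) \<cdot> ?e (?I i @ [Ide C Y] @ ?I k @ [f] @ ?I l)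
      = ?e (?I i @ ?I k @ [f] @ ?I l) \<cdot> attach (?Z i) (?Z k @ [Y] @ ?Z l)"
    using attach_nat[of "?I i" "?I k @ [f] @ ?I l"] by simp
  have nat_j: "attach (?Z i @ [Z] @ ?Z k) (?Z l) \<cdot> ?e (?I i @ [f] @ ?I k @ [Ide C Y] @ ?I l)
      = ?e (?I i @ [f] @ ?I k @ ?I l) \<cdot> attach (?Z i @ [Y] @ ?Z k) (?Z l)"
    using attach_nat[of "?I i @ [f] @ ?I k" "?I l"] by simp
  have [simp]: "Dom C b = eob (?Z i @ ?Z k @ ?Z l)"
    "Dom C b' = eob (?Z i @ ?Z k @ [Z] @ ?Z l)"
    unfolding Zn(1,2) by (rule homD(2)[OF b], rule homD(2)[OF b'])
  have Zn': "?Z i @ [Z] @ ?Z k @ ?Z l = ?Z i @ ?Z k @ [Z] @ ?Z l"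
    using Zn by simp
  have [simp]: "eob (?Z i @ Z # ?Z k @ ?Z l) = eob (?Z i @ ?Z k @ Z # ?Z l)"
    using arg_cong[OF Zn', of "eob"] by simp
  have "attach_at (Suc n) b' i \<cdot> edge ((face (Suc (Suc n)) i)[j := False]) (face (Suc (Suc n)) i)
      = b' \<cdot> (attach (?Z i) (?Z k @ [Z] @ ?Z l) \<cdot> ?e (?I i @ [Ide C Y] @ ?I k @ [f] @ ?I l))"
    unfolding at_i edge_i by (rule assoc_simp) simp_all
  also have "\<dots> = (\<phi> \<cdot> (b \<cdot> attach (?Z i @ ?Z k) (?Z l))) \<cdot> attach (?Z i) (?Z k @ [Y] @ ?Z l)"
    unfolding nat_i by (rule Comp_eq_extend[OF sq_ik]) simp_all
  also have "\<dots> = \<phi> \<cdot> (b \<cdot> (attach (?Z i @ ?Z k) (?Z l) \<cdot> attach (?Z i) (?Z k @ [Y] @ ?Z l)))"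
    by simp
  also have "\<dots> = \<phi> \<cdot> (b \<cdot> (attach (?Z i) (?Z k @ ?Z l) \<cdot> attach (?Z i @ [Y] @ ?Z k) (?Z l)))"
    by (subst attach_commute) simp_all
  also have "\<dots> = (\<phi> \<cdot> (b \<cdot> attach (?Z i) (?Z k @ ?Z l))) \<cdot> attach (?Z i @ [Y] @ ?Z k) (?Z l)"
    by simp
  also have "\<dots> = b' \<cdot> (attach (?Z i @ [Z] @ ?Z k) (?Z l) \<cdot> ?e (?I i @ [f] @ ?I k @ [Ide C Y] @ ?I l))"
    unfolding nat_j by (rule Comp_eq_extend[OF sq_i, symmetric]) simp_all
  also have "\<dots> = attach_at (Suc n) b' j \<cdot> edge ((face (Suc (Suc n)) i)[j := False]) (face (Suc (Suc n)) j)"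
    unfolding at_j edge_j by (rule assoc_simp[symmetric]) simp_all
  finally show "attach_at (Suc n) b' i \<cdot> edge ((face (Suc (Suc n)) i)[j := False]) (face (Suc (Suc n)) i)
      = attach_at (Suc n) b' j \<cdot> edge ((face (Suc (Suc n)) i)[j := False]) (face (Suc (Suc n)) j)" .
qed

text \<open>The passage from stage \<open>n\<close>, given by \<open>B\<close> and \<open>b\<close>, to the next one.\<close>
definition stage :: "nat \<Rightarrow> 'oc \<Rightarrow> 'mc \<Rightarrow> 'oc \<Rightarrow> 'mc \<Rightarrow> 'mc \<Rightarrow> 'mc \<Rightarrow> bool" where
  "stage n B b B' b' \<phi> \<psi> \<longleftrightarrow> \<phi> \<in> hom C B B' \<and> \<psi> \<in> hom C (latch (Suc n)) B \<and>
     b' \<in> hom C (eob (replicate (Suc n) Z)) B' \<and>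
     is_pushout C (latching_map C (Suc n) (Fcube (Suc n))) \<psi> b' \<phi> \<and>
     (\<forall>i\<le>n. \<psi> \<cdot> latch_in (Suc n) (face (Suc n) i) = attach_at n b i)"

lemma stage_exists:
  assumes b: "b \<in> hom C (eob (replicate n Z)) B" and compatible: "attach_compatible n b"
  shows "\<exists>B' b' \<phi> \<psi>. stage n B b B' b' \<phi> \<psi> \<and> attach_compatible (Suc n) b'"
proof -
  let ?l = "latching_map C (Suc n) (Fcube (Suc n))"
  have B: "B \<in> Obj C"
    using Obj_of_hom(2)[OF b] .
  have m: "attach_at n b i \<in> hom C (vertex (face (Suc n) i)) B" if "i < Suc n" for i
    using attach_at_arr[OF b, of i] that by (simp add: hom_def)
  have com: "attach_at n b i \<cdot> edge ((face (Suc n) i)[j := False]) (face (Suc n) i)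
     = attach_at n b j \<cdot> edge ((face (Suc n) i)[j := False]) (face (Suc n) j)" if "i < j" "j < Suc n" for i j
    using compatible[unfolded attach_compatible_def, rule_format, of i j] that by simp
  obtain \<psi> where \<psi>: "\<psi> \<in> hom C (latch (Suc n)) B"
    and \<psi>_in: "\<And>i. i < Suc n \<Longrightarrow> \<psi> \<cdot> latch_in (Suc n) (face (Suc n) i) = attach_at n b i"
    by (rule latch_extend[OF B m com], assumption, assumption, assumption, rule that)
  have l: "?l \<in> hom C (latch (Suc n)) (eob (replicate (Suc n) Z))"
    using latching_map(1)[of "Suc n"] unfolding vertex_top .
  note [simp] = homD[OF l] homD[OF \<psi>]
  obtain b' \<phi> where push: "is_pushout C ?l \<psi> b' \<phi>"
    using pushout[of ?l \<psi>] by auto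
  have "b' \<in> Arr C"
    using push unfolding is_pushout_def by (elim conjE)
  moreover have "Dom C b' = Cod C ?l"
    using push unfolding is_pushout_def by (elim conjE)
  ultimately have b': "b' \<in> hom C (eob (replicate (Suc n) Z)) (Cod C b')"
    by (simp add: hom_def)
  have "\<phi> \<in> hom C (Cod C \<psi>) (Cod C b')"
    using push unfolding is_pushout_def by (elim conjE)
  then have \<phi>: "\<phi> \<in> hom C B (Cod C b')"
    by simp
  have square: "b' \<cdot> ?l = \<phi> \<cdot> \<psi>"
    using push unfolding is_pushout_def by (elim conjE)
  note [simp] = homD[OF b'] homD[OF \<phi>]
  have "b' \<cdot> edge (face (Suc n) i) (replicate (Suc n) True) = \<phi> \<cdot> attach_at n b i" if i: "i \<le> n" for i
  proof -
    have lt: "i < Suc n" using i by simp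
    note [simp] = latch_in_arr[OF length_face face_neq_top[OF lt]]
    have "b' \<cdot> edge (face (Suc n) i) (replicate (Suc n) True) = b' \<cdot> (?l \<cdot> latch_in (Suc n) (face (Suc n) i))"
      unfolding latching_map(2)[OF lt] ..
    also have "\<dots> = (\<phi> \<cdot> \<psi>) \<cdot> latch_in (Suc n) (face (Suc n) i)"
      by (rule Comp_eq_extend[OF square]) simp_all
    also have "\<dots> = \<phi> \<cdot> (\<psi> \<cdot> latch_in (Suc n) (face (Suc n) i))"
      by (rule assoc_simp) simp_all
    also have "\<dots> = \<phi> \<cdot> attach_at n b i"
      unfolding \<psi>_in[OF lt] ..
    finally show ?thesis .
  qed
  then have "attach_compatible (Suc n) b'"
    by (rule attach_compatible_Suc[OF b b' \<phi>])
  moreover have "\<forall>i\<le>n. \<psi> \<cdot> latch_in (Suc n) (face (Suc n) i) = attach_at n b i"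
    using \<psi>_in by (simp only: less_Suc_eq_le) blast
  then have "stage n B b (Cod C b') b' \<phi> \<psi>"
    unfolding stage_def by (intro conjI \<phi> \<psi> b' push)
  ultimately have "stage n B b (Cod C b') b' \<phi> \<psi> \<and> attach_compatible (Suc n) b'"
    by (intro conjI)
  then show ?thesis by (intro exI)
qed

text \<open>Recursion over the stages; the compatibility of the next attaching values is carried along, as it
  is what makes the next stage exist.\<close>
lemma stages_exist:
  "\<exists>(B :: nat \<Rightarrow> 'oc) b \<phi> \<psi>. B 0 = A \<and> b 0 = Ide C A \<and> (\<forall>n. stage n (B n) (b n) (B (Suc n)) (b (Suc n)) (\<phi> (Suc n)) (\<psi> (Suc n)))"
proof -
  define Good where "Good n s \<longleftrightarrow> (case s of (B, b, \<phi>, \<psi>) \<Rightarrow>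
      b \<in> hom C (eob (replicate n Z)) B \<and> attach_compatible n b \<and> (n = 0 \<longrightarrow> B = A \<and> b = Ide C A))"
    for n and s :: "'oc \<times> 'mc \<times> 'mc \<times> 'mc"
  define Next where "Next n s s' \<longleftrightarrow> (case s of (B, b, _, _) \<Rightarrow> case s' of (B', b', \<phi>, \<psi>) \<Rightarrow> stage n B b B' b' \<phi> \<psi>)"
    for n and s s' :: "'oc \<times> 'mc \<times> 'mc \<times> 'mc"
  have "\<exists>s. \<forall>n. Good n (s n) \<and> Next n (s n) (s (Suc n))"
  proof (rule dependent_nat_choice)
    \<comment> \<open>No arrow leads to stage \<open>0\<close>, so the last two entries are dummies.\<close>
    have "Good 0 (A, Ide C A, Ide C A, Ide C A)"
      by (simp add: Good_def attach_compatible_def hom_def)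
    then show "\<exists>s. Good 0 s" ..
  next
    fix s n assume "Good n s"
    then obtain B b \<phi> \<psi> where s: "s = (B, b, \<phi>, \<psi>)" "b \<in> hom C (eob (replicate n Z)) B" "attach_compatible n b"
      by (cases s) (simp add: Good_def)
    from stage_exists[OF s(2,3)] obtain B' b' \<phi>' \<psi>'
      where *: "stage n B b B' b' \<phi>' \<psi>'" "attach_compatible (Suc n) b'"
      by (elim exE conjE)
    have "b' \<in> hom C (eob (replicate (Suc n) Z)) B'"
      using *(1) unfolding stage_def by (elim conjE)
    then have "Good (Suc n) (B', b', \<phi>', \<psi>') \<and> Next n s (B', b', \<phi>', \<psi>')"
      using * s by (simp add: Good_def Next_def)
    then show "\<exists>s'. Good (Suc n) s' \<and> Next n s s'" ..
  qed
  then obtain s where s: "\<And>n. Good n (s n)" "\<And>n. Next n (s n) (s (Suc n))"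
    by blast
  define B where "B n = fst (s n)" for n
  define b where "b n = fst (snd (s n))" for n
  define \<phi> where "\<phi> n = fst (snd (snd (s n)))" for n
  define \<psi> where "\<psi> n = snd (snd (snd (s n)))" for n
  have "B 0 = A" "b 0 = Ide C A"
    using s(1)[of 0] by (auto simp: Good_def B_def b_def split: prod.splits)
  moreover have "stage n (B n) (b n) (B (Suc n)) (b (Suc n)) (\<phi> (Suc n)) (\<psi> (Suc n))" for n
    using s(2)[of n] by (auto simp: Next_def B_def b_def \<phi>_def \<psi>_def split: prod.splits)
  ultimately have "B 0 = A \<and> b 0 = Ide C A \<and>
      (\<forall>n. stage n (B n) (b n) (B (Suc n)) (b (Suc n)) (\<phi> (Suc n)) (\<psi> (Suc n)))"
    by simp
  then show ?thesis
    by (intro exI)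
qed

lemma stageD:
  assumes "stage n B b B' b' \<phi> \<psi>"
  shows "\<phi> \<in> hom C B B'" "\<psi> \<in> hom C (latch (Suc n)) B"
    "b' \<in> hom C (eob (replicate (Suc n) Z)) B'"
    "is_pushout C (latching_map C (Suc n) (Fcube (Suc n))) \<psi> b' \<phi>"
    "\<forall>i\<le>n. \<psi> \<cdot> latch_in (Suc n) (face (Suc n) i) = attach_at n b i"
proof -
  note * = assms[unfolded stage_def]
  show "\<phi> \<in> hom C B B'"
    by (rule conjunct1[OF *])
  show "\<psi> \<in> hom C (latch (Suc n)) B"
    by (rule conjunct1[OF conjunct2[OF *]])
  show "b' \<in> hom C (eob (replicate (Suc n) Z)) B'"
    by (rule conjunct1[OF conjunct2[OF conjunct2[OF *]]])
  show "is_pushout C (latching_map C (Suc n) (Fcube (Suc n))) \<psi> b' \<phi>"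
    by (rule conjunct1[OF conjunct2[OF conjunct2[OF conjunct2[OF *]]]])
  show "\<forall>i\<le>n. \<psi> \<cdot> latch_in (Suc n) (face (Suc n) i) = attach_at n b i"
    by (rule conjunct2[OF conjunct2[OF conjunct2[OF conjunct2[OF *]]]])
qed

lemma attach_unique:
  assumes st: "stage n B b B' b' \<phi> \<psi>" and \<psi>': "\<psi>' \<in> hom C (latch (Suc n)) B"
  shows "(\<forall>i\<le>n. \<psi>' \<cdot> latch_in (Suc n) (face (Suc n) i) = attach_at n b i) \<longleftrightarrow> \<psi>' = \<psi>"
proof -
  note \<psi> = stageD(2)[OF st] and \<psi>_in = stageD(5)[OF st]
  show ?thesis
  proof
    assume eq: "\<forall>i\<le>n. \<psi>' \<cdot> latch_in (Suc n) (face (Suc n) i) = attach_at n b i"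
    show "\<psi>' = \<psi>"
    proof (rule latch_ext[OF \<psi>' \<psi>])
      fix i assume "i < Suc n"
      then have "i \<le> n" by simp
      then show "\<psi>' \<cdot> latch_in (Suc n) (face (Suc n) i) = \<psi> \<cdot> latch_in (Suc n) (face (Suc n) i)"
        using eq[rule_format, of i] \<psi>_in[rule_format, of i] by (simp only:)
    qed
  next
    assume "\<psi>' = \<psi>"
    then show "\<forall>i\<le>n. \<psi>' \<cdot> latch_in (Suc n) (face (Suc n) i) = attach_at n b i"
      using \<psi>_in by (simp only:)
  qed
qed

lemma attach_at_unfold:
  assumes b: "b \<in> hom C (eob (replicate n Z)) B" and i: "i \<le> n"
  shows "attach_at n b i = b \<cdot> ecomp (replicate i Z) [] (replicate (n - i) Z)
    \<cdot> earr (replicate i (Ide C Z) @ [gbar] @ replicate (n - i) (Ide C Z))"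
proof -
  have "replicate i Z @ replicate (n - i) Z = replicate n Z"
    using i by (simp flip: replicate_add)
  then show ?thesis
    using homD[OF b] by (simp add: attach_at_def attach_def)
qed

text \<open>The slots \<open>1, \<dots>, Suc n\<close> of an operation correspond to the coordinates \<open>0, \<dots>, n\<close> of the cube.\<close>
lemma stage_attaching_map:
  assumes st: "stage n B b B' b' \<phi> \<psi>" and b: "b \<in> hom C (eob (replicate n Z)) B"
    and \<psi>': "\<psi>' \<in> hom C (latch (Suc n)) B"
  shows "(\<forall>i\<in>{1..Suc n}. \<psi>' \<cdot> latch_in (Suc n) (replicate (i - 1) True @ [False] @ replicate (Suc n - i) True)
      = b \<cdot> ecomp (replicate (i - 1) Z) [] (replicate (Suc n - i) Z)
        \<cdot> earr (replicate (i - 1) (Ide C Z) @ [gbar] @ replicate (Suc n - i) (Ide C Z)))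
    \<longleftrightarrow> \<psi>' = \<psi>"
proof -
  let ?E = "\<lambda>i. \<psi>' \<cdot> latch_in (Suc n) (replicate (i - 1) True @ [False] @ replicate (Suc n - i) True)
      = b \<cdot> ecomp (replicate (i - 1) Z) [] (replicate (Suc n - i) Z)
        \<cdot> earr (replicate (i - 1) (Ide C Z) @ [gbar] @ replicate (Suc n - i) (Ide C Z))"
  have E: "?E (Suc i) \<longleftrightarrow> \<psi>' \<cdot> latch_in (Suc n) (face (Suc n) i) = attach_at n b i" if "i \<le> n" for i
    unfolding attach_at_unfold[OF b that] using face_eq[of i "n - i"] that by simp
  have "(\<forall>i\<in>{1..Suc n}. ?E i) \<longleftrightarrow> (\<forall>i\<le>n. ?E (Suc i))"
  proof (intro iffI ballI allI impI)
    fix i assume *: "\<forall>i\<in>{1..Suc n}. ?E i" "i \<le> n"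
    show "?E (Suc i)" by (rule bspec[OF *(1)]) (use *(2) in simp)
  next
    fix i assume *: "\<forall>i\<le>n. ?E (Suc i)" "i \<in> {1..Suc n}"
    then obtain k where k: "i = Suc k" "k \<le> n" by (cases i) auto
    show "?E i"
      unfolding k(1) by (rule *(1)[rule_format, OF k(2)])
  qed
  also have "\<dots> \<longleftrightarrow> (\<forall>i\<le>n. \<psi>' \<cdot> latch_in (Suc n) (face (Suc n) i) = attach_at n b i)"
    using E by blast
  also have "\<dots> \<longleftrightarrow> \<psi>' = \<psi>"
    by (rule attach_unique[OF st \<psi>'])
  finally show ?thesis .
qed

end

lemma adjoint_hom:
  assumes "adjunction C E F G \<Phi>" "X \<in> Obj C" "Y \<in> Obj E" "g \<in> hom E (FOb F X) Y"
  shows "\<Phi> X Y g \<in> hom C X (FOb G Y)"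
  using assms unfolding adjunction_def by (blast dest: bij_betwE)

theorem lemma8p1:
  fixes V :: "('ov, 'mv) braided"
    and C :: "('oc, 'mc) monoidal"
    and z :: "('ov, 'mv, 'oc, 'mc) central"
    and P :: "('ov, 'mv) operad"
    and A :: "'oc \<times> (nat \<Rightarrow> 'mc)"
    and F :: "('oc, 'mc, 'oc \<times> (nat \<Rightarrow> 'mc),
               ('oc \<times> (nat \<Rightarrow> 'mc)) \<times> 'mc \<times> ('oc \<times> (nat \<Rightarrow> 'mc))) func"
    and \<Phi> :: "'oc \<Rightarrow> 'oc \<times> (nat \<Rightarrow> 'mc)
               \<Rightarrow> ('oc \<times> (nat \<Rightarrow> 'mc)) \<times> 'mc \<times> ('oc \<times> (nat \<Rightarrow> 'mc)) \<Rightarrow> 'mc"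
    and Y Z :: 'oc and f :: 'mc
    and g :: "('oc \<times> (nat \<Rightarrow> 'mc)) \<times> 'mc \<times> ('oc \<times> (nat \<Rightarrow> 'mc))"
    and gbar :: 'mc
    and PA :: "('oc, 'mc) functor_operad"
    and D :: "nat \<Rightarrow> (bool list, bool list \<times> bool list, 'oc, 'mc) func"
  assumes universe: "infinite (UNIV :: 'u set)"
    and V: "symmetric_monoidal_category V" "closed_monoidal V" "bicomplete TYPE('u) V"
    and C: "monoidal_category C" "biclosed C" "bicomplete TYPE('u) C"
    and z: "central_functor V C z" "has_right_adjoint V C z"
    and P: "operad V P"
    and A: "is_algebra C z P A"
    and free: "adjunction C (algebras C z P) F forgetful \<Phi>"
    and f: "f \<in> hom C Y Z"
    and g: "g \<in> hom (algebras C z P) (FOb F Y) A"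
  defines "gbar \<equiv> \<Phi> Y A g"
    and "PA \<equiv> enveloping C z P A"
    and "D \<equiv> \<lambda>t. cube_functor C (FOOb PA) (FOArr PA) (replicate t f)"
  shows "\<exists>(B :: nat \<Rightarrow> 'oc) (\<phi> :: nat \<Rightarrow> 'mc) (\<psi> :: nat \<Rightarrow> 'mc) (\<psi>bar :: nat \<Rightarrow> 'mc).
    B 0 = fst A \<and>
    (\<forall>t \<ge> 1.
       \<phi> t \<in> hom C (B (t - 1)) (B t) \<and>
       \<psi> t \<in> hom C (fst (latching C t (D t))) (B (t - 1)) \<and>
       \<psi>bar t \<in> hom C (FOOb PA (replicate t Z)) (B t) \<and>
       latching_map C t (D t) \<in> hom C (fst (latching C t (D t))) (FOOb PA (replicate t Z)) \<and>
       is_pushout C (latching_map C t (D t)) (\<psi> t) (\<psi>bar t) (\<phi> t) \<and>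
       (\<forall>\<psi>'. \<psi>' \<in> hom C (fst (latching C t (D t))) (B (t - 1)) \<longrightarrow>
          (\<forall>i \<in> {1..t}.
             \<psi>' \<cdot>\<^bsub>C\<^esub> snd (latching C t (D t))
                        (replicate (i - 1) True @ [False] @ replicate (t - i) True)
             = (if t > 1 then \<psi>bar (t - 1) else Ide C (fst A))
               \<cdot>\<^bsub>C\<^esub> FOComp PA (replicate (i - 1) Z) [] (replicate (t - i) Z)
               \<cdot>\<^bsub>C\<^esub> FOArr PA (replicate (i - 1) (Ide C Z) @ [gbar] @ replicate (t - i) (Ide C Z)))
          \<longleftrightarrow> \<psi>' = \<psi> t))"
proof -
  obtain A0 \<alpha> where A_eq: "A = (A0, \<alpha>)"
    by (cases A)
  interpret C: monoidal_category C
    by (rule C(1))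
  have Y: "Y \<in> Obj C"
    using C.Obj_of_hom(1)[OF f] .
  have "gbar \<in> hom C Y (FOb forgetful A)"
    unfolding gbar_def by (rule adjoint_hom[OF free Y _ g]) (simp add: algebras_def A)
  then have gbar: "gbar \<in> hom C Y A0"
    by (simp add: forgetful_def A_eq)
  interpret attaching C V z P A0 \<alpha> Y Z f gbar
  proof (intro attaching.intro operad_algebra.intro operad_central.intro attaching_axioms.intro
      operad_algebra_axioms.intro operad_central_axioms.intro)
    show "monoidal_category C" "Defs.operad V P" "central_functor V C z" "is_algebra C z P (A0, \<alpha>)"
      "f \<in> hom C Y Z" "gbar \<in> hom C Y A0"
      using C(1) P z(1) A f gbar by (simp_all add: A_eq)
  qed (rule C.countable_coproduct[OF universe C(3)] C.coequalizer_exists[OF universe C(3)]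
      C.pushout_exists[OF universe C(3)] countable_colimit[OF universe C(3)]; assumption)+
  have PA: "FOOb PA = eob" "FOArr PA = earr" "FOComp PA = ecomp"
    by (simp_all add: PA_def enveloping_def A_eq)
  have D_eq: "D = Fcube"
    by (rule ext) (simp add: D_def Fcube_def PA)
  obtain B b \<phi> \<psi> where B0: "B 0 = A0" and b0: "b 0 = Ide C A0"
    and stages: "\<And>n. stage n (B n) (b n) (B (Suc n)) (b (Suc n)) (\<phi> (Suc n)) (\<psi> (Suc n))"
    using stages_exist by (elim exE conjE) blast
  note st = stageD(1-4)[OF stages]
  have b: "b n \<in> hom C (eob (replicate n Z)) (B n)" for n
  proof (cases n)
    case 0
    then show ?thesis using C.Ide_hom[OF A_Obj] by (simp add: B0 b0)
  next
    case (Suc k)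
    show ?thesis unfolding Suc by (rule st(3))
  qed
  show ?thesis
    unfolding PA D_eq A_eq fst_conv
  proof (rule exI[of _ B], rule exI[of _ \<phi>], rule exI[of _ \<psi>], rule exI[of _ b], intro conjI allI impI)
    show "B 0 = A0" by (rule B0)
    fix t :: nat assume "1 \<le> t"
    then obtain n where t: "t = Suc n" by (cases t) auto
    have n: "t - 1 = n" by (simp add: t)
    have b_n: "(if t > 1 then b (t - 1) else Ide C A0) = b n"
      using b0 by (cases n) (simp_all add: t)
    show "\<phi> t \<in> hom C (B (t - 1)) (B t)" "\<psi> t \<in> hom C (latch t) (B (t - 1))"
      "b t \<in> hom C (eob (replicate t Z)) (B t)"
      "is_pushout C (latching_map C t (Fcube t)) (\<psi> t) (b t) (\<phi> t)"
      unfolding n unfolding t by (rule st)+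
    show "latching_map C t (Fcube t) \<in> hom C (latch t) (eob (replicate t Z))"
      using latching_map(1)[of t] unfolding vertex_top .
    fix \<psi>' assume "\<psi>' \<in> hom C (latch t) (B (t - 1))"
    then have \<psi>': "\<psi>' \<in> hom C (latch (Suc n)) (B n)"
      unfolding n unfolding t .
    show "(\<forall>i\<in>{1..t}. \<psi>' \<cdot>\<^bsub>C\<^esub> latch_in t (replicate (i - 1) True @ [False] @ replicate (t - i) True)
        = (if t > 1 then b (t - 1) else Ide C A0)
          \<cdot>\<^bsub>C\<^esub> ecomp (replicate (i - 1) Z) [] (replicate (t - i) Z)
          \<cdot>\<^bsub>C\<^esub> earr (replicate (i - 1) (Ide C Z) @ [gbar] @ replicate (t - i) (Ide C Z)))
      \<longleftrightarrow> \<psi>' = \<psi> t"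
      unfolding b_n unfolding t by (rule stage_attaching_map[OF stages b \<psi>'])
  qed
qed

end
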